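(* Let $K$ be a field of characteristic $0$, let $f,g\in K[X]$ have degree greater than one, and let $x_0,y_0\in K$. Assume there is no linear $\mu\in\overline{K}[X]$ such that $\mu^{\circ(-1)}(x_0)\in\overline{\mathbb{Q}}$, $\mu^{\circ(-1)}(y_0)\in\overline{\mathbb{Q}}$, and both $\mu^{\circ(-1)}\circ f\circ\mu$ and $\mu^{\circ(-1)}\circ g\circ\mu$ lie in $\overline{\mathbb{Q}}[X]$. If $\mathcal{O}_f(x_0)\cap\mathcal{O}_g(y_0)$ is infinite, then $f$ and $g$ have a common iterate, i.e. $f^{\circ a}=g^{\circ b}$ for some positive integers $a,b$.
   Context: $\overline K$ is an algebraic closure of $K$ and $\overline{\mathbb{Q}}$ denotes the algebraic closure of $\mathbb{Q}$ inside $\overline K$. $f^{\circ n}$ denotes the $n$-th iterate under composition, and $\mathcal{O}_f(x_0)=\{f^{\circ n}(x_0):n\ge 0\}$. A linear polynomial has degree exactly $1$ and $\mu^{\circ(-1)}$ is its compositional inverse. *)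

theory Defs
  imports "HOL-Computational_Algebra.Polynomial"
begin

text \<open>K is modelled as a subfield of an ambient algebraically closed field of characteristic 0.\<close>

definition is_subfield :: "'a::field set \<Rightarrow> bool" where
  "is_subfield K \<longleftrightarrow> 0 \<in> K \<and> 1 \<in> K \<and>
     (\<forall>x\<in>K. \<forall>y\<in>K. x + y \<in> K \<and> x * y \<in> K) \<and>
     (\<forall>x\<in>K. - x \<in> K \<and> inverse x \<in> K)"

definition alg_closure_in :: "'a::field set \<Rightarrow> 'a set" where
  "alg_closure_in K = {x. \<exists>p. p \<noteq> 0 \<and> (\<forall>i. coeff p i \<in> K) \<and> poly p x = 0}"

definition Qbar :: "'a::field_char_0 set" where
  "Qbar = {x. algebraic x}"

definition poly_iter :: "'a::comm_ring_1 poly \<Rightarrow> nat \<Rightarrow> 'a poly" where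
  "poly_iter f n = ((\<lambda>q. pcompose f q) ^^ n) [:0, 1:]"

definition orbit :: "'a::comm_ring_1 poly \<Rightarrow> 'a \<Rightarrow> 'a set" where
  "orbit f x0 = {(poly f ^^ n) x0 | n. True}"

definition lin_inv :: "'a::field poly \<Rightarrow> 'a poly" where
  "lin_inv mu = [: - coeff mu 0 / coeff mu 1, 1 / coeff mu 1 :]"

end

theory Submission
  imports Defs Complex_Main "HOL-Number_Theory.Cong"
begin

text \<open>
  After conjugation \<open>f\<close> is monic and centred, and Zorn's lemma gives an algebraically closed field \<open>k\<close> that
  does not contain all the data, while all the data are algebraic over \<open>k(t)\<close> for every \<open>t\<close> outside \<open>k\<close>.
  Places are valuation rings containing \<open>k\<close>; their residue characteristic is 0.

  Suppose first that both orbits are bounded at every place. At a place where a coefficient of \<open>f\<close> has a pole,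
  every orbit point is congruent modulo the maximal ideal to one of the finitely many roots of \<open>f \<circ> f\<close>. Because the
  orbit lies in a finite extension of \<open>k(a)\<close>, for a coefficient \<open>a\<close>, infinitely many orbit points are congruent
  to each other at all such places at once. Their differences are integral everywhere, hence constant, and they
  vanish somewhere: a contradiction unless there are no bad places, so that \<open>f\<close> and the orbit are
  defined over \<open>k\<close>. The same applies to \<open>g\<close>, contradicting the choice of \<open>k\<close>.

  So one orbit, hence the infinite intersection, escapes at some place. Comparing the valuations in
  \<open>f\<^sup>m(z) = g\<^sup>n(z)\<close>, with \<open>d = deg f\<close>, \<open>e = deg g\<close>, leads to a Pillai equation \<open>a d\<^sup>m - b e\<^sup>n = c\<close> with infinitely many
  solutions. Such an equation forces \<open>c = 0\<close>, by Pade approximation of a fifth root of a number close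
  to 1, and this means \<open>d\<^sup>m = e\<^sup>n\<close>. Hence some iterates \<open>F\<close> and \<open>G\<close> have equal degree and satisfy
  \<open>F\<^sup>l(z) = G\<^sup>l(z)\<close> for infinitely many \<open>l\<close>. In residue characteristic 0 taking powers preserves the distance of
  a unit from 1; this shows that the leading coefficient of \<open>G\<close> is a root of unity and, after a further
  iteration, that \<open>F = G\<close>.
\<close>

section \<open>Divided differences of the exponential function\<close>

text \<open>Two facts replace heights. An element of every valuation ring over the algebraically
  closed \<open>k\<close> lies in \<open>k\<close>. Finite dimension over k(a) bounds the length of
  triangular families of differences, which handles all bad places together without knowing that
  they are finite in number. In the Pillai step the usual obstacle is to show that an integer linear
  form does not vanish. Here the Pade remainder is a divided difference of \<open>exp\<close>, hence
  positive with an explicit lower bound, so neighbouring approximants need not be compared. With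
  r-th roots the k-th approximant excludes a second solution y1 roughly between y0^(2k+1) and
  y0^(rk+r-1); the choice r = 5 makes these ranges overlap enough to absorb all constants into
  powers of y0.\<close>

lemma lagrange_weights_sum_eq_0:
  fixes w :: "nat \<Rightarrow> 'a::field"
  assumes "inj_on w {..n}" "n \<ge> 1"
  shows "(\<Sum>i\<le>n. 1 / (\<Prod>l\<in>{..n}-{i}. w i - w l)) = 0"
proof -
  define q where "q i = (\<Prod>l\<in>{..n}-{i}. [:- w l, 1:])" for i
  define c where "c i = 1 / (\<Prod>l\<in>{..n}-{i}. w i - w l)" for i
  have pq: "poly (q i) x = (\<Prod>l\<in>{..n}-{i}. x - w l)" for i x
    by (simp add: q_def poly_prod)
  have deg: "degree (q i) = n" if "i \<le> n" for i
    using that by (simp add: q_def degree_prod_sum_eq)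
  have lc: "lead_coeff (q i) = 1" for i
    unfolding q_def lead_coeff_prod by simp
  \<comment> \<open>\<open>L\<close> is the Lagrange interpolant of the constant 1, hence equal to
    1, and the sum of the weights is its coefficient of degree \<open>n\<close>.\<close>
  define L where "L = (\<Sum>i\<le>n. smult (c i) (q i))"
  have dL: "degree L \<le> n"
    unfolding L_def by (intro degree_sum_le) (auto simp: deg degree_smult_eq)
  have "L = 1"
  proof (rule poly_eqI_degree)
    fix x assume "x \<in> w ` {..n}"
    then obtain j where j: "j \<le> n" "x = w j" by auto
    have "poly L x = (\<Sum>i\<le>n. if i = j then 1 else 0)"
      unfolding L_def poly_sum
    proof (rule sum.cong)
      fix i assume i: "i \<in> {..n}"
      show "poly (smult (c i) (q i)) x = (if i = j then 1 else 0)"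
      proof (cases "i = j")
        case True
        have "(\<Prod>l\<in>{..n}-{j}. w j - w l) \<noteq> 0"
          using assms j by (auto simp: inj_on_def)
        then show ?thesis using True j by (simp add: pq c_def)
      next
        case False
        have "(\<Prod>l\<in>{..n}-{i}. w j - w l) = 0"
          using False j by (intro prod_zero) auto
        then show ?thesis using False j by (simp add: pq)
      qed
    qed simp
    then show "poly L x = poly 1 x" using j by simp
  next
    show "card (w ` {..n}) > degree L" using dL assms by (simp add: card_image)
    show "card (w ` {..n}) > degree (1 :: 'a poly)" using assms by (simp add: card_image)
  qed
  then have "coeff L n = 0" using assms(2) by simp
  moreover have "coeff L n = (\<Sum>i\<le>n. c i)"
    unfolding L_def coeff_sum using deg lc by (intro sum.cong) auto
  ultimately show ?thesis by (simp add: c_def)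
qed

text \<open>The divided difference of \<open>\<lambda>t. exp (t * u)\<close> at the nodes
  \<open>w 0, ..., w n\<close>, read as a function of \<open>u\<close> for fixed nodes.\<close>

definition exp_divdiff :: "(nat \<Rightarrow> real) \<Rightarrow> nat \<Rightarrow> real \<Rightarrow> real" where
  "exp_divdiff w n u = (\<Sum>i\<le>n. exp (w i * u) / (\<Prod>l\<in>{..n}-{i}. w i - w l))"

text \<open>Differentiation in \<open>u\<close> brings down
  \<open>w i = w (Suc n) + (w i - w (Suc n))\<close>; the second summand cancels the factor of the
  last node and lowers the order by one. The resulting linear differential equation permits
  induction on the number of nodes.\<close>

lemma exp_divdiff_deriv:
  assumes "inj_on w {..Suc n}"
  shows "(exp_divdiff w (Suc n) has_real_derivative
           (w (Suc n) * exp_divdiff w (Suc n) u + exp_divdiff w n u)) (at u)"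
proof -
  let ?P = "\<lambda>i. \<Prod>l\<in>{..Suc n}-{i}. w i - w l"
  have "(exp_divdiff w (Suc n) has_real_derivative (\<Sum>i\<le>Suc n. exp (w i * u) * w i / ?P i)) (at u)"
    unfolding exp_divdiff_def[abs_def]
    using assms by (auto intro!: derivative_eq_intros sum.cong DERIV_cdivide simp del: sum.atMost_Suc simp: divide_inverse)
  also have "(\<Sum>i\<le>Suc n. exp (w i * u) * w i / ?P i) =
      (\<Sum>i\<le>Suc n. w (Suc n) * (exp (w i * u) / ?P i) + (w i - w (Suc n)) * (exp (w i * u) / ?P i))"
    by (intro sum.cong) (auto simp: algebra_simps diff_divide_distrib)
  also have "\<dots> = w (Suc n) * exp_divdiff w (Suc n) u
      + (\<Sum>i\<le>n. (w i - w (Suc n)) * (exp (w i * u) / ?P i))"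
    unfolding sum.distrib exp_divdiff_def sum_distrib_left[symmetric] by simp
  also have "(\<Sum>i\<le>n. (w i - w (Suc n)) * (exp (w i * u) / ?P i)) = exp_divdiff w n u"
    unfolding exp_divdiff_def
  proof (rule sum.cong)
    fix i assume i: "i \<in> {..n}"
    have "{..Suc n} - {i} = insert (Suc n) ({..n} - {i})" using i by auto
    then have "?P i = (w i - w (Suc n)) * (\<Prod>l\<in>{..n}-{i}. w i - w l)" by simp
    moreover have "w i \<noteq> w (Suc n)" using inj_onD[OF assms, of i "Suc n"] i by auto
    ultimately show "(w i - w (Suc n)) * (exp (w i * u) / ?P i) =
        exp (w i * u) / (\<Prod>l\<in>{..n}-{i}. w i - w l)" by simp
  qed simp
  finally show ?thesis .
qed

lemma exp_divdiff_0_right: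
  assumes "inj_on w {..Suc n}" shows "exp_divdiff w (Suc n) 0 = 0"
  using lagrange_weights_sum_eq_0[OF assms] by (simp add: exp_divdiff_def)

text \<open>The integrating factor \<open>exp (- (\<omega> * s))\<close> turns the differential
  inequality into monotonicity.\<close>

lemma nonneg_if_deriv_ge:
  fixes \<phi> :: "real \<Rightarrow> real"
  assumes d: "\<And>s. (\<phi> has_real_derivative D s) (at s)"
    and D: "\<And>s. 0 \<le> s \<Longrightarrow> D s \<ge> \<omega> * \<phi> s" and "\<phi> 0 = 0" "u \<ge> 0"
  shows "\<phi> u \<ge> 0"
proof -
  have "exp (- (\<omega> * 0)) * \<phi> 0 \<le> exp (- (\<omega> * u)) * \<phi> u"
  proof (rule DERIV_nonneg_imp_nondecreasing[OF assms(4)])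
    fix x assume x: "0 \<le> x" "x \<le> u"
    have "((\<lambda>s. exp (- (\<omega> * s)) * \<phi> s) has_real_derivative
        exp (- (\<omega> * x)) * (D x - \<omega> * \<phi> x)) (at x)"
      by (auto intro!: derivative_eq_intros d simp: algebra_simps)
    moreover have "exp (- (\<omega> * x)) * (D x - \<omega> * \<phi> x) \<ge> 0" using D[OF x(1)] by simp
    ultimately show "\<exists>y. ((\<lambda>s. exp (- (\<omega> * s)) * \<phi> s) has_real_derivative y) (at x) \<and> 0 \<le> y"
      by blast
  qed
  then show ?thesis using assms(3) by (simp add: zero_le_mult_iff)
qed

text \<open>These are the bounds that the mean value form u^n exp(xi u) / n! with 0 <= xi <= W would
  give. They follow by comparing each bound with the solution of the differential equation, both
  starting from 0.\<close>

lemma exp_divdiff_bounds: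
  assumes "inj_on w {..n}" "\<And>i. i \<le> n \<Longrightarrow> 0 \<le> w i \<and> w i \<le> W" "u \<ge> 0"
  shows "u ^ n / fact n \<le> exp_divdiff w n u \<and> exp_divdiff w n u \<le> u ^ n / fact n * exp (W * u)"
  using assms
proof (induction n arbitrary: u)
  case 0
  then show ?case by (auto simp: exp_divdiff_def intro!: mult_right_mono)
next
  case (Suc n)
  have inj: "inj_on w {..n}" using Suc.prems(1) by (rule inj_on_subset) auto
  have IH: "s ^ n / fact n \<le> exp_divdiff w n s \<and> exp_divdiff w n s \<le> s ^ n / fact n * exp (W * s)"
    if "s \<ge> 0" for s
    using Suc.prems(2) that by (intro Suc.IH inj) auto
  note d = exp_divdiff_deriv[OF Suc.prems(1)]
  note z = exp_divdiff_0_right[OF Suc.prems(1)]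
  have pd: "((\<lambda>s. s ^ Suc n / fact (Suc n)) has_real_derivative (s ^ n / fact n)) (at s)" for s :: real
  proof -
    have "real (Suc n) * s ^ n / fact (Suc n) = s ^ n / fact n"
      unfolding fact_Suc by (simp del: of_nat_Suc)
    then show ?thesis using DERIV_cdivide[OF DERIV_pow[of "Suc n" s UNIV], of "fact (Suc n)"] by simp
  qed
  have w: "0 \<le> w (Suc n)" "w (Suc n) \<le> W" using Suc.prems(2)[of "Suc n"] by auto
  have 1: "exp_divdiff w (Suc n) s - s ^ Suc n / fact (Suc n) \<ge> 0" if "s \<ge> 0" for s
  proof (rule nonneg_if_deriv_ge[where \<omega> = "w (Suc n)" and u = s and
      \<phi> = "\<lambda>s. exp_divdiff w (Suc n) s - s ^ Suc n / fact (Suc n)" and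
      D = "\<lambda>s. w (Suc n) * exp_divdiff w (Suc n) s + exp_divdiff w n s - s ^ n / fact n"])
    show "((\<lambda>s. exp_divdiff w (Suc n) s - s ^ Suc n / fact (Suc n)) has_real_derivative
        (w (Suc n) * exp_divdiff w (Suc n) s + exp_divdiff w n s - s ^ n / fact n)) (at s)" for s
      by (intro DERIV_diff d pd)
    show "w (Suc n) * (exp_divdiff w (Suc n) s - s ^ Suc n / fact (Suc n))
        \<le> w (Suc n) * exp_divdiff w (Suc n) s + exp_divdiff w n s - s ^ n / fact n" if "s \<ge> 0" for s
    proof -
      have "w (Suc n) * (s ^ Suc n / fact (Suc n)) \<ge> 0" using w that by simp
      then show ?thesis using IH[OF that] unfolding right_diff_distrib by linarith
    qed
  qed (use z that in auto)
  have 2: "s ^ Suc n / fact (Suc n) * exp (W * s) - exp_divdiff w (Suc n) s \<ge> 0" if "s \<ge> 0" for s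
  proof (rule nonneg_if_deriv_ge[where \<omega> = "w (Suc n)" and u = s and
      \<phi> = "\<lambda>s. s ^ Suc n / fact (Suc n) * exp (W * s) - exp_divdiff w (Suc n) s" and
      D = "\<lambda>s. s ^ n / fact n * exp (W * s) + W * (s ^ Suc n / fact (Suc n) * exp (W * s))
         - (w (Suc n) * exp_divdiff w (Suc n) s + exp_divdiff w n s)"])
    show "((\<lambda>s. s ^ Suc n / fact (Suc n) * exp (W * s) - exp_divdiff w (Suc n) s) has_real_derivative
        (s ^ n / fact n * exp (W * s) + W * (s ^ Suc n / fact (Suc n) * exp (W * s))
         - (w (Suc n) * exp_divdiff w (Suc n) s + exp_divdiff w n s))) (at s)" for s
      by (intro DERIV_diff d) (rule derivative_eq_intros refl pd | simp)+
    show "w (Suc n) * (s ^ Suc n / fact (Suc n) * exp (W * s) - exp_divdiff w (Suc n) s)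
        \<le> s ^ n / fact n * exp (W * s) + W * (s ^ Suc n / fact (Suc n) * exp (W * s))
         - (w (Suc n) * exp_divdiff w (Suc n) s + exp_divdiff w n s)" if "s \<ge> 0" for s
    proof -
      have "w (Suc n) * (s ^ Suc n / fact (Suc n) * exp (W * s))
          \<le> W * (s ^ Suc n / fact (Suc n) * exp (W * s))"
        using w that by (intro mult_right_mono) auto
      then show ?thesis using IH[OF that] unfolding right_diff_distrib by linarith
    qed
  qed (use z that in auto)
  show ?case using 1[OF Suc.prems(3)] 2[OF Suc.prems(3)] by linarith
qed

section \<open>Powers of 5 in factorials\<close>

lemma fact_5_mult:
  "\<exists>m. (fact (5 * j) :: nat) = 5 ^ j * fact j * m \<and> \<not> 5 dvd m"
proof (induction j)
  case (Suc j)
  then obtain m where m: "(fact (5 * j) :: nat) = 5 ^ j * fact j * m" "\<not> 5 dvd m" by blast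
  have e: "5 * Suc j = Suc (Suc (Suc (Suc (Suc (5 * j)))))" by simp
  have "(fact (5 * Suc j) :: nat) = 5 ^ Suc j * fact (Suc j) *
      (m * (5*j+1) * (5*j+2) * (5*j+3) * (5*j+4))"
    unfolding e fact_Suc m(1) by (simp add: algebra_simps)
  moreover have "\<not> 5 dvd (m * (5*j+1) * (5*j+2) * (5*j+3) * (5*j+4))"
  proof -
    have p: "prime (5::nat)" by simp
    have "\<not> 5 dvd 5*j+1" "\<not> 5 dvd 5*j+2" "\<not> 5 dvd 5*j+3" "\<not> 5 dvd 5*j+4" by presburger+
    then show ?thesis using m(2) by (simp only: prime_dvd_mult_iff[OF p]) simp
  qed
  ultimately show ?case by blast
qed (auto intro: exI[of _ 1])

text \<open>Legendre's formula in weak form: each pass divides the argument by 5. The crude bound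
  \<open>v \<le> i\<close> suffices because the next lemma spends a whole factor
  \<open>5 ^ i\<close>.\<close>

lemma fact_5_part: "\<exists>v m. (fact i :: nat) = 5 ^ v * m \<and> \<not> 5 dvd m \<and> v \<le> i"
proof (induction i rule: less_induct)
  case (less i)
  define j where "j = i div 5"
  have p: "prime (5::nat)" by simp
  have aux: "t < 5 \<Longrightarrow> \<exists>m'. (fact (5 * j + t) :: nat) = fact (5 * j) * m' \<and> \<not> 5 dvd m'" for t
  proof (induction t)
    case 0 then show ?case by (auto intro: exI[of _ 1])
  next
    case (Suc t)
    then obtain m' where m': "(fact (5 * j + t) :: nat) = fact (5 * j) * m'" "\<not> 5 dvd m'" by auto
    have "\<not> 5 dvd (5 * j + Suc t)" using Suc.prems by presburger
    then have "\<not> 5 dvd (m' * (5 * j + Suc t))"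
      using m' by (simp only: prime_dvd_mult_iff[OF p]) simp
    moreover have "(fact (5 * j + Suc t) :: nat) = fact (5 * j) * (m' * (5 * j + Suc t))"
      using m' by (simp add: algebra_simps)
    ultimately show ?case by blast
  qed
  have "i = 5 * j + i mod 5" "i mod 5 < 5" by (auto simp: j_def)
  with aux obtain m' where m': "(fact i :: nat) = fact (5 * j) * m'" "\<not> 5 dvd m'" by metis
  obtain m where m: "(fact (5 * j) :: nat) = 5 ^ j * fact j * m" "\<not> 5 dvd m"
    using fact_5_mult by blast
  show ?case
  proof (cases "i = 0")
    case False
    then have "j < i" by (auto simp: j_def)
    then obtain v n where v: "(fact j :: nat) = 5 ^ v * n" "\<not> 5 dvd n" "v \<le> j" using less by blast
    have "(fact i :: nat) = 5 ^ (j + v) * (n * m * m')"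
      using m m' v by (simp add: power_add)
    moreover have "\<not> 5 dvd (n * m * m')" using m m' v by (simp add: prime_dvd_mult_iff[OF p])
    moreover have "j + v \<le> i" using v(3) by (simp add: j_def)
    ultimately show ?thesis by blast
  qed (auto intro: exI[of _ 1])
qed

text \<open>Modulo the part of \<open>i!\<close> prime to 5, division by 5 turns the product into \<open>i!\<close> times a binomial coefficient.\<close>
lemma fact_dvd_prod_step5:
  "(fact i :: int) dvd 5 ^ i * (\<Prod>s<i. a - 5 * int s)"
proof -
  obtain v m where vm: "(fact i :: nat) = 5 ^ v * m" "\<not> 5 dvd m" "v \<le> i"
    using fact_5_part by blast
  have fi: "(fact i :: int) = 5 ^ v * int m"
    using arg_cong[OF vm(1), of int] by simp
  have "coprime (5::nat) m" using vm(2) by (intro prime_imp_coprime) auto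
  then have cop: "coprime (5::int) (int m)" by (metis coprime_int_iff of_nat_numeral)
  then obtain t where t: "[5 * t = 1] (mod int m)"
    using cong_solve_coprime_int by blast
  have "[t ^ i * (\<Prod>s<i. a - 5 * int s) = (\<Prod>s<i. t * a - int s)] (mod int m)"
  proof -
    have "t ^ i * (\<Prod>s<i. a - 5 * int s) = (\<Prod>s<i. t * (a - 5 * int s))"
      by (simp add: prod.distrib)
    also have "[\<dots> = (\<Prod>s<i. t * a - int s)] (mod int m)"
    proof (rule cong_prod)
      fix s
      have "[t * a - (5 * t) * int s = t * a - 1 * int s] (mod int m)"
        by (intro cong_diff cong_mult t cong_refl)
      then show "[t * (a - 5 * int s) = t * a - int s] (mod int m)" by (simp add: algebra_simps)
    qed
    finally show ?thesis .
  qed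
  moreover have "int m dvd (\<Prod>s<i. t * a - int s)"
  proof -
    have "int m dvd fact i" using fi by simp
    also have "fact i dvd (\<Prod>s<i. t * a - int s)"
      unfolding lessThan_atLeast0 gbinomial_int_mult_fact[symmetric] by simp
    finally show ?thesis .
  qed
  ultimately have "int m dvd t ^ i * (\<Prod>s<i. a - 5 * int s)"
    using cong_dvd_iff by blast
  moreover have "coprime (int m) (t ^ i)"
  proof -
    have "coprime (5 * t) (int m)" using t by (metis cong_imp_coprime cong_sym coprime_1_left)
    then show ?thesis by (simp add: coprime_commute)
  qed
  ultimately have "int m dvd (\<Prod>s<i. a - 5 * int s)"
    using coprime_dvd_mult_right_iff by blast
  moreover have "(5::int) ^ v dvd 5 ^ i" using vm(3) by (rule le_imp_power_dvd)
  ultimately show ?thesis unfolding fi by (intro mult_dvd_mono)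
qed

section \<open>Approximation of fifth roots\<close>

text \<open>For \<open>i \<le> k\<close> this is the generalized binomial coefficient (k + v choose
  i). Indexing by \<open>u\<close> keeps every factor positive when |v| < 1.\<close>

definition binom_shift :: "real \<Rightarrow> nat \<Rightarrow> nat \<Rightarrow> real" where
  "binom_shift v k i = (\<Prod>u\<in>{k-i<..k}. real u + v) / fact i"

lemma prod_shift_split:
  fixes h :: "real \<Rightarrow> real"
  assumes "j \<le> k"
  shows "(\<Prod>l\<in>{..k}-{j}. h (real j - real l)) = (\<Prod>u\<in>{0<..j}. h (real u)) * (\<Prod>u\<in>{0<..k-j}. h (- real u))"
proof -
  have "{..k}-{j} = {..<j} \<union> {j<..k}" using assms by auto
  moreover have "(\<Prod>l\<in>{..<j} \<union> {j<..k}. h (real j - real l)) =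
      (\<Prod>l\<in>{..<j}. h (real j - real l)) * (\<Prod>l\<in>{j<..k}. h (real j - real l))"
    by (rule prod.union_disjoint) auto
  ultimately have "(\<Prod>l\<in>{..k}-{j}. h (real j - real l)) =
      (\<Prod>l\<in>{..<j}. h (real j - real l)) * (\<Prod>l\<in>{j<..k}. h (real j - real l))"
    by metis
  also have "(\<Prod>l\<in>{..<j}. h (real j - real l)) = (\<Prod>u\<in>{0<..j}. h (real u))"
    by (rule prod.reindex_bij_witness[of _ "\<lambda>u. j - u" "\<lambda>l. j - l"]) (auto simp: of_nat_diff)
  also have "(\<Prod>l\<in>{j<..k}. h (real j - real l)) = (\<Prod>u\<in>{0<..k-j}. h (- real u))"
    by (rule prod.reindex_bij_witness[of _ "\<lambda>u. u + j" "\<lambda>l. l - j"]) (auto simp: of_nat_diff)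
  finally show ?thesis .
qed

lemma prod_real_fact: "(\<Prod>u\<in>{0<..k}. real u) = fact k"
  unfolding fact_prod of_nat_prod by (intro prod.cong) auto

lemma prod_uminus_shift: "(\<Prod>u\<in>{0<..n}. - real u - v) = (-1) ^ n * (\<Prod>u\<in>{0<..n}. real u + v)"
proof -
  have "(\<Prod>u\<in>{0<..n}. - real u - v) = (\<Prod>u\<in>{0<..n}. (-1) * (real u + v))"
    by (intro prod.cong) auto
  then show ?thesis by (simp only: prod.distrib prod_constant) simp
qed

lemma prod_split_top:
  fixes j k :: nat
  assumes "j \<le> k"
  shows "(\<Prod>u\<in>{0<..k}. h u) = (\<Prod>u\<in>{0<..j}. h u) * (\<Prod>u\<in>{j<..k}. h u :: real)"
proof -
  have "{0<..k} = {0<..j} \<union> {j<..k}" using assms by auto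
  moreover have "prod h ({0<..j} \<union> {j<..k}) = prod h {0<..j} * prod h {j<..k}"
    by (rule prod.union_disjoint) auto
  ultimately show ?thesis by metis
qed

text \<open>The left side is the normalised weight, at the node \<open>j\<close>, of the divided
  difference with nodes 0, ..., k and v, ..., k + v. The numerator is chosen so that it splits into
  two shifted binomials, the signs \<open>(-1) ^ (k - j)\<close> cancelling. The weight at the node
  \<open>j + v\<close> is the case of \<open>- v\<close>.\<close>

lemma node_weight:
  fixes v :: real
  assumes "j \<le> k" "\<bar>v\<bar> < 1" "v \<noteq> 0"
  shows "v * (\<Prod>u\<in>{0<..k}. (real u - v) * (real u + v)) /
      ((\<Prod>l\<in>{..k}-{j}. real j - real l) * (\<Prod>l\<le>k. real j - real l - v))
     = - (binom_shift (- v) k (k - j) * binom_shift v k j)"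
proof -
  let ?M = "\<lambda>n. \<Prod>u\<in>{0<..n}. real u - v" and ?P = "\<lambda>n. \<Prod>u\<in>{0<..n}. real u + v"
  let ?M' = "\<Prod>u\<in>{j<..k}. real u - v" and ?P' = "\<Prod>u\<in>{k-j<..k}. real u + v"
  have "(\<Prod>l\<in>{..k}-{j}. real j - real l) = fact j * ((-1) ^ (k-j) * fact (k-j))"
    using prod_shift_split[OF assms(1), of "\<lambda>x. x"] prod_uminus_shift[of 0 "k-j"]
    by (simp add: prod_real_fact)
  moreover have "(\<Prod>l\<le>k. real j - real l - v) = - v * (?M j * ((-1) ^ (k-j) * ?P (k-j)))"
  proof -
    have "{..k} = insert j ({..k}-{j})" using assms by auto
    then have "(\<Prod>l\<le>k. real j - real l - v) = (real j - real j - v) * (\<Prod>l\<in>{..k}-{j}. real j - real l - v)"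
      by (metis (no_types, lifting) Diff_iff finite_Diff finite_atMost insertCI prod.insert)
    then show ?thesis
      using prod_shift_split[OF assms(1), of "\<lambda>x. x - v"] prod_uminus_shift[of v "k-j"] by simp
  qed
  moreover have "(\<Prod>u\<in>{0<..k}. (real u - v) * (real u + v)) = (?M j * ?M') * (?P (k-j) * ?P')"
    unfolding prod.distrib
    using prod_split_top[OF assms(1), of "\<lambda>u. real u - v"] prod_split_top[of "k-j" k "\<lambda>u. real u + v"]
    by simp
  moreover have "?M j \<noteq> 0" "?P (k-j) \<noteq> 0" using assms(2) by auto
  moreover have "binom_shift (- v) k (k - j) = ?M' / fact (k-j)" "binom_shift v k j = ?P' / fact j"
    using assms(1) by (simp_all add: binom_shift_def)
  ultimately show ?thesis using assms(3) by (simp add: field_simps)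
qed

text \<open>Of 25 = 5 * 5, one factor clears the denominators of the shifted factors and the other
  pays for the powers of 5 in \<open>fact i\<close>.\<close>

lemma binom_shift_int:
  assumes "i \<le> k" "v \<in> {1/5, -(1/5)}"
  shows "\<exists>c::int. 25 ^ i * binom_shift v k i = of_int c"
proof -
  obtain e :: int where e: "v = of_int e / 5"
    using assms(2) that[of 1] that[of "-1"] by auto
  have "(\<Prod>u\<in>{k-i<..k}. real u + v) = (\<Prod>s<i. real k - real s + v)"
    by (rule prod.reindex_bij_witness[of _ "\<lambda>s. k - s" "\<lambda>u. k - u"]) (use assms in \<open>auto simp: of_nat_diff\<close>)
  also have "5 ^ i * \<dots> = (\<Prod>s<i. 5 * (real k - real s + v))"
    unfolding prod.distrib by simp
  also have "\<dots> = of_int (\<Prod>s<i. (5 * int k + e) - 5 * int s)"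
    unfolding of_int_prod by (intro prod.cong) (auto simp: e algebra_simps)
  finally have 1: "5 ^ i * (\<Prod>u\<in>{k-i<..k}. real u + v) = of_int (\<Prod>s<i. (5 * int k + e) - 5 * int s)" .
  obtain c where c: "5 ^ i * (\<Prod>s<i. (5 * int k + e) - 5 * int s) = fact i * c"
    using fact_dvd_prod_step5 by (metis dvdE)
  have "25 ^ i * binom_shift v k i = 5 ^ i * (5 ^ i * (\<Prod>u\<in>{k-i<..k}. real u + v)) / fact i"
    by (simp add: binom_shift_def power_mult_distrib[symmetric])
  also have "\<dots> = of_int (5 ^ i * (\<Prod>s<i. (5 * int k + e) - 5 * int s)) / fact i"
    unfolding 1 by simp
  also have "\<dots> = of_int c" unfolding c by simp
  finally show ?thesis by blast
qed

text \<open>Since |v| < 1, the product is compared factor by factor with the ordinary binomial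
  coefficient (k + 1 choose i).\<close>

lemma binom_shift_bounds:
  assumes "i \<le> k" "\<bar>v\<bar> < 1"
  shows "0 \<le> binom_shift v k i" "binom_shift v k i \<le> 2 ^ Suc k"
proof -
  have nn: "0 \<le> real u + v" if "u \<in> {k-i<..k}" for u
  proof -
    have "u \<ge> 1" using that by auto
    then have "real u \<ge> 1" by simp
    then show ?thesis using assms by linarith
  qed
  show "0 \<le> binom_shift v k i" unfolding binom_shift_def using nn by (intro divide_nonneg_nonneg prod_nonneg) auto
  have "(\<Prod>u\<in>{k-i<..k}. real u + v) \<le> (\<Prod>u\<in>{k-i<..k}. real (Suc u))"
    using nn assms by (intro prod_mono) auto
  also have "\<dots> = (\<Prod>s<i. real (Suc k) - real s)"
    by (rule prod.reindex_bij_witness[of _ "\<lambda>s. k - s" "\<lambda>u. k - u"]) (use assms in \<open>auto simp: of_nat_diff\<close>)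
  also have "\<dots> = fact i * real (Suc k choose i)"
    unfolding binomial_gbinomial gbinomial_mult_fact by (simp add: lessThan_atLeast0)
  finally have "binom_shift v k i \<le> real (Suc k choose i)"
    unfolding binom_shift_def by (simp add: field_simps)
  also have "\<dots> \<le> 2 ^ Suc k" using binomial_le_pow2[of "Suc k" i] by (metis of_nat_le_iff of_nat_numeral of_nat_power)
  finally show "binom_shift v k i \<le> 2 ^ Suc k" .
qed

text \<open>The normalising numerator of \<open>node_weight\<close> at
  \<open>v = 1/5\<close>.\<close>

definition fifth_scale :: "nat \<Rightarrow> real" where
  "fifth_scale k = 1/5 * (\<Prod>u\<in>{0<..k}. (real u - 1/5) * (real u + 1/5))"

text \<open>The lower bound combines u^2 - 1/25 >= (24/25) u^2 with (2k+1)! <= 24^k (k!)^2. Here 24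
  = 6 * 4 comes from 2k+1 <= 6^k and (2k choose k) <= 4^k; the powers of 24 cancel and leave
  25^k.\<close>

lemma fifth_scale_bounds:
  "fifth_scale k / fact (2*k+1) \<le> 1" "1 \<le> 5 * 25 ^ k * (fifth_scale k / fact (2*k+1))"
proof -
  have 1: "(\<Prod>u\<in>{0<..k}. (real u - 1/5) * (real u + 1/5)) \<le> (\<Prod>u\<in>{0<..k}. real u * real u)"
  proof (intro prod_mono conjI)
    fix u assume "u \<in> {0<..k}"
    then have "real u \<ge> 1" by auto
    then show "0 \<le> (real u - 1/5) * (real u + 1/5)" by (intro mult_nonneg_nonneg) auto
    show "(real u - 1/5) * (real u + 1/5) \<le> real u * real u" by (simp add: algebra_simps)
  qed
  also have "\<dots> = fact k * fact k" by (simp add: prod.distrib prod_real_fact)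
  also have "\<dots> \<le> fact (k + k)"
    using dvd_imp_le[OF fact_fact_dvd_fact[of k k]]
    by (metis fact_gt_zero of_nat_fact of_nat_le_iff of_nat_mult)
  also have "\<dots> \<le> fact (2*k+1)" by (intro fact_mono) auto
  finally have "fifth_scale k \<le> 1/5 * fact (2*k+1)"
    unfolding fifth_scale_def by (rule mult_left_mono) simp
  also have "\<dots> \<le> fact (2*k+1)" by simp
  finally show "fifth_scale k / fact (2*k+1) \<le> 1"
    by (subst pos_divide_le_eq) auto
  have "(24/25) ^ k * (fact k * fact k) = (\<Prod>u\<in>{0<..k}. (24/25) * (real u * real u))"
    by (simp only: prod.distrib prod_real_fact prod_constant) simp
  also have "\<dots> \<le> (\<Prod>u\<in>{0<..k}. (real u - 1/5) * (real u + 1/5))"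
  proof (rule prod_mono)
    fix u assume "u \<in> {0<..k}"
    then have "real u \<ge> 1" by auto
    then have "real u * real u \<ge> 1 * 1" by (intro mult_mono) auto
    then show "0 \<le> 24/25 * (real u * real u) \<and> 24/25 * (real u * real u) \<le> (real u - 1/5) * (real u + 1/5)"
      by (auto simp: algebra_simps)
  qed
  finally have 2: "(24/25) ^ k * (fact k * fact k) \<le> 5 * fifth_scale k" by (simp add: fifth_scale_def)
  have "(fact (2*k+1) :: nat) = (2*k+1) * ((2*k choose k) * (fact k * fact k))"
    using binomial_fact_lemma[of k "2*k"] by (simp add: algebra_simps)
  also have "\<dots> \<le> 6 ^ k * (4 ^ k * (fact k * fact k))"
  proof (intro mult_mono)
    show "2*k+1 \<le> 6 ^ k" by (induction k) auto
    show "(2*k choose k) \<le> 4 ^ k" using binomial_le_pow2[of "2*k" k] by (simp add: power_mult)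
  qed auto
  finally have "(fact (2*k+1) :: nat) \<le> 24 ^ k * (fact k * fact k)"
    by (simp add: mult.assoc[symmetric] power_mult_distrib[symmetric])
  then have "real (fact (2*k+1)) \<le> real (24 ^ k * (fact k * fact k))" by (rule of_nat_mono)
  then have "(fact (2*k+1) :: real) \<le> 24 ^ k * (fact k * fact k)"
    by (simp only: of_nat_fact of_nat_mult of_nat_power of_nat_numeral)
  also have "\<dots> = 25 ^ k * ((24/25) ^ k * (fact k * fact k))"
    by (simp add: power_divide)
  also have "\<dots> \<le> 25 ^ k * (5 * fifth_scale k)" using 2 by (intro mult_left_mono) auto
  finally have "1 * fact (2*k+1) \<le> 5 * 25 ^ k * fifth_scale k" by (simp add: mult_ac)
  then have "1 \<le> 5 * 25 ^ k * fifth_scale k / fact (2*k+1)"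
    by (subst pos_le_divide_eq) (auto simp del: fact_Suc)
  then show "1 \<le> 5 * 25 ^ k * (fifth_scale k / fact (2*k+1))" by simp
qed

text \<open>Diagonal Pade approximation of the fifth root, obtained from the divided difference of
  \<open>exp\<close> at the nodes \<open>0, \<dots>, k, 1/5, \<dots>, k + 1/5\<close>.\<close>
lemma fifth_root_pade:
  "\<exists>A B :: nat \<Rightarrow> int. (\<forall>j\<le>k. 0 \<le> B j \<and> B j \<le> 4 * 100 ^ k) \<and>
    (\<forall>u::real. u \<ge> 0 \<longrightarrow> u ^ (2*k+1) / 5 \<le> (\<Sum>j\<le>k. of_int (A j) * exp u ^ j) + exp (u/5) * (\<Sum>j\<le>k. of_int (B j) * exp u ^ j) \<and>
      (\<Sum>j\<le>k. of_int (A j) * exp u ^ j) + exp (u/5) * (\<Sum>j\<le>k. of_int (B j) * exp u ^ j)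
        \<le> 25 ^ k * u ^ (2*k+1) * exp u ^ (k+1))"
proof -
  let ?cA = "\<lambda>j. - (25 ^ k * (binom_shift (- (1/5)) k (k - j) * binom_shift (1/5) k j))"
    and ?cB = "\<lambda>j. 25 ^ k * (binom_shift (1/5) k (k - j) * binom_shift (- (1/5)) k j)"
  define w where "w i = (if i \<le> k then real i else real (i - Suc k) + 1/5)" for i
  \<comment> \<open>The extra \<open>25 ^ k = 25 ^ (k - j) * 25 ^ j\<close> makes both shifted
    binomials in each weight integral at once.\<close>
  define N where "N = 25 ^ k * fifth_scale k"
  define n where "n = 2 * k + 1"
  have inj: "inj_on w {..n}"
  proof (rule inj_onI)
    have *: "real a \<noteq> real b + 1/5" for a b
    proof
      assume "real a = real b + 1/5"
      then have "real (5 * a) = real (5 * b + 1)" by simp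
      then have "5 * a = 5 * b + 1" by (simp only: of_nat_eq_iff)
      then show False by presburger
    qed
    fix x y assume "x \<in> {..n}" "y \<in> {..n}" "w x = w y"
    then show "x = y" using *[of x "y - Suc k"] *[of y "x - Suc k"] by (auto simp: w_def split: if_splits)
  qed
  have wb: "0 \<le> w i \<and> w i \<le> real (k+1)" if "i \<le> n" for i
    using that by (auto simp: w_def n_def)
  have split: "{..n} = {..k} \<union> {Suc k..n}" "{..k} \<inter> {Suc k..n} = {}" by (auto simp: n_def)
  have prodsplit: "(\<Prod>l\<in>{..n}-{i}. h (w l)) = (\<Prod>l\<in>{..k}-{i}. h (real l)) * (\<Prod>l\<le>k. h (real l + 1/5))" if "i \<le> k" for i and h :: "real \<Rightarrow> real"
  proof -
    have "{..n}-{i} = ({..k}-{i}) \<union> {Suc k..n}" using that by (auto simp: n_def)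
    moreover have "(\<Prod>l\<in>({..k}-{i}) \<union> {Suc k..n}. h (w l)) = (\<Prod>l\<in>{..k}-{i}. h (w l)) * (\<Prod>l\<in>{Suc k..n}. h (w l))"
      by (rule prod.union_disjoint) auto
    ultimately have "(\<Prod>l\<in>{..n}-{i}. h (w l)) = (\<Prod>l\<in>{..k}-{i}. h (w l)) * (\<Prod>l\<in>{Suc k..n}. h (w l))"
      by metis
    also have "(\<Prod>l\<in>{..k}-{i}. h (w l)) = (\<Prod>l\<in>{..k}-{i}. h (real l))"
      by (intro prod.cong) (auto simp: w_def)
    also have "(\<Prod>l\<in>{Suc k..n}. h (w l)) = (\<Prod>l\<le>k. h (real l + 1/5))"
      by (rule prod.reindex_bij_witness[of _ "\<lambda>u. u + Suc k" "\<lambda>l. l - Suc k"]) (auto simp: w_def n_def)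
    finally show ?thesis .
  qed
  have prodsplit2: "(\<Prod>l\<in>{..n}-{Suc k+i}. h (w l)) = (\<Prod>l\<le>k. h (real l)) * (\<Prod>l\<in>{..k}-{i}. h (real l + 1/5))" if "i \<le> k" for i and h :: "real \<Rightarrow> real"
  proof -
    have "{..n}-{Suc k+i} = {..k} \<union> ({Suc k..n}-{Suc k+i})" using that by (auto simp: n_def)
    moreover have "(\<Prod>l\<in>{..k} \<union> ({Suc k..n}-{Suc k+i}). h (w l)) = (\<Prod>l\<in>{..k}. h (w l)) * (\<Prod>l\<in>{Suc k..n}-{Suc k+i}. h (w l))"
      by (rule prod.union_disjoint) auto
    ultimately have "(\<Prod>l\<in>{..n}-{Suc k+i}. h (w l)) = (\<Prod>l\<in>{..k}. h (w l)) * (\<Prod>l\<in>{Suc k..n}-{Suc k+i}. h (w l))"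
      by metis
    also have "(\<Prod>l\<in>{..k}. h (w l)) = (\<Prod>l\<in>{..k}. h (real l))"
      by (intro prod.cong) (auto simp: w_def)
    also have "(\<Prod>l\<in>{Suc k..n}-{Suc k+i}. h (w l)) = (\<Prod>l\<in>{..k}-{i}. h (real l + 1/5))"
      by (rule prod.reindex_bij_witness[of _ "\<lambda>u. u + Suc k" "\<lambda>l. l - Suc k"]) (auto simp: w_def n_def)
    finally show ?thesis .
  qed
  \<comment> \<open>The nodes \<open>j\<close> contribute powers of \<open>exp u\<close>, and the
    nodes \<open>j + 1/5\<close> the same powers with the common factor
    \<open>exp (u/5)\<close>.\<close>
  have dd: "N * exp_divdiff w n u =
     (\<Sum>j\<le>k. ?cA j * exp u ^ j)
     + exp (u/5) * (\<Sum>j\<le>k. ?cB j * exp u ^ j)" for u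
  proof -
    let ?t = "\<lambda>i. exp (w i * u) / (\<Prod>l\<in>{..n}-{i}. w i - w l)"
    have "exp_divdiff w n u = (\<Sum>i\<le>k. ?t i) + (\<Sum>i\<in>{Suc k..n}. ?t i)"
      unfolding exp_divdiff_def split(1) by (rule sum.union_disjoint) auto
    also have "(\<Sum>i\<in>{Suc k..n}. ?t i) = (\<Sum>i\<le>k. ?t (Suc k + i))"
      by (rule sum.reindex_bij_witness[of _ "\<lambda>u. Suc k + u" "\<lambda>l. l - Suc k"]) (auto simp: n_def)
    finally have "N * exp_divdiff w n u = (\<Sum>i\<le>k. N * ?t i) + (\<Sum>i\<le>k. N * ?t (Suc k + i))"
      by (simp only: distrib_left sum_distrib_left)
    also have "(\<Sum>i\<le>k. N * ?t i) = (\<Sum>j\<le>k. ?cA j * exp u ^ j)"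
    proof (rule sum.cong)
      fix j assume "j \<in> {..k}"
      then have j: "j \<le> k" by simp
      have w: "w j = real j" using j by (simp add: w_def)
      have e: "exp (w j * u) = exp u ^ j" by (simp add: w exp_of_nat_mult)
      have "N * ?t j = 25 ^ k * (fifth_scale k / (\<Prod>l\<in>{..n}-{j}. w j - w l)) * exp u ^ j"
        by (simp add: N_def e)
      also have "fifth_scale k / (\<Prod>l\<in>{..n}-{j}. w j - w l) = - (binom_shift (- (1/5)) k (k - j) * binom_shift (1/5) k j)"
        unfolding fifth_scale_def w prodsplit[OF j, of "\<lambda>y. real j - y"]
        using node_weight[OF j, of "1/5"] by (simp add: diff_diff_eq)
      finally show "N * ?t j = ?cA j * exp u ^ j" by simp
    qed simp
    also have "(\<Sum>i\<le>k. N * ?t (Suc k + i)) = (\<Sum>j\<le>k. exp (u/5) * (?cB j * exp u ^ j))"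
    proof (rule sum.cong)
      fix j assume "j \<in> {..k}"
      then have j: "j \<le> k" by simp
      have w: "w (Suc k + j) = real j + 1/5" using j by (simp add: w_def)
      have e: "exp (w (Suc k + j) * u) = exp (u/5) * exp u ^ j"
        unfolding w distrib_right exp_add exp_of_nat_mult by simp
      have "N * ?t (Suc k + j) = 25 ^ k * (fifth_scale k / (\<Prod>l\<in>{..n}-{Suc k + j}. w (Suc k + j) - w l)) * (exp (u/5) * exp u ^ j)"
        unfolding e N_def by simp
      also have "fifth_scale k / (\<Prod>l\<in>{..n}-{Suc k + j}. w (Suc k + j) - w l) = binom_shift (1/5) k (k - j) * binom_shift (- (1/5)) k j"
      proof -
        have "(\<Prod>u\<in>{0<..k}. (real u - - (1/5)) * (real u + - (1/5))) = (\<Prod>u\<in>{0<..k}. (real u - 1/5) * (real u + 1/5))"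
          by (intro prod.cong) auto
        moreover have "(\<Prod>l\<le>k. real j - real l - - (1/5)) = (\<Prod>l\<le>k. real j + 1/5 - real l)"
          by (intro prod.cong) auto
        moreover have "- (1/5) * P / (Q * R) = - S \<Longrightarrow> 1/5 * P / (R * Q) = S" for P Q R S :: real
          by (simp add: mult.commute)
        ultimately show ?thesis
          unfolding fifth_scale_def w prodsplit2[OF j, of "\<lambda>y. real j + 1/5 - y"]
          using node_weight[OF j, of "-(1/5)"]
          by (simp add: mult.commute[of "\<Prod>l\<le>k. real j + 1/5 - real l"])
      qed
      finally show "N * ?t (Suc k + j) = exp (u/5) * (?cB j * exp u ^ j)" by simp
    qed simp
    finally show ?thesis by (simp only: sum_distrib_left)
  qed
  have int: "\<exists>c::int. 25 ^ k * (binom_shift v k (k-j) * binom_shift v' k j) = of_int c"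
    if v: "v \<in> {1/5, -(1/5)}" and v': "v' \<in> {1/5, -(1/5)}" and jk: "j \<le> k" for v v' j
  proof -
    obtain c c' where "25 ^ (k-j) * binom_shift v k (k-j) = of_int c" "25 ^ j * binom_shift v' k j = of_int c'"
      using binom_shift_int[OF diff_le_self v] binom_shift_int[OF jk v'] by metis
    moreover have "(25::real) ^ k = 25 ^ (k-j) * 25 ^ j" using jk by (simp add: power_add[symmetric])
    ultimately have "25 ^ k * (binom_shift v k (k-j) * binom_shift v' k j) = of_int (c * c')"
      by (metis (no_types, opaque_lifting) mult.assoc mult.left_commute of_int_mult)
    then show ?thesis by blast
  qed
  have "\<exists>c::int. ?cA j = of_int c" if jk: "j \<le> k" for j
  proof -
    obtain c :: int where "25 ^ k * (binom_shift (- (1/5)) k (k - j) * binom_shift (1/5) k j) = of_int c"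
      using int[OF _ _ jk, of "-(1/5)" "1/5"] by blast
    then show ?thesis by (intro exI[of _ "- c"]) simp
  qed
  then obtain A :: "nat \<Rightarrow> int" where A: "\<And>j. j \<le> k \<Longrightarrow> ?cA j = of_int (A j)"
    by metis
  have "\<exists>c::int. ?cB j = of_int c" if jk: "j \<le> k" for j
    using int[OF _ _ jk, of "1/5" "-(1/5)"] by blast
  then obtain B :: "nat \<Rightarrow> int" where B: "\<And>j. j \<le> k \<Longrightarrow> ?cB j = of_int (B j)"
    by metis
  have Bb: "0 \<le> B j \<and> B j \<le> 4 * 100 ^ k" if "j \<le> k" for j
  proof -
    have b: "0 \<le> binom_shift (1/5) k (k - j)" "binom_shift (1/5) k (k - j) \<le> 2 ^ Suc k"
      "0 \<le> binom_shift (-(1/5)) k j" "binom_shift (-(1/5)) k j \<le> 2 ^ Suc k"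
      using that by (simp_all add: binom_shift_bounds del: power_Suc)
    have "real_of_int (B j) \<le> 25 ^ k * (2 ^ Suc k * 2 ^ Suc k)"
      unfolding B[OF that, symmetric] using b by (intro mult_left_mono mult_mono) auto
    also have "\<dots> = 4 * 100 ^ k" by (simp add: mult.assoc[symmetric] power_mult_distrib[symmetric])
    finally have "real_of_int (B j) \<le> of_int (4 * 100 ^ k)" by simp
    then have "B j \<le> 4 * 100 ^ k" by (simp only: of_int_le_iff)
    moreover have "0 \<le> real_of_int (B j)" unfolding B[OF that, symmetric] using b by simp
    ultimately show ?thesis by simp
  qed
  have main: "u ^ n / 5 \<le> N * exp_divdiff w n u \<and> N * exp_divdiff w n u \<le> 25 ^ k * u ^ n * exp u ^ (k+1)" if "u \<ge> 0" for u
  proof -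
    note b = exp_divdiff_bounds[OF inj wb that]
    have N0: "N \<ge> 0" unfolding N_def fifth_scale_def by (intro mult_nonneg_nonneg prod_nonneg) auto
    have e: "exp (real (k+1) * u) = exp u ^ (k+1)" by (rule exp_of_nat_mult)
    have s: "N / fact n \<le> 25 ^ k" "1/5 \<le> N / fact n"
    proof -
      have "N / fact n = 25 ^ k * (fifth_scale k / fact n)" by (simp add: N_def)
      moreover have "25 ^ k * (fifth_scale k / fact n) \<le> 25 ^ k * 1"
        unfolding n_def using fifth_scale_bounds(1)[of k] by (intro mult_left_mono) auto
      moreover have "1 \<le> 5 * (25 ^ k * (fifth_scale k / fact n))"
        unfolding n_def using fifth_scale_bounds(2)[of k] by (simp only: mult.assoc)
      ultimately show "N / fact n \<le> 25 ^ k" "1/5 \<le> N / fact n" by simp_all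
    qed
    have "u ^ n / 5 \<le> u ^ n * (N / fact n)"
      using mult_left_mono[OF s(2), of "u ^ n"] that by simp
    also have "\<dots> \<le> N * exp_divdiff w n u" using mult_left_mono[OF conjunct1[OF b] N0] by (simp add: mult_ac)
    finally have 1: "u ^ n / 5 \<le> N * exp_divdiff w n u" .
    have "N * exp_divdiff w n u \<le> N * (u ^ n / fact n * exp u ^ (k+1))"
      using b N0 unfolding e by (intro mult_left_mono) auto
    also have "\<dots> = N / fact n * (u ^ n * exp u ^ (k+1))" by simp
    also have "\<dots> \<le> 25 ^ k * (u ^ n * exp u ^ (k+1))" using s that by (intro mult_right_mono) auto
    finally show ?thesis using 1 by simp
  qed
  have sA: "(\<Sum>j\<le>k. ?cA j * exp u ^ j)
      = (\<Sum>j\<le>k. of_int (A j) * exp u ^ j)" for u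
    by (intro sum.cong refl) (simp only: atMost_iff A)
  have sB: "(\<Sum>j\<le>k. ?cB j * exp u ^ j)
      = (\<Sum>j\<le>k. of_int (B j) * exp u ^ j)" for u
    by (intro sum.cong refl) (simp only: atMost_iff B)
  show ?thesis
    using Bb main[unfolded dd sA sB, unfolded n_def]
    by (intro exI[of _ A] exI[of _ B] conjI allI impI) (auto simp only:)
qed

section \<open>Pillai's equation\<close>

text \<open>Thue's gap argument: with X = a x0^5 and Y = b y0^5, the second solution provides a
  rational number \<open>\<tau>\<close> very close to the fifth root \<open>\<alpha>\<close> of X /
  Y. A suitable Pade form, evaluated at \<open>\<tau>\<close> instead of \<open>\<alpha>\<close>,
  would give an integer strictly between 0 and 1. The conditions on \<open>y0\<close> let powers of
  \<open>y0\<close> absorb every constant.\<close>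

lemma fifth_power_pair_bound:
  fixes a b c x0 y0 x1 y1 :: nat
  assumes pos: "a > 0" "b > 0" "c > 0"
    and eq0: "a * x0 ^ 5 = b * y0 ^ 5 + c" and eq1: "a * x1 ^ 5 = b * y1 ^ 5 + c"
    and K: "40 * c \<le> y0" "1600 * b\<^sup>2 \<le> y0" "50 * c\<^sup>2 \<le> y0" "2 * c * (b + c) \<le> y0" "2 \<le> y0"
  shows "y1 < y0 ^ 7"
proof (rule ccontr)
  assume "\<not> y1 < y0 ^ 7"
  then have y17: "y0 ^ 7 \<le> y1" by simp
  have "y1 < 2 ^ y1" by (rule less_exp)
  also have "\<dots> \<le> y0 ^ y1" using K(5) by (rule power_mono) simp
  also have "\<dots> \<le> y0 ^ (4 * y1 + 3)" using K(5) by (intro power_increasing) auto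
  finally have ex: "\<exists>k. y1 < y0 ^ (4 * k + 3)" by blast
  \<comment> \<open>This places \<open>y1\<close> in the window from y0^(4k-1) to y0^(4k+3). For k
    >= 2 these windows cover everything from y0^7 on, which explains the exponent 7.\<close>
  define k where "k = (LEAST k. y1 < y0 ^ (4 * k + 3))"
  have k1: "y1 < y0 ^ (4 * k + 3)" unfolding k_def using ex by (rule LeastI_ex)
  have k2: "k \<ge> 2"
  proof (rule ccontr)
    assume "\<not> k \<ge> 2"
    then have "y0 ^ (4 * k + 3) \<le> y0 ^ 7" using K(5) by (intro power_increasing) auto
    then show False using k1 y17 by simp
  qed
  have "\<not> y1 < y0 ^ (4 * (k - 1) + 3)" unfolding k_def using k2 by (intro not_less_Least) (simp add: k_def)
  then have k3: "y0 ^ (4 * k - 1) \<le> y1"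
  proof -
    have "4 * (k - 1) + 3 = 4 * k - 1" using k2 by simp
    then show ?thesis using \<open>\<not> y1 < y0 ^ (4 * (k - 1) + 3)\<close> by simp
  qed
  have y1pos: "y1 > 0" using y17 K(5) by (metis gr0I le_zero_eq power_eq_0_iff not_numeral_le_zero)
  have xpos: "x0 > 0" "x1 > 0" using eq0 eq1 pos by (auto intro: gr0I)
  obtain A B :: "nat \<Rightarrow> int" where B: "\<And>j. j \<le> k \<Longrightarrow> 0 \<le> B j \<and> B j \<le> 4 * 100 ^ k"
    and R: "\<And>u::real. u \<ge> 0 \<Longrightarrow> u ^ (2*k+1) / 5 \<le> (\<Sum>j\<le>k. of_int (A j) * exp u ^ j) + exp (u/5) * (\<Sum>j\<le>k. of_int (B j) * exp u ^ j) \<and>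
      (\<Sum>j\<le>k. of_int (A j) * exp u ^ j) + exp (u/5) * (\<Sum>j\<le>k. of_int (B j) * exp u ^ j)
        \<le> 25 ^ k * u ^ (2*k+1) * exp u ^ (k+1)"
    using fifth_root_pade[of k] by blast
  define X Y Y1 :: real where "X = real (a * x0 ^ 5)" and "Y = real (b * y0 ^ 5)" and "Y1 = real (b * y1 ^ 5)"
  have XY: "X = Y + c" unfolding X_def Y_def eq0 by simp
  have X1: "real (a * x1 ^ 5) = Y1 + c" unfolding eq1 Y1_def by simp
  have "c \<le> y0" using K(1) by simp
  also have "y0 \<le> y0 ^ 5" using K(5) by (intro self_le_power) auto
  also have "\<dots> \<le> b * y0 ^ 5" using pos by simp
  finally have cY: "real c \<le> Y" unfolding Y_def by (simp only: of_nat_le_iff)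
  have Y0: "Y > 0" "Y1 > 0" "X > 0" using pos K y1pos cY by (auto simp: Y_def Y1_def XY)
  define u where "u = ln (X / Y)"
  define u1 where "u1 = ln ((Y1 + c) / Y1)"
  have eu: "exp u = X / Y" unfolding u_def using Y0 by simp
  have eu1: "exp u1 = (Y1 + c) / Y1" unfolding u1_def using Y0 by simp
  have eu2: "exp u \<le> 2" unfolding eu XY using cY Y0 by (simp add: field_simps)
  have u_le: "u \<le> c / Y"
    using ln_le_minus_one[of "X / Y"] Y0 unfolding u_def XY by (simp add: field_simps)
  have u1_le: "u1 \<le> c / Y1"
    using ln_le_minus_one[of "(Y1 + c) / Y1"] Y0 unfolding u1_def by (simp add: field_simps)
  have u1_ge: "u1 \<ge> 0" unfolding u1_def using Y0 by simp
  have u_ge: "1 / (2 * Y) \<le> u"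
  proof -
    have "ln (Y / X) \<le> Y / X - 1" using Y0 by (intro ln_le_minus_one) simp
    moreover have "ln (Y / X) = - u" unfolding u_def using Y0 by (simp add: ln_div)
    ultimately have "u \<ge> 1 - Y / X" by simp
    moreover have "1 - Y / X = c / X" using Y0 by (simp add: XY field_simps)
    moreover have "1 / (2 * Y) \<le> c / X"
    proof -
      have "c \<ge> 1" using pos by simp
      then show ?thesis using cY Y0 by (intro frac_le) (auto simp: XY)
    qed
    ultimately show ?thesis by linarith
  qed
  have u0: "u \<ge> 0" using u_ge Y0 by (smt (verit) divide_pos_pos)
  \<comment> \<open>Multiplication by \<open>Y ^ k\<close> homogenises the Pade polynomials at
    \<open>exp u = X / Y\<close> and makes their values integers.\<close>
  define P Q :: int where "P = (\<Sum>j\<le>k. A j * (int (a * x0 ^ 5) ^ j * int (b * y0 ^ 5) ^ (k - j)))"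
    and "Q = (\<Sum>j\<le>k. B j * (int (a * x0 ^ 5) ^ j * int (b * y0 ^ 5) ^ (k - j)))"
  have scale: "Y ^ k * (\<Sum>j\<le>k. of_int (C j) * exp u ^ j)
      = of_int (\<Sum>j\<le>k. C j * (int (a * x0 ^ 5) ^ j * int (b * y0 ^ 5) ^ (k - j)))" for C :: "nat \<Rightarrow> int"
    unfolding sum_distrib_left of_int_sum
  proof (rule sum.cong)
    fix j assume "j \<in> {..k}"
    then have "Y ^ k = Y ^ j * Y ^ (k - j)" by (simp add: power_add[symmetric])
    then have "Y ^ k * (of_int (C j) * exp u ^ j) = of_int (C j) * (X ^ j * Y ^ (k - j))"
      unfolding eu using Y0 by (simp add: power_divide)
    then show "Y ^ k * (of_int (C j) * exp u ^ j) = of_int (C j * (int (a * x0 ^ 5) ^ j * int (b * y0 ^ 5) ^ (k - j)))"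
      by (simp add: X_def Y_def)
  qed simp
  define \<alpha> where "\<alpha> = exp (u / 5)"
  \<comment> \<open>By the two equations \<open>\<tau> ^ 5\<close> is the quotient of X / Y by (Y1 +
    c) / Y1, so this rational number differs from \<open>\<alpha>\<close> by at most c / Y1.\<close>
  define \<tau> where "\<tau> = real (x0 * y1) / real (y0 * x1)"
  define T where "T = of_int P + \<alpha> * of_int Q"
  have T: "T = Y ^ k * ((\<Sum>j\<le>k. of_int (A j) * exp u ^ j) + exp (u/5) * (\<Sum>j\<le>k. of_int (B j) * exp u ^ j))"
    unfolding T_def P_def Q_def scale[symmetric] \<alpha>_def by (simp add: algebra_simps)
  have T_ge: "Y ^ k * (u ^ (2*k+1) / 5) \<le> T"
    unfolding T using R[OF u0] Y0 by (intro mult_left_mono) auto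
  have T_le: "T \<le> Y ^ k * (25 ^ k * u ^ (2*k+1) * exp u ^ (k+1))"
    unfolding T using R[OF u0] Y0 by (intro mult_left_mono) auto
  have tau: "\<tau> = exp ((u - u1) / 5)"
  proof (rule power_eq_imp_eq_base[of _ 5])
    have "\<tau> ^ 5 = (a * x0 ^ 5 / (b * y0 ^ 5)) * (b * y1 ^ 5 / (a * x1 ^ 5))"
      using pos xpos y1pos K unfolding \<tau>_def by (simp add: power_divide power_mult_distrib field_simps)
    also have "\<dots> = (X / Y) * (Y1 / (Y1 + c))" unfolding X1[symmetric] by (simp add: X_def Y_def Y1_def)
    also have "\<dots> = exp u / exp u1" by (simp add: eu eu1)
    also have "\<dots> = exp ((u - u1) / 5) ^ 5" by (simp add: exp_diff[symmetric] exp_of_nat_mult[symmetric])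
    finally show "\<tau> ^ 5 = exp ((u - u1) / 5) ^ 5" .
  qed (auto simp: \<tau>_def)
  have at: "0 \<le> \<alpha> - \<tau>" "\<alpha> - \<tau> \<le> c / Y1"
  proof -
    show "0 \<le> \<alpha> - \<tau>" unfolding tau \<alpha>_def using u1_ge by simp
    have "\<alpha> \<le> exp u" unfolding \<alpha>_def using u0 by simp
    then have \<alpha>2: "\<alpha> \<le> 2" using eu2 by simp
    have "\<tau> = \<alpha> * exp (- (u1 / 5))" unfolding tau \<alpha>_def by (simp add: exp_add[symmetric] diff_divide_distrib)
    then have "\<alpha> - \<tau> = \<alpha> * (1 - exp (- (u1 / 5)))" by (simp add: algebra_simps)
    also have "\<dots> \<le> 2 * (u1 / 5)"
      using exp_ge_add_one_self[of "- (u1 / 5)"] \<alpha>2 u1_ge by (intro mult_mono) (auto simp: \<alpha>_def)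
    also have "\<dots> \<le> u1" using u1_ge by simp
    finally show "\<alpha> - \<tau> \<le> c / Y1" using u1_le by simp
  qed
  have Q0: "0 \<le> Q" unfolding Q_def using B by (intro sum_nonneg mult_nonneg_nonneg) auto
  \<comment> \<open>The constant 400 is 2 * 100 * 2: from k + 1 <= 2^k, from the bound on
    \<open>B\<close>, and from X <= 2 Y.\<close>
  have Q1: "real_of_int Q \<le> 4 * (400 * Y) ^ k"
  proof -
    have "real_of_int Q = (\<Sum>j\<le>k. of_int (B j) * (X ^ j * Y ^ (k - j)))" unfolding Q_def X_def Y_def by simp
    also have "\<dots> \<le> (\<Sum>j\<le>k. (4 * 100 ^ k) * ((2 * Y) ^ j * (2 * Y) ^ (k - j)))"
    proof (rule sum_mono)
      fix j assume "j \<in> {..k}"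
      then have "0 \<le> B j \<and> B j \<le> 4 * 100 ^ k" using B by simp
      then have "0 \<le> real_of_int (B j) \<and> real_of_int (B j) \<le> of_int (4 * 100 ^ k)" by (simp only: of_int_le_iff of_int_0_le_iff)
      then show "of_int (B j) * (X ^ j * Y ^ (k - j)) \<le> (4 * 100 ^ k) * ((2 * Y) ^ j * (2 * Y) ^ (k - j))"
        using Y0 cY by (intro mult_mono power_mono) (auto simp: XY)
    qed
    also have "\<dots> = (\<Sum>j\<le>k. (4 * 100 ^ k) * (2 * Y) ^ k)" by (intro sum.cong refl) (simp only: power_add[symmetric] atMost_iff le_add_diff_inverse)
    also have "\<dots> = real (k + 1) * ((4 * 100 ^ k) * (2 * Y) ^ k)" by simp
    also have "\<dots> \<le> 2 ^ k * ((4 * 100 ^ k) * (2 * Y) ^ k)"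
    proof (rule mult_right_mono)
      have "k + 1 \<le> 2 ^ k" by (induction k) auto
      then have "real (k + 1) \<le> real (2 ^ k)" by (simp only: of_nat_le_iff)
      then show "real (k + 1) \<le> 2 ^ k" by simp
    qed (use Y0 in auto)
    also have "\<dots> = 4 * (400 * Y) ^ k"
    proof -
      have "(400 * Y) ^ k = (2 * (100 * (2 * Y))) ^ k" by simp
      also have "\<dots> = 2 ^ k * (100 ^ k * (2 * Y) ^ k)" by (simp only: power_mult_distrib)
      finally show ?thesis by (simp only: mult_ac)
    qed
    finally show ?thesis .
  qed
  have y0pos: "y0 > 0" using K by simp
  \<comment> \<open>Cleared of denominators, this says that replacing \<open>\<alpha>\<close> by
    \<open>\<tau>\<close> changes the form by less than its lower bound. It uses the lower end of
    the window, through 11k + 6 < 5(4k - 1) for k >= 2.\<close>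
  have ineq1: "40 * real c * Y * (1600 * Y\<^sup>2) ^ k < Y1"
  proof -
    have "40 * c * (b * y0 ^ 5) * (1600 * (b * y0 ^ 5)\<^sup>2) ^ k = (40 * c) * (b * y0 ^ 5) * ((1600 * b\<^sup>2) * y0 ^ 10) ^ k"
      by (simp add: power_mult_distrib mult_ac)
    also have "\<dots> \<le> y0 * (b * y0 ^ 5) * (y0 * y0 ^ 10) ^ k"
      using K by (intro mult_mono power_mono) auto
    also have "\<dots> = b * (y0 ^ 6 * (y0 ^ 11) ^ k)" 
    proof -
      have "y0 * y0 ^ 10 = y0 ^ 11" "y0 ^ 6 = y0 * y0 ^ 5"
        using power_add[of y0 1 10] power_add[of y0 1 5] by simp_all
      then show ?thesis by (simp only: mult_ac)
    qed
    also have "y0 ^ 6 * (y0 ^ 11) ^ k = y0 ^ (11 * k + 6)" by (simp add: power_add power_mult)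
    also have "b * y0 ^ (11 * k + 6) < b * y0 ^ (5 * (4 * k - 1))"
      using K k2 pos by (intro mult_strict_left_mono power_strict_increasing) auto
    also have "\<dots> = b * (y0 ^ (4 * k - 1)) ^ 5" by (simp only: power_mult[symmetric] mult.commute)
    also have "\<dots> \<le> b * y1 ^ 5" using k3 by (intro mult_left_mono power_mono) auto
    finally have "real (40 * c * (b * y0 ^ 5) * (1600 * (b * y0 ^ 5)\<^sup>2) ^ k) < real (b * y1 ^ 5)"
      by (simp only: of_nat_less_iff)
    then show ?thesis unfolding Y_def Y1_def by simp
  qed
  \<comment> \<open>This makes the form smaller than the inverse of its denominator
    \<open>y0 * x1\<close>. It uses the upper end of the window, through 1 + k + 1 + (4k + 3) = 5(k
    + 1).\<close>
  have ineq2: "2 * real c * (50 * (real c)\<^sup>2) ^ k * real (y0 * x1) < Y ^ (k + 1)"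
  proof -
    have x1: "x1 \<le> (b + c) * y1"
    proof -
      have "x1 ^ 5 \<le> a * x1 ^ 5" using pos by simp
      also have "\<dots> \<le> b * y1 ^ 5 + c * y1 ^ 5" using eq1 y1pos by simp
      also have "\<dots> \<le> (b + c) ^ 5 * y1 ^ 5"
        unfolding add_mult_distrib[symmetric] using pos by (intro mult_right_mono self_le_power) auto
      also have "\<dots> = ((b + c) * y1) ^ 5" by (simp add: power_mult_distrib)
      finally show ?thesis by (subst (asm) power_mono_iff) auto
    qed
    have "2 * c * (50 * c\<^sup>2) ^ k * (y0 * x1) \<le> 2 * c * y0 ^ k * (y0 * ((b + c) * y1))"
      using K x1 by (intro mult_mono power_mono) auto
    also have "\<dots> = (2 * c * (b + c)) * (y0 ^ k * y0 * y1)" by simp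
    also have "\<dots> \<le> y0 * (y0 ^ k * y0 * y1)" using K by (intro mult_right_mono) auto
    also have "\<dots> < y0 * (y0 ^ k * y0 * y0 ^ (4 * k + 3))"
      using k1 y0pos by simp
    also have "\<dots> = (y0 ^ 5) ^ (k + 1)" 
    proof -
      have "5 * (k + 1) = 1 + (k + (1 + (4 * k + 3)))" by simp
      then have "(y0 ^ 5) ^ (k + 1) = y0 ^ (1 + (k + (1 + (4 * k + 3))))" by (simp only: power_mult[symmetric])
      then show ?thesis by (simp only: power_add[of y0] power_one_right mult.assoc)
    qed
    also have "\<dots> \<le> (b * y0 ^ 5) ^ (k + 1)" using pos by (intro power_mono) auto
    finally have "real (2 * c * (50 * c\<^sup>2) ^ k * (y0 * x1)) < real ((b * y0 ^ 5) ^ (k + 1))"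
      by (simp only: of_nat_less_iff)
    then show ?thesis unfolding Y_def by simp
  qed
  \<comment> \<open>\<open>V\<close> is the form at \<open>\<tau>\<close>; multiplied by
    \<open>y0 * x1\<close> it becomes an integer, positive by \<open>ineq1\<close> and below 1 by
    \<open>ineq2\<close>.\<close>
  define V where "V = of_int P + \<tau> * of_int Q"
  have VT: "V = T - (\<alpha> - \<tau>) * of_int Q" unfolding V_def T_def by (simp add: algebra_simps)
  have "(\<alpha> - \<tau>) * of_int Q \<le> (c / Y1) * (4 * (400 * Y) ^ k)"
    using at Q0 Q1 Y0 by (intro mult_mono) auto
  also have "\<dots> < Y ^ k * ((1 / (2 * Y)) ^ (2*k+1) / 5)"
  proof -
    have "(2 * Y) ^ (2*k+1) = 2 * Y * (4 * Y\<^sup>2) ^ k" by (simp add: power_mult power_mult_distrib)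
    then have e: "Y ^ k * ((1 / (2 * Y)) ^ (2*k+1) / 5) = Y ^ k / (10 * Y * (4 * Y\<^sup>2) ^ k)"
      by (simp add: power_one_over)
    have "(1600 * Y\<^sup>2) ^ k * Y ^ k = (400 * Y) ^ k * (4 * Y\<^sup>2) ^ k"
    proof -
      have "1600 * Y\<^sup>2 * Y = 400 * Y * (4 * Y\<^sup>2)" by simp
      then show ?thesis by (metis power_mult_distrib)
    qed
    moreover have "(real c * (4 * p)) * (10 * Y * q) = (40 * real c * Y) * (p * q)" for p q :: real by simp
    ultimately have "(real c * (4 * (400 * Y) ^ k)) * (10 * Y * (4 * Y\<^sup>2) ^ k) = (40 * real c * Y * (1600 * Y\<^sup>2) ^ k) * Y ^ k"
      by (simp only: mult.assoc)
    also have "\<dots> < Y1 * Y ^ k" using ineq1 Y0 by (intro mult_strict_right_mono) auto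
    finally have "real c * (4 * (400 * Y) ^ k) / Y1 < Y ^ k / (10 * Y * (4 * Y\<^sup>2) ^ k)"
      using Y0 by (simp add: divide_less_eq less_divide_eq mult_ac)
    then show ?thesis unfolding e by simp
  qed
  also have "\<dots> \<le> Y ^ k * (u ^ (2*k+1) / 5)"
    using u_ge Y0 by (intro mult_left_mono divide_right_mono power_mono) auto
  finally have Vpos: "V > 0" using T_ge unfolding VT by simp
  have "V \<le> T" unfolding VT using at(1) Q0 by simp
  also have "T \<le> Y ^ k * (25 ^ k * (c / Y) ^ (2*k+1) * 2 ^ (k+1))"
    using T_le by (rule order_trans) (use u_le u0 eu2 Y0 in \<open>intro mult_mono mult_left_mono power_mono; auto\<close>)
  also have "\<dots> = 2 * c * (50 * (real c)\<^sup>2) ^ k / Y ^ (k + 1)"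
  proof -
    have 1: "(c / Y) ^ (2*k+1) = c * ((real c)\<^sup>2) ^ k / (Y ^ (k+1) * Y ^ k)"
    proof -
      have "(real c) ^ (2*k+1) = c * ((real c)\<^sup>2) ^ k" by (simp add: power_mult)
      moreover have "Y ^ (2*k+1) = Y ^ (k+1) * Y ^ k" unfolding power_add[symmetric] by (simp add: mult_2)
      ultimately show ?thesis by (simp only: power_divide)
    qed
    have 2: "(50 * (real c)\<^sup>2) ^ k = 25 ^ k * 2 ^ k * ((real c)\<^sup>2) ^ k"
      by (simp only: power_mult_distrib[symmetric]) simp
    have 3: "Y ^ k * (25 ^ k * (p / (q * Y ^ k)) * 2 ^ (k+1)) = 2 * (25 ^ k * 2 ^ k * p) / q" for p q :: real
      using Y0 by simp
    show ?thesis unfolding 1 2 3 by simp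
  qed
  finally have "V * real (y0 * x1) \<le> 2 * c * (50 * (real c)\<^sup>2) ^ k / Y ^ (k + 1) * real (y0 * x1)"
    by (rule mult_right_mono) simp
  also have "\<dots> < 1" using ineq2 Y0 by (simp add: field_simps)
  finally have "V * real (y0 * x1) < 1" .
  moreover have "V * real (y0 * x1) = of_int (P * int (y0 * x1) + Q * int (x0 * y1))"
    unfolding V_def \<tau>_def using xpos y0pos by (simp add: field_simps)
  moreover have "V * real (y0 * x1) > 0" using Vpos xpos y0pos by simp
  ultimately have "0 < P * int (y0 * x1) + Q * int (x0 * y1)" "P * int (y0 * x1) + Q * int (x0 * y1) < 1"
    by linarith+
  then show False by simp
qed

text \<open>One sufficiently large solution bounds every other one by its seventh power, so the
  solutions cannot be unbounded.\<close>

lemma finite_fifth_power_eq: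
  fixes a b c :: nat
  assumes pos: "a > 0" "b > 0" "c > 0"
  shows "finite {(x, y). a * x ^ 5 = b * y ^ 5 + c}" (is "finite ?S")
proof (rule ccontr)
  assume inf: "infinite ?S"
  have "inj_on snd ?S"
  proof (rule inj_onI, clarsimp)
    fix x x' y assume "a * x ^ 5 = b * y ^ 5 + c" "a * x' ^ 5 = b * y ^ 5 + c"
    then have "a * x ^ 5 = a * x' ^ 5" by simp
    then have "x ^ 5 = x' ^ 5" using pos by simp
    then show "x = x'" by (rule power_eq_imp_eq_base) auto
  qed
  then have "infinite (snd ` ?S)" using inf finite_imageD by blast
  then have unb: "\<exists>x y. y \<ge> M \<and> a * x ^ 5 = b * y ^ 5 + c" for M
    unfolding infinite_nat_iff_unbounded_le by force
  obtain x0 y0 where 0: "y0 \<ge> 40 * c + 1600 * b\<^sup>2 + 50 * c\<^sup>2 + 2 * c * (b + c) + 2"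
    "a * x0 ^ 5 = b * y0 ^ 5 + c" using unb by blast
  obtain x1 y1 where 1: "y1 \<ge> y0 ^ 7" "a * x1 ^ 5 = b * y1 ^ 5 + c" using unb by blast
  have "y1 < y0 ^ 7" by (rule fifth_power_pair_bound[OF pos 0(2) 1(2)]) (use 0(1) in auto)
  then show False using 1(1) by simp
qed

text \<open>Splitting the exponents by their residues mod 5 moves the remainders into the
  coefficients and leaves fifth powers.\<close>

lemma finite_pillai_pos:
  fixes a b c d e :: nat
  assumes pos: "a > 0" "b > 0" "c > 0" and de: "d > 1" "e > 1"
  shows "finite {(m, n). a * d ^ m = b * e ^ n + c}" (is "finite ?S")
proof -
  define C where "C \<mu> \<nu> = {(m, n) \<in> ?S. m mod 5 = \<mu> \<and> n mod 5 = \<nu>}" for \<mu> \<nu> :: nat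
  have "finite (C \<mu> \<nu>)" for \<mu> \<nu>
  proof (rule inj_on_finite)
    let ?F = "\<lambda>(m, n). (d ^ (m div 5), e ^ (n div 5))"
    show "inj_on ?F (C \<mu> \<nu>)"
    proof (rule inj_onI, clarsimp simp: C_def)
      fix m n m' n'
      assume h: "m' mod 5 = m mod 5" "n' mod 5 = n mod 5"
        "d ^ (m div 5) = d ^ (m' div 5)" "e ^ (n div 5) = e ^ (n' div 5)"
      have "m div 5 = m' div 5" "n div 5 = n' div 5"
        using h de by (auto dest: power_inject_exp[THEN iffD1, rotated])
      then show "m = m' \<and> n = n'" using h by (metis mult_div_mod_eq)
    qed
    show "?F ` C \<mu> \<nu> \<subseteq> {(x, y). (a * d ^ \<mu>) * x ^ 5 = (b * e ^ \<nu>) * y ^ 5 + c}"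
    proof (clarsimp simp: C_def)
      fix m n assume h: "a * d ^ m = b * e ^ n + c"
      have "d ^ m = d ^ (m mod 5) * (d ^ (m div 5)) ^ 5" "e ^ n = e ^ (n mod 5) * (e ^ (n div 5)) ^ 5"
        by (simp_all add: power_mult[symmetric] power_add[symmetric])
      then show "a * d ^ (m mod 5) * (d ^ (m div 5)) ^ 5 = b * e ^ (n mod 5) * (e ^ (n div 5)) ^ 5 + c"
        using h by (simp add: mult.assoc)
    qed
    show "finite {(x, y). (a * d ^ \<mu>) * x ^ 5 = (b * e ^ \<nu>) * y ^ 5 + c}"
      by (rule finite_fifth_power_eq) (use pos de in auto)
  qed
  moreover have "?S \<subseteq> (\<Union>\<mu>\<in>{..<5}. \<Union>\<nu>\<in>{..<5}. C \<mu> \<nu>)" by (auto simp: C_def)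
  ultimately show ?thesis by (meson finite_UN finite_lessThan finite_subset)
qed

lemma finite_pillai:
  fixes a b d e :: nat and c :: int
  assumes "a > 0" "b > 0" "c \<noteq> 0" "d > 1" "e > 1"
  shows "finite {(m, n). int a * int d ^ m = int b * int e ^ n + c}" (is "finite ?S")
proof (cases "c > 0")
  case True
  have "int a * int d ^ m = int b * int e ^ n + c \<Longrightarrow> a * d ^ m = b * e ^ n + nat c" for m n
  proof -
    assume "int a * int d ^ m = int b * int e ^ n + c"
    then have "int (a * d ^ m) = int (b * e ^ n + nat c)" using True by simp
    then show ?thesis by (simp only: of_nat_eq_iff)
  qed
  then have "?S \<subseteq> {(m, n). a * d ^ m = b * e ^ n + nat c}" by auto
  then show ?thesis using finite_pillai_pos[of a b "nat c" d e] assms True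
    by (auto intro: finite_subset)
next
  case False
  have "int a * int d ^ m = int b * int e ^ n + c \<Longrightarrow> b * e ^ n = a * d ^ m + nat (- c)" for m n
  proof -
    assume "int a * int d ^ m = int b * int e ^ n + c"
    then have "int (b * e ^ n) = int (a * d ^ m + nat (- c))" using False by simp
    then show ?thesis by (simp only: of_nat_eq_iff)
  qed
  then have "?S \<subseteq> prod.swap ` {(n, m). b * e ^ n = a * d ^ m + nat (- c)}" by (auto simp: image_iff)
  moreover have "finite {(n, m). b * e ^ n = a * d ^ m + nat (- c)}"
    using assms False by (intro finite_pillai_pos) auto
  ultimately show ?thesis by (auto intro: finite_subset)
qed

section \<open>Valuation rings and algebraic closure\<close>

definition is_subring :: "'a::comm_ring_1 set \<Rightarrow> bool" where
  "is_subring A \<longleftrightarrow> 1 \<in> A \<and> (\<forall>x\<in>A. \<forall>y\<in>A. x - y \<in> A \<and> x * y \<in> A)"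

definition polys_over :: "'a::comm_ring_1 set \<Rightarrow> 'a poly set" where
  "polys_over A = {p. \<forall>i. coeff p i \<in> A}"

context
  fixes A :: "'a::comm_ring_1 set"
  assumes A: "is_subring A"
begin

lemma subring_1: "1 \<in> A" using A by (simp add: is_subring_def)
lemma subring_diff: "x \<in> A \<Longrightarrow> y \<in> A \<Longrightarrow> x - y \<in> A" using A by (simp add: is_subring_def)
lemma subring_mult: "x \<in> A \<Longrightarrow> y \<in> A \<Longrightarrow> x * y \<in> A" using A by (simp add: is_subring_def)
lemma subring_0: "0 \<in> A" using subring_diff[OF subring_1 subring_1] by simp
lemma subring_uminus: "x \<in> A \<Longrightarrow> - x \<in> A" using subring_diff[OF subring_0, of x] by simp
lemma subring_add: "x \<in> A \<Longrightarrow> y \<in> A \<Longrightarrow> x + y \<in> A"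
  using subring_diff[OF _ subring_uminus, of x y] by simp
lemma subring_power: "x \<in> A \<Longrightarrow> x ^ n \<in> A" by (induction n) (auto intro: subring_1 subring_mult)
lemma subring_sum: "(\<And>i. i \<in> I \<Longrightarrow> f i \<in> A) \<Longrightarrow> sum f I \<in> A"
  by (induction I rule: infinite_finite_induct) (auto intro: subring_0 subring_add)
lemma subring_of_nat: "of_nat n \<in> A" by (induction n) (auto intro: subring_0 subring_1 subring_add)

lemmas subring_intros = subring_1 subring_0 subring_diff subring_mult subring_uminus subring_add
  subring_power subring_sum subring_of_nat

lemma polys_over_const: "c \<in> A \<Longrightarrow> [:c:] \<in> polys_over A"
  by (auto simp: polys_over_def coeff_pCons subring_0 split: nat.splits)
lemma polys_over_pCons: "c \<in> A \<Longrightarrow> p \<in> polys_over A \<Longrightarrow> pCons c p \<in> polys_over A"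
  by (auto simp: polys_over_def coeff_pCons split: nat.splits)
lemma polys_over_diff: "p \<in> polys_over A \<Longrightarrow> q \<in> polys_over A \<Longrightarrow> p - q \<in> polys_over A"
  by (simp add: polys_over_def subring_diff)
lemma polys_over_add: "p \<in> polys_over A \<Longrightarrow> q \<in> polys_over A \<Longrightarrow> p + q \<in> polys_over A"
  by (simp add: polys_over_def subring_add)
lemma polys_over_mult: "p \<in> polys_over A \<Longrightarrow> q \<in> polys_over A \<Longrightarrow> p * q \<in> polys_over A"
  by (simp add: polys_over_def coeff_mult subring_sum subring_mult)
lemma polys_over_monom: "c \<in> A \<Longrightarrow> monom c n \<in> polys_over A"
  by (simp add: polys_over_def subring_0)
lemma polys_over_sum: "(\<And>i. i \<in> I \<Longrightarrow> f i \<in> polys_over A) \<Longrightarrow> sum f I \<in> polys_over A"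
  by (simp add: polys_over_def coeff_sum subring_sum)
lemma polys_over_pcompose: "p \<in> polys_over A \<Longrightarrow> q \<in> polys_over A \<Longrightarrow> pcompose p q \<in> polys_over A"
proof (induction p)
  case 0 then show ?case by simp
next
  case (pCons c p)
  have "c \<in> A" "p \<in> polys_over A"
    using pCons.prems(1) by (force simp: polys_over_def coeff_pCons split: nat.splits)+
  then show ?case using pCons
    by (simp add: pcompose_pCons polys_over_add polys_over_mult polys_over_const)
qed
lemma poly_in_subring: "p \<in> polys_over A \<Longrightarrow> x \<in> A \<Longrightarrow> poly p x \<in> A"
  unfolding poly_altdef by (intro subring_sum subring_mult subring_power) (auto simp: polys_over_def)

definition adjoin :: "'a \<Rightarrow> 'a set" where
  "adjoin u = {poly p u | p. p \<in> polys_over A}"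

lemma is_subring_adjoin: "is_subring (adjoin u)"
  unfolding is_subring_def
proof (intro conjI ballI)
  show "1 \<in> adjoin u" unfolding adjoin_def
    using polys_over_const[OF subring_1] by (intro CollectI exI[of _ "[:1:]"]) auto
  fix x y assume "x \<in> adjoin u" "y \<in> adjoin u"
  then obtain p q where "p \<in> polys_over A" "q \<in> polys_over A" "x = poly p u" "y = poly q u"
    by (auto simp: adjoin_def)
  then show "x - y \<in> adjoin u" "x * y \<in> adjoin u" unfolding adjoin_def
    using polys_over_diff[of p q] polys_over_mult[of p q] by (force simp flip: poly_diff poly_mult)+
qed

lemma subset_adjoin: "A \<subseteq> adjoin u"
proof
  fix c assume "c \<in> A"
  then show "c \<in> adjoin u" unfolding adjoin_def using polys_over_const[of c]
    by (intro CollectI exI[of _ "[:c:]"]) auto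
qed

lemma in_adjoin: "u \<in> adjoin u"
  unfolding adjoin_def using polys_over_pCons[OF subring_0 polys_over_const[OF subring_1]]
  by (intro CollectI exI[of _ "[:0, 1:]"]) auto

end

lemma is_subring_subfield:
  assumes "is_subfield F" shows "is_subring F"
proof -
  have "x - y \<in> F" if "x \<in> F" "y \<in> F" for x y
  proof -
    have "x + (- y) \<in> F" using assms that unfolding is_subfield_def by blast
    then show ?thesis by simp
  qed
  then show ?thesis using assms unfolding is_subring_def is_subfield_def by blast
qed

definition valuation_ring :: "'a::field set \<Rightarrow> bool" where
  "valuation_ring V \<longleftrightarrow> is_subring V \<and> (\<forall>x. x \<in> V \<or> inverse x \<in> V)"

text \<open>The descent step showing that a maximal subring that contains \<open>1/x\<close> but not \<open>x\<close> is a valuation ring.\<close>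
lemma shorten_expression:
  fixes A :: "'a::field set"
  assumes A: "is_subring A" and x: "x \<notin> A" "inverse x \<in> A"
    and unit: "\<And>b. b \<in> A \<Longrightarrow> inverse (1 - inverse x * b) \<in> A"
    and u: "u \<noteq> 0" and p: "p \<in> polys_over A" "poly p u = x"
    and q: "q \<in> polys_over A" "poly q (inverse u) = x" and deg: "degree q \<le> degree p"
  shows "\<exists>p'\<in>polys_over A. poly p' u = x \<and> degree p' < degree p"
proof -
  define m where "m = degree q"
  define y where "y = inverse x"
  define w where "w = inverse (1 - y * coeff q 0)"
  have x0: "x \<noteq> 0" using x subring_0[OF A] by auto
  have y: "y \<in> A" "y * x = 1" using x x0 by (auto simp: y_def)
  have cq: "coeff q i \<in> A" for i using q(1) by (simp add: polys_over_def)
  have w: "w \<in> A" unfolding w_def y_def by (rule unit[OF cq])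
  have m: "m > 0"
  proof (rule ccontr)
    assume "\<not> m > 0"
    then obtain c where "q = [:c:]" unfolding m_def by (auto elim: degree_eq_zeroE)
    then show False using cq[of 0] q(2) x(1) by simp
  qed
  have nz: "1 - y * coeff q 0 \<noteq> 0"
  proof
    assume "1 - y * coeff q 0 = 0"
    then have "y * (x - coeff q 0) = 0" using y(2) by (simp add: right_diff_distrib)
    moreover have "y \<noteq> 0" using y(2) by auto
    ultimately have "x = coeff q 0" by simp
    then show False using cq[of 0] x(1) by simp
  qed
  \<comment> \<open>Multiplying \<open>poly q (inverse u) = x\<close> by
    \<open>inverse x * u ^ m\<close> and solving for \<open>u ^ m\<close> expresses this power by
    lower ones with coefficients in \<open>A\<close>. The division by
    \<open>1 - inverse x * coeff q 0\<close> is the point where \<open>unit\<close> enters.\<close>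
  define r where "r = (\<Sum>i<m. monom (w * y * coeff q (m - i)) i)"
  have r_over: "r \<in> polys_over A"
    unfolding r_def using w y cq by (intro polys_over_sum[OF A] polys_over_monom[OF A] subring_mult[OF A]) auto
  have r_deg: "degree r < m"
    unfolding r_def by (rule le_less_trans[OF degree_sum_le[of _ _ "m - 1"]])
      (use m in \<open>auto intro: order_trans[OF degree_monom_le]\<close>)
  have r_u: "poly r u = u ^ m"
  proof -
    have "x * u ^ m = (\<Sum>j\<le>m. coeff q j * inverse u ^ j * u ^ m)"
      unfolding q(2)[symmetric] poly_altdef m_def by (simp add: sum_distrib_right)
    also have "\<dots> = (\<Sum>j\<le>m. coeff q j * u ^ (m - j))"
      using u by (intro sum.cong) (auto simp: power_diff field_simps)
    also have "\<dots> = (\<Sum>i\<le>m. coeff q (m - i) * u ^ i)"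
      by (rule sum.reindex_bij_witness[of _ "\<lambda>i. m - i" "\<lambda>i. m - i"]) auto
    also have "{..m} = insert m {..<m}" by auto
    finally have "x * u ^ m = coeff q 0 * u ^ m + (\<Sum>i<m. coeff q (m - i) * u ^ i)" by simp
    then have "y * x * u ^ m = y * coeff q 0 * u ^ m + y * (\<Sum>i<m. coeff q (m - i) * u ^ i)"
      by (simp only: mult.assoc distrib_left)
    then have "(1 - y * coeff q 0) * u ^ m = y * (\<Sum>i<m. coeff q (m - i) * u ^ i)"
      unfolding left_diff_distrib diff_eq_eq using y by (simp add: add.commute)
    then have "u ^ m = w * (y * (\<Sum>i<m. coeff q (m - i) * u ^ i))"
      unfolding w_def using nz by (simp add: field_simps)
    then show ?thesis unfolding r_def by (simp add: poly_sum poly_monom sum_distrib_left mult.assoc)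
  qed
  define n where "n = degree p"
  have n: "m \<le> n" using deg by (simp add: n_def m_def)
  define a where "a = coeff p n"
  have a: "a \<in> A" using p by (simp add: a_def polys_over_def)
  \<comment> \<open>The leading power \<open>u ^ n\<close> is replaced by \<open>u ^ (n - m)\<close>
    times the expression \<open>r\<close> for \<open>u ^ m\<close>.\<close>
  define p' where "p' = (p - monom a n) + monom a (n - m) * r"
  have "p' \<in> polys_over A" unfolding p'_def using p a r_over
    by (intro polys_over_add[OF A] polys_over_diff[OF A] polys_over_mult[OF A] polys_over_monom[OF A]) auto
  moreover have "poly p' u = x"
    unfolding p'_def using p r_u n by (simp add: poly_monom power_add[symmetric])
  moreover have "degree p' < n"
  proof -
    have "degree (p - monom a n) \<le> n - 1"
      by (rule degree_le) (auto simp: a_def n_def coeff_eq_0 not_less_eq)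
    moreover have "degree (monom a (n - m) * r) \<le> n - m + degree r"
      by (rule order_trans[OF degree_mult_le]) (auto intro: degree_monom_le)
    ultimately have "degree p' \<le> max (n - 1) (n - m + degree r)"
      unfolding p'_def by (intro degree_add_le) auto
    then show ?thesis using m n r_deg by linarith
  qed
  ultimately show ?thesis unfolding n_def by blast
qed

text \<open>Chevalley's extension argument: take a maximal subring over \<open>F\<close> that
  contains 1/x but not \<open>x\<close>. The ring F[1/x] is a candidate, because an equation x =
  p(1/x) becomes algebraic for \<open>x\<close> after clearing denominators.\<close>

lemma exists_valuation_ring:
  fixes F :: "'a::field set"
  assumes F: "is_subfield F" and x: "x \<notin> alg_closure_in F"
  shows "\<exists>V. valuation_ring V \<and> F \<subseteq> V \<and> x \<notin> V"
proof -
  have FR: "is_subring F" using F by (rule is_subring_subfield)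
  define y where "y = inverse x"
  define \<A> where "\<A> = {A. is_subring A \<and> F \<subseteq> A \<and> y \<in> A \<and> x \<notin> A}"
  have x0: "x \<noteq> 0"
  proof
    assume "x = 0"
    then have "x \<in> alg_closure_in F" unfolding alg_closure_in_def
      using subring_0[OF FR] subring_1[OF FR]
      by (intro CollectI exI[of _ "[:0, 1:]"]) (auto simp: coeff_pCons split: nat.splits)
    then show False using x by simp
  qed
  have "adjoin F y \<in> \<A>"
  proof -
    have "x \<notin> adjoin F y"
    proof
      assume "x \<in> adjoin F y"
      then obtain p where p: "p \<in> polys_over F" "x = poly p y" by (auto simp: adjoin_def[OF FR])
      define n where "n = degree p"
      define q where "q = monom 1 (Suc n) - (\<Sum>i\<le>n. monom (coeff p i) (n - i))"
      have "q \<in> polys_over F" unfolding q_def using p subring_1[OF FR]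
        by (intro polys_over_diff[OF FR] polys_over_monom[OF FR] polys_over_sum[OF FR]) (auto simp: polys_over_def)
      moreover have "q \<noteq> 0"
      proof
        assume "q = 0"
        then have "coeff q (Suc n) = 0" by simp
        moreover have "coeff q (Suc n) = 1" unfolding q_def coeff_diff coeff_sum coeff_monom by (auto intro!: sum.neutral)
        ultimately show False by simp
      qed
      moreover have "poly q x = 0"
      proof -
        have "x * x ^ n = (\<Sum>i\<le>n. coeff p i * y ^ i * x ^ n)"
          unfolding p(2) poly_altdef n_def[symmetric] by (subst sum_distrib_right) (simp add: p(2)[symmetric] poly_altdef)
        also have "\<dots> = (\<Sum>i\<le>n. coeff p i * x ^ (n - i))"
          using x0 by (intro sum.cong) (auto simp: y_def power_diff field_simps)
        finally show ?thesis unfolding q_def by (simp add: poly_monom poly_sum)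
      qed
      ultimately show False using x by (auto simp: alg_closure_in_def polys_over_def)
    qed
    then show ?thesis unfolding \<A>_def
      using is_subring_adjoin[OF FR] subset_adjoin[OF FR] in_adjoin[OF FR] by auto
  qed
  then have "\<A> \<noteq> {}" by auto
  moreover have "\<Union>C \<in> \<A>" if C: "C \<noteq> {}" "subset.chain \<A> C" for C
  proof -
    have CA: "C \<subseteq> \<A>" and lin: "\<And>X Y. X \<in> C \<Longrightarrow> Y \<in> C \<Longrightarrow> X \<subseteq> Y \<or> Y \<subseteq> X"
      using C(2) by (auto simp: subset_chain_def)
    have "is_subring (\<Union>C)" unfolding is_subring_def
    proof (intro conjI ballI)
      show "1 \<in> \<Union>C" using C CA by (auto simp: \<A>_def dest: subring_1)
      fix a b assume "a \<in> \<Union>C" "b \<in> \<Union>C"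
      then obtain X where X: "X \<in> C" "a \<in> X" "b \<in> X" using lin by blast
      then have "is_subring X" using CA by (auto simp: \<A>_def)
      then show "a - b \<in> \<Union>C" "a * b \<in> \<Union>C" using X by (auto dest: subring_diff subring_mult)
    qed
    then show ?thesis using C(1) CA unfolding \<A>_def by blast
  qed
  ultimately obtain A where A: "A \<in> \<A>" and max: "\<And>X. X \<in> \<A> \<Longrightarrow> A \<subseteq> X \<Longrightarrow> X = A"
    using subset_Zorn_nonempty[of \<A>] by blast
  have sub: "is_subring A" and FA: "F \<subseteq> A" and yA: "y \<in> A" and xA: "x \<notin> A" using A by (auto simp: \<A>_def)
  have inA: "u \<in> A" if "x \<notin> adjoin A u" for u
  proof -
    have "adjoin A u \<in> \<A>" unfolding \<A>_def
      using that is_subring_adjoin[OF sub] subset_adjoin[OF sub, of u] FA yA by auto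
    then have "adjoin A u = A" using max subset_adjoin[OF sub] by blast
    then show ?thesis using in_adjoin[OF sub] by blast
  qed
  \<comment> \<open>Let s = 1 - b/x. If \<open>x\<close> were in A[1/s], then x s^n would lie in
    \<open>A\<close> for some n. But x s - x = -b, and inductively x s^n - x, lies in
    \<open>A\<close>, so \<open>x\<close> would too.\<close>
  have unit: "inverse (1 - inverse x * b) \<in> A" if b: "b \<in> A" for b
  proof (rule inA, rule notI)
    define s where "s = 1 - y * b"
    have sA: "s \<in> A" unfolding s_def using b yA by (intro subring_intros[OF sub]) auto
    have s0: "s \<noteq> 0"
    proof
      assume "s = 0"
      then have "x = b" using x0 by (simp add: s_def y_def field_simps)
      then show False using b xA by simp
    qed
    assume "x \<in> adjoin A (inverse (1 - inverse x * b))"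
    then obtain p where p: "p \<in> polys_over A" "x = poly p (inverse s)" by (auto simp: adjoin_def[OF sub] s_def y_def)
    define n where "n = degree p"
    define c where "c = (\<Sum>i\<le>n. coeff p i * s ^ (n - i))"
    have c: "c \<in> A" unfolding c_def using p sA by (intro subring_intros[OF sub]) (auto simp: polys_over_def)
    have "x * s ^ n = (\<Sum>i\<le>n. coeff p i * inverse s ^ i * s ^ n)"
      unfolding p(2) poly_altdef n_def[symmetric] by (subst sum_distrib_right) simp
    also have "\<dots> = c" unfolding c_def
      using s0 by (intro sum.cong) (auto simp: power_diff field_simps)
    finally have xs: "x * s ^ n \<in> A" using c by simp
    have "x * s ^ j - x \<in> A" for j
    proof (induction j)
      case (Suc j)
      have "x * s ^ Suc j - x = (x * s ^ j - x) * s - b"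
        using x0 by (simp add: s_def y_def field_simps)
      then show ?case using Suc sA b by (simp add: subring_intros[OF sub])
    qed (simp add: subring_0[OF sub])
    from subring_diff[OF sub xs this[of n]] show False using xA by simp
  qed
  have "u \<in> A \<or> inverse u \<in> A" for u
  proof (rule ccontr)
    assume "\<not> (u \<in> A \<or> inverse u \<in> A)"
    then have u: "u \<notin> A" "inverse u \<notin> A" by auto
    have u0: "u \<noteq> 0" using u subring_0[OF sub] by auto
    \<comment> \<open>If neither \<open>u\<close> nor its inverse is in \<open>A\<close>, then
      \<open>x\<close> is a polynomial in each of them by maximality. A pair of such expressions of
      least total degree can still be shortened on its longer side.\<close>
    define Q where "Q n \<longleftrightarrow> (\<exists>p\<in>polys_over A. \<exists>q\<in>polys_over A. poly p u = x \<and> poly q (inverse u) = x \<and> degree p + degree q = n)" for n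
    have "x \<in> adjoin A u" "x \<in> adjoin A (inverse u)" using inA u by auto
    then obtain p q where "p \<in> polys_over A" "x = poly p u" "q \<in> polys_over A" "x = poly q (inverse u)"
      unfolding adjoin_def[OF sub] mem_Collect_eq by (elim exE conjE)
    then have "Q (degree p + degree q)" unfolding Q_def by (metis (no_types))
    then have "\<exists>n. Q n" by blast
    then have Q: "Q (LEAST n. Q n)" and least: "\<And>m. Q m \<Longrightarrow> (LEAST n. Q n) \<le> m" by (auto intro: LeastI_ex Least_le)
    from Q obtain p q where pq: "p \<in> polys_over A" "q \<in> polys_over A" "poly p u = x" "poly q (inverse u) = x"
      "degree p + degree q = (LEAST n. Q n)" unfolding Q_def by auto
    have yA': "inverse x \<in> A" using yA by (simp add: y_def)
    show False
    proof (cases "degree q \<le> degree p")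
      case True
      then obtain p' where "p' \<in> polys_over A" "poly p' u = x" "degree p' < degree p"
        using shorten_expression[OF sub xA yA' unit u0 pq(1,3,2,4)] by auto
      then have "Q (degree p' + degree q)" using pq unfolding Q_def by blast
      then show False using least pq(5) \<open>degree p' < degree p\<close> by fastforce
    next
      case False
      then obtain q' where "q' \<in> polys_over A" "poly q' (inverse u) = x" "degree q' < degree q"
        using shorten_expression[OF sub xA yA' unit, of "inverse u" q p] u0 pq by auto
      then have "Q (degree p + degree q')" using pq unfolding Q_def by blast
      then show False using least pq(5) \<open>degree q' < degree q\<close> by fastforce
    qed
  qed
  then show ?thesis using sub FA xA unfolding valuation_ring_def by blast
qed

text \<open>Valuation rings are integrally closed: if \<open>x\<close> had a pole, dividing the
  equation by x^(n-1) would express \<open>x\<close> through elements of \<open>V\<close>.\<close>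

lemma alg_closure_in_subset_valuation_ring:
  fixes F :: "'a::field set"
  assumes F: "is_subfield F" and V: "valuation_ring V" "F \<subseteq> V"
  shows "alg_closure_in F \<subseteq> V"
proof
  fix x assume "x \<in> alg_closure_in F"
  then obtain p where p: "p \<noteq> 0" "\<And>i. coeff p i \<in> F" "poly p x = 0" by (auto simp: alg_closure_in_def)
  have sub: "is_subring V" using V by (simp add: valuation_ring_def)
  show "x \<in> V"
  proof (rule ccontr)
    assume xV: "x \<notin> V"
    then have y: "inverse x \<in> V" and x0: "x \<noteq> 0" using V subring_0[OF sub] by (auto simp: valuation_ring_def)
    define n where "n = degree p"
    define a where "a = coeff p n"
    have a: "a \<noteq> 0" "inverse a \<in> V" using p F V(2) by (auto simp: a_def n_def is_subfield_def)
    have n: "n > 0"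
    proof (rule ccontr)
      assume "\<not> n > 0"
      then obtain c where "p = [:c:]" by (auto simp: n_def elim: degree_eq_zeroE)
      then show False using p by auto
    qed
    have "{..n} = insert n {..<n}" by auto
    then have "0 = a * x ^ n + (\<Sum>i<n. coeff p i * x ^ i)"
      using p(3) unfolding poly_altdef n_def[symmetric] a_def by simp
    then have "x * (a * x ^ (n - 1)) = - (\<Sum>i<n. coeff p i * x ^ i)"
      using n by (simp add: power_eq_if eq_neg_iff_add_eq_0 mult_ac)
    then have "x = inverse a * (- (\<Sum>i<n. coeff p i * x ^ i)) * inverse x ^ (n - 1)"
      using a x0 by (simp add: field_simps)
    also have "\<dots> = inverse a * (- (\<Sum>i<n. coeff p i * (x ^ i * inverse x ^ (n - 1))))"
      by (simp add: sum_distrib_right mult.assoc)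
    also have "(\<Sum>i<n. coeff p i * (x ^ i * inverse x ^ (n - 1))) = (\<Sum>i<n. coeff p i * inverse x ^ (n - 1 - i))"
      using x0 by (intro sum.cong) (auto simp: power_diff field_simps)
    finally have "x = inverse a * (- (\<Sum>i<n. coeff p i * inverse x ^ (n - 1 - i)))" .
    also have "\<dots> \<in> V" using a y p(2) V(2) by (intro subring_intros[OF sub]) auto
    finally show False using xV by simp
  qed
qed

text \<open>An intersection of rings is a ring, so this description yields closure of the algebraic
  elements under addition and multiplication, and also transitivity of algebraicity, without
  resultants.\<close>

lemma alg_closure_in_eq:
  fixes F :: "'a::field set"
  assumes "is_subfield F"
  shows "alg_closure_in F = \<Inter>{V. valuation_ring V \<and> F \<subseteq> V}"
  using alg_closure_in_subset_valuation_ring[OF assms] exists_valuation_ring[OF assms] by blast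

lemma subset_alg_closure_in: "is_subfield F \<Longrightarrow> F \<subseteq> alg_closure_in F"
  using alg_closure_in_eq by blast

lemma alg_closure_in_mono: "F \<subseteq> G \<Longrightarrow> alg_closure_in F \<subseteq> alg_closure_in G"
  unfolding alg_closure_in_def by blast

lemma is_subfield_alg_closure_in:
  fixes F :: "'a::field set"
  assumes F: "is_subfield F"
  shows "is_subfield (alg_closure_in F)"
proof -
  have ring: "is_subring (alg_closure_in F)"
    unfolding alg_closure_in_eq[OF F] is_subring_def
    by (auto simp: valuation_ring_def dest: subring_1 subring_diff subring_mult)
  have inv: "inverse x \<in> alg_closure_in F" if "x \<in> alg_closure_in F" for x
  proof (cases "x = 0")
    case False
    from that obtain p where p: "p \<noteq> 0" "\<forall>i. coeff p i \<in> F" "poly p x = 0" by (auto simp: alg_closure_in_def)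
    have "reflect_poly p \<noteq> 0" using p by simp
    moreover have "\<forall>i. coeff (reflect_poly p) i \<in> F"
      using p F by (auto simp: coeff_reflect_poly is_subfield_def)
    moreover have "poly (reflect_poly p) (inverse x) = 0"
      using poly_reflect_poly_nz[of "inverse x" p] p False by simp
    ultimately show ?thesis unfolding alg_closure_in_def by blast
  qed (use that in simp)
  show ?thesis unfolding is_subfield_def
    using inv subring_intros[OF ring] by auto
qed

lemma alg_closure_in_idem:
  fixes F :: "'a::field set"
  assumes F: "is_subfield F"
  shows "alg_closure_in (alg_closure_in F) = alg_closure_in F"
proof
  show "alg_closure_in (alg_closure_in F) \<subseteq> alg_closure_in F"
  proof
    fix x assume x: "x \<in> alg_closure_in (alg_closure_in F)"
    have "x \<in> V" if "valuation_ring V" "F \<subseteq> V" for V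
      using alg_closure_in_subset_valuation_ring[OF is_subfield_alg_closure_in[OF F] that(1)
          alg_closure_in_subset_valuation_ring[OF F that]] x by (rule subsetD)
    then show "x \<in> alg_closure_in F" unfolding alg_closure_in_eq[OF F] by blast
  qed
qed (rule subset_alg_closure_in[OF is_subfield_alg_closure_in[OF F]])

section \<open>Places and fields of constants\<close>

text \<open>In the language of absolute values, \<open>x \<notin> V\<close> reads |x| > 1,
  \<open>x \<in> M\<close> reads |x| < 1 and \<open>x \<notin> M\<close> reads |x| >= 1; nonzero
  elements of \<open>k\<close> have size 1.\<close>

locale valued =
  fixes k V :: "'a::field_char_0 set"
  assumes subfield_k: "is_subfield k" and val_ring: "valuation_ring V" and k_subset: "k \<subseteq> V"
begin

lemma subring_V: "is_subring V" using val_ring by (simp add: valuation_ring_def)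

lemmas V_intros = subring_intros[OF subring_V]

text \<open>The maximal ideal. Zero has its own disjunct because \<open>inverse 0 = 0\<close> lies
  in \<open>V\<close>.\<close>

definition M where "M = {x \<in> V. x = 0 \<or> inverse x \<notin> V}"

lemma M_imp_V: "x \<in> M \<Longrightarrow> x \<in> V" by (simp add: M_def)
lemma M_0: "0 \<in> M" by (simp add: M_def V_intros)
lemma M_1: "1 \<notin> M" by (simp add: M_def V_intros)
lemma not_V_imp_inverse_M: "x \<notin> V \<Longrightarrow> inverse x \<in> M"
  using val_ring by (auto simp: M_def valuation_ring_def)
lemma not_M_imp_inverse_V: "x \<notin> M \<Longrightarrow> inverse x \<in> V"
  using val_ring by (auto simp: M_def valuation_ring_def)
lemma not_M_imp_nonzero: "x \<notin> M \<Longrightarrow> x \<noteq> 0" using M_0 by auto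
lemma not_V_imp_not_M: "x \<notin> V \<Longrightarrow> x \<notin> M" using M_imp_V by auto

lemma M_mult: assumes "x \<in> V" "y \<in> M" shows "x * y \<in> M"
proof (cases "x * y = 0")
  case False
  have "inverse (x * y) \<notin> V"
  proof
    assume "inverse (x * y) \<in> V"
    then have "x * inverse (x * y) \<in> V" using assms by (intro V_intros)
    moreover have "x * inverse (x * y) = inverse y" using False by simp
    ultimately have "inverse y \<in> V" by (simp only:)
    then show False using assms False by (auto simp: M_def)
  qed
  moreover have "x * y \<in> V" using assms(1) M_imp_V[OF assms(2)] by (rule V_intros)
  ultimately show ?thesis by (simp add: M_def)
qed (use M_0 in auto)

lemma M_mult': "x \<in> M \<Longrightarrow> y \<in> V \<Longrightarrow> x * y \<in> M"
  using M_mult by (metis mult.commute)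

lemma M_add_aux: assumes "y \<in> M" "x / y \<in> V" "y \<noteq> 0" shows "x + y \<in> M"
proof -
  have "(x / y + 1) * y \<in> M" using assms by (intro M_mult V_intros) auto
  moreover have "(x / y + 1) * y = x + y" using assms(3) by (simp add: distrib_right)
  ultimately show ?thesis by simp
qed

lemma M_add: assumes "x \<in> M" "y \<in> M" shows "x + y \<in> M"
proof (cases "x = 0 \<or> y = 0")
  case False
  have "x / y \<in> V \<or> inverse (x / y) \<in> V" using val_ring by (auto simp: valuation_ring_def)
  then show ?thesis
    using M_add_aux[of y x] M_add_aux[of x y] assms False by (auto simp: add.commute)
qed (use assms in auto)

lemma M_uminus: "x \<in> M \<Longrightarrow> - x \<in> M" using M_mult[of "-1" x] by (simp add: V_intros)
lemma M_diff: "x \<in> M \<Longrightarrow> y \<in> M \<Longrightarrow> x - y \<in> M" using M_add[of x "-y"] M_uminus by simp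
lemma M_sum: "(\<And>i. i \<in> I \<Longrightarrow> f i \<in> M) \<Longrightarrow> sum f I \<in> M"
  by (induction I rule: infinite_finite_induct) (auto intro: M_0 M_add)
lemma M_power: "x \<in> M \<Longrightarrow> n > 0 \<Longrightarrow> x ^ n \<in> M"
  by (cases n) (auto intro!: M_mult' V_intros dest: M_imp_V)

lemma not_M_mult: assumes "x \<notin> M" "y \<notin> M" shows "x * y \<notin> M"
proof
  assume "x * y \<in> M"
  then have "inverse x * (x * y) \<in> M" using not_M_imp_inverse_V[OF assms(1)] by (rule M_mult[rotated])
  moreover have "inverse x * (x * y) = y" using not_M_imp_nonzero[OF assms(1)] by simp
  ultimately show False using assms by simp
qed
lemma not_M_power: "x \<notin> M \<Longrightarrow> x ^ n \<notin> M"
  by (induction n) (auto simp: M_1 not_M_mult)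
lemma not_M_prod_mset: "(\<And>x. x \<in># A \<Longrightarrow> f x \<notin> M) \<Longrightarrow> (\<Prod>x\<in>#A. f x) \<notin> M"
  by (induction A) (auto simp: M_1 not_M_mult)
lemma not_M_add_M: "x \<notin> M \<Longrightarrow> y \<in> M \<Longrightarrow> x + y \<notin> M"
  using M_diff[of "x + y" y] by auto
lemma not_V_mult: assumes "x \<notin> V" "y \<notin> M" shows "x * y \<notin> V"
proof
  assume "x * y \<in> V"
  then have "(x * y) * inverse y \<in> V" using not_M_imp_inverse_V[OF assms(2)] by (rule V_intros)
  moreover have "(x * y) * inverse y = x" using not_M_imp_nonzero[OF assms(2)] by simp
  ultimately show False using assms by simp
qed
lemma not_V_power: "x \<notin> V \<Longrightarrow> n > 0 \<Longrightarrow> x ^ n \<notin> V"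
  using not_V_mult[OF _ not_M_power[OF not_V_imp_not_M]] by (cases n) auto
lemma inverse_not_M: "x \<in> V \<Longrightarrow> x \<noteq> 0 \<Longrightarrow> inverse x \<notin> M"
  by (auto simp: M_def)
lemma k_M: "x \<in> k \<Longrightarrow> x \<in> M \<Longrightarrow> x = 0"
  using subfield_k k_subset by (auto simp: M_def is_subfield_def)
text \<open>Residue characteristic 0: positive integers are nonzero elements of \<open>k\<close>,
  hence units at every place.\<close>

lemma of_nat_not_M: "n > 0 \<Longrightarrow> of_nat n \<notin> M"
  using k_M[of "of_nat n"] subring_of_nat[OF is_subring_subfield[OF subfield_k], of n] by auto

text \<open>At a pole of \<open>a\<close> the leading term dominates, because the coefficients are
  constants.\<close>

lemma poly_leading_unit:
  assumes p: "p \<in> polys_over k" "p \<noteq> 0" and a: "a \<notin> V"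
  shows "poly p a / a ^ degree p \<in> V" "poly p a / a ^ degree p \<notin> M"
proof -
  define n where "n = degree p"
  have a0: "a \<noteq> 0" using a V_intros by auto
  have "{..n} = insert n {..<n}" by auto
  then have "poly p a / a ^ n = lead_coeff p + (\<Sum>i<n. coeff p i * a ^ i / a ^ n)"
    using a0 unfolding poly_altdef n_def[symmetric] by (simp add: add_divide_distrib sum_divide_distrib n_def)
  also have "(\<Sum>i<n. coeff p i * a ^ i / a ^ n) = (\<Sum>i<n. coeff p i * inverse a ^ (n - i))"
    using a0 by (intro sum.cong) (auto simp: power_diff field_simps)
  finally have eq: "poly p a / a ^ n = lead_coeff p + (\<Sum>i<n. coeff p i * inverse a ^ (n - i))" .
  have c: "coeff p i \<in> k" for i using p by (simp add: polys_over_def)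
  have S: "(\<Sum>i<n. coeff p i * inverse a ^ (n - i)) \<in> M"
    using c k_subset not_V_imp_inverse_M[OF a] by (intro M_sum M_mult M_power) auto
  have "lead_coeff p \<in> V" using c k_subset by blast
  from V_intros(6)[OF this M_imp_V[OF S]] show "poly p a / a ^ degree p \<in> V"
    unfolding eq[symmetric] unfolding n_def .
  have "lead_coeff p \<notin> M" using k_M[OF c, of "degree p"] p(2) leading_coeff_0_iff[of p] by blast
  then show "poly p a / a ^ degree p \<notin> M" using eq S unfolding n_def by (simp add: not_M_add_M)
qed

end

definition field_adjoin :: "'a::field set \<Rightarrow> 'a \<Rightarrow> 'a set" where
  "field_adjoin k t = {poly p t / poly q t | p q. p \<in> polys_over k \<and> q \<in> polys_over k \<and> poly q t \<noteq> 0}"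

lemma field_adjoinI:
  "p \<in> polys_over k \<Longrightarrow> q \<in> polys_over k \<Longrightarrow> poly q t \<noteq> 0 \<Longrightarrow> poly p t / poly q t \<in> field_adjoin k t"
  unfolding field_adjoin_def by blast

lemma field_adjoinE:
  assumes "x \<in> field_adjoin k t"
  obtains p q where "x = poly p t / poly q t" "p \<in> polys_over k" "q \<in> polys_over k" "poly q t \<noteq> 0"
  using assms unfolding field_adjoin_def by blast

lemma is_subfield_field_adjoin:
  assumes k: "is_subfield k" shows "is_subfield (field_adjoin k t)"
proof -
  note R = is_subring_subfield[OF k]
  have 0: "0 \<in> field_adjoin k t"
    using field_adjoinI[of 0 k "[:1:]" t] polys_over_const[OF R subring_0[OF R]] subring_1[OF R]
    by (simp add: polys_over_const[OF R])
  have 1: "1 \<in> field_adjoin k t"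
    using field_adjoinI[of "[:1:]" k "[:1:]" t] subring_1[OF R] by (simp add: polys_over_const[OF R])
  have ops: "x + y \<in> field_adjoin k t \<and> x * y \<in> field_adjoin k t"
    if xy: "x \<in> field_adjoin k t" "y \<in> field_adjoin k t" for x y
  proof -
    obtain p q where x: "x = poly p t / poly q t" "p \<in> polys_over k" "q \<in> polys_over k" "poly q t \<noteq> 0"
      using xy(1) by (rule field_adjoinE)
    obtain p' q' where y: "y = poly p' t / poly q' t" "p' \<in> polys_over k" "q' \<in> polys_over k" "poly q' t \<noteq> 0"
      using xy(2) by (rule field_adjoinE)
    have "poly (p * q' + p' * q) t / poly (q * q') t \<in> field_adjoin k t"
      using x y by (intro field_adjoinI polys_over_add[OF R] polys_over_mult[OF R]) auto
    moreover have "poly (p * p') t / poly (q * q') t \<in> field_adjoin k t"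
      using x y by (intro field_adjoinI polys_over_mult[OF R]) auto
    ultimately show ?thesis using x y by (simp add: add_frac_eq)
  qed
  have inv: "inverse x \<in> field_adjoin k t" if "x \<in> field_adjoin k t" for x
  proof -
    obtain p q where x: "x = poly p t / poly q t" "p \<in> polys_over k" "q \<in> polys_over k" "poly q t \<noteq> 0"
      using \<open>x \<in> field_adjoin k t\<close> by (rule field_adjoinE)
    show ?thesis
    proof (cases "x = 0")
      case False
      then have "poly q t / poly p t \<in> field_adjoin k t" using x by (intro field_adjoinI) auto
      then show ?thesis using x by simp
    qed (use 0 in simp)
  qed
  have "- 1 \<in> field_adjoin k t"
    using field_adjoinI[of "[:-1:]" k "[:1:]" t] subring_1[OF R] subring_uminus[OF R]
    by (simp add: polys_over_const[OF R])
  then have "- x \<in> field_adjoin k t" if "x \<in> field_adjoin k t" for x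
    using ops[of "-1" x] that by simp
  then show ?thesis unfolding is_subfield_def using 0 1 ops inv by blast
qed

lemma subset_field_adjoin:
  assumes k: "is_subfield k" shows "k \<subseteq> field_adjoin k t"
proof
  note R = is_subring_subfield[OF k]
  fix c assume "c \<in> k"
  then show "c \<in> field_adjoin k t"
    using field_adjoinI[of "[:c:]" k "[:1:]" t] subring_1[OF R] by (simp add: polys_over_const[OF R])
qed

lemma in_field_adjoin:
  assumes k: "is_subfield k" shows "t \<in> field_adjoin k t"
proof -
  note R = is_subring_subfield[OF k]
  show ?thesis
    using field_adjoinI[of "[:0, 1:]" k "[:1:]" t] subring_0[OF R] subring_1[OF R]
    by (simp add: polys_over_const[OF R] polys_over_pCons[OF R])
qed

text \<open>The degree of a rational function in \<open>a\<close> is its order of growth at every place where \<open>a\<close> has a pole.\<close>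
lemma field_adjoin_degree:
  assumes "c \<in> field_adjoin k a" "c \<noteq> 0"
  obtains e :: int where "\<And>V. valued k V \<Longrightarrow> a \<notin> V \<Longrightarrow> c / a powi e \<in> V \<and> c / a powi e \<notin> valued.M V"
proof -
  obtain p q where c: "c = poly p a / poly q a" "p \<in> polys_over k" "q \<in> polys_over k" "poly q a \<noteq> 0"
    using assms(1) by (rule field_adjoinE)
  have p0: "p \<noteq> 0" "q \<noteq> 0" using c assms(2) by auto
  show ?thesis
  proof (rule that[of "int (degree p) - int (degree q)"])
    fix V assume "valued k V" and a: "a \<notin> V"
    then interpret valued k V by simp
    have a0: "a \<noteq> 0" using a V_intros by auto
    have "c / a powi (int (degree p) - int (degree q)) =
        (poly p a / a ^ degree p) * inverse (poly q a / a ^ degree q)"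
      using a0 by (simp add: c power_int_diff field_simps)
    moreover note u = poly_leading_unit[OF c(2) p0(1) a] poly_leading_unit[OF c(3) p0(2) a]
    have "(poly p a / a ^ degree p) * inverse (poly q a / a ^ degree q) \<in> V"
      by (rule V_intros(4)[OF u(1) not_M_imp_inverse_V[OF u(4)]])
    moreover have "(poly p a / a ^ degree p) * inverse (poly q a / a ^ degree q) \<notin> M"
      by (rule not_M_mult[OF u(2) inverse_not_M[OF u(3) not_M_imp_nonzero[OF u(4)]]])
    ultimately show "c / a powi (int (degree p) - int (degree q)) \<in> V \<and>
        c / a powi (int (degree p) - int (degree q)) \<notin> M"
      by simp
  qed
qed

text \<open>The elements bounded by some power of \<open>a\<close> form a valuation ring
  \<open>W\<close> above \<open>V\<close>. It contains k(a), hence everything algebraic over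
  k(a).\<close>

lemma (in valued) archimedean:
  assumes C: "C \<in> alg_closure_in (field_adjoin k a)" and a: "a \<notin> V"
  shows "\<exists>N. C / a ^ N \<in> V"
proof -
  define W where "W = {x. \<exists>N. x / a ^ N \<in> V}"
  have a0: "a \<noteq> 0" using a V_intros by auto
  have ia: "inverse a \<in> V" using not_V_imp_inverse_M[OF a] by (rule M_imp_V)
  have up: "x / a ^ N' \<in> V" if "x / a ^ N \<in> V" "N \<le> N'" for x N N'
  proof -
    have "x / a ^ N' = x / a ^ N * inverse a ^ (N' - N)"
      using a0 that(2) by (simp add: power_diff field_simps)
    also have "\<dots> \<in> V" using that(1) ia by (intro V_intros)
    finally show ?thesis .
  qed
  have "V \<subseteq> W" by (auto simp: W_def intro: exI[of _ 0])
  have "is_subring W" unfolding is_subring_def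
  proof (intro conjI ballI)
    show "1 \<in> W" using \<open>V \<subseteq> W\<close> V_intros by auto
    fix x y assume "x \<in> W" "y \<in> W"
    then obtain N N' where N: "x / a ^ N \<in> V" "y / a ^ N' \<in> V" by (auto simp: W_def)
    have "x / a ^ (N + N') \<in> V" "y / a ^ (N + N') \<in> V" using N by (auto intro: up)
    then have "(x - y) / a ^ (N + N') \<in> V" unfolding diff_divide_distrib by (intro V_intros)
    then show "x - y \<in> W" by (auto simp: W_def)
    have "(x / a ^ N) * (y / a ^ N') \<in> V" using N by (intro V_intros)
    then have "x * y / a ^ (N + N') \<in> V" by (simp add: power_add)
    then show "x * y \<in> W" by (auto simp: W_def)
  qed
  then have W: "valuation_ring W"
    using \<open>V \<subseteq> W\<close> val_ring unfolding valuation_ring_def by blast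
  have "field_adjoin k a \<subseteq> W"
  proof
    fix c assume c: "c \<in> field_adjoin k a"
    show "c \<in> W"
    proof (cases "c = 0")
      case True then show ?thesis using \<open>V \<subseteq> W\<close> V_intros by auto
    next
      case False
      obtain e :: int where e: "c / a powi e \<in> V"
        using field_adjoin_degree[OF c False] valued_axioms a by metis
      show ?thesis
      proof (cases "e \<ge> 0")
        case True
        then show ?thesis using e by (auto simp: W_def power_int_def)
      next
        case False
        then have "c / a powi e * inverse a ^ nat (- e) \<in> V" using e ia by (intro V_intros)
        then have "c \<in> V" using False a0 by (simp add: power_int_def field_simps)
        then show ?thesis using \<open>V \<subseteq> W\<close> by blast
      qed
    qed
  qed
  then have "alg_closure_in (field_adjoin k a) \<subseteq> W"
    using alg_closure_in_subset_valuation_ring[OF is_subfield_field_adjoin[OF subfield_k] W] by blast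
  then show ?thesis using C by (auto simp: W_def)
qed

section \<open>Algebraic numbers and maximal fields of constants\<close>

lemma Qbar_eq: "Qbar = alg_closure_in (\<rat> :: 'a::field_char_0 set)"
  unfolding Qbar_def alg_closure_in_def algebraic_altdef by blast

lemma is_subfield_Rats: "is_subfield (\<rat> :: 'a::field_char_0 set)"
  by (auto simp: is_subfield_def)

lemma is_subfield_Qbar: "is_subfield (Qbar :: 'a::field_char_0 set)"
  unfolding Qbar_eq by (rule is_subfield_alg_closure_in[OF is_subfield_Rats])

lemma alg_closure_in_Qbar: "alg_closure_in Qbar \<subseteq> (Qbar :: 'a::field_char_0 set)"
  unfolding Qbar_eq alg_closure_in_idem[OF is_subfield_Rats] by simp

text \<open>Over a maximal such field the data live in a field of transcendence degree one.\<close>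
lemma exists_maximal_field_of_constants:
  fixes D :: "'a::field_char_0 set"
  assumes "finite D" "\<not> D \<subseteq> Qbar"
  obtains k where "is_subfield k" "alg_closure_in k \<subseteq> k" "\<not> D \<subseteq> k"
    "\<And>t. t \<notin> k \<Longrightarrow> D \<subseteq> alg_closure_in (field_adjoin k t)"
proof -
  define \<A> where "\<A> = {k. is_subfield k \<and> alg_closure_in k \<subseteq> k \<and> \<not> D \<subseteq> k}"
  have "Qbar \<in> \<A>" using assms is_subfield_Qbar alg_closure_in_Qbar by (simp add: \<A>_def)
  then have "\<A> \<noteq> {}" by auto
  moreover have "\<Union>C \<in> \<A>" if C: "C \<noteq> {}" "subset.chain \<A> C" for C
  proof -
    have CA: "\<And>X. X \<in> C \<Longrightarrow> is_subfield X" "\<And>X. X \<in> C \<Longrightarrow> alg_closure_in X \<subseteq> X"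
      "\<And>X. X \<in> C \<Longrightarrow> \<not> D \<subseteq> X" using C(2) by (auto simp: subset_chain_def \<A>_def)
    have "is_subfield (\<Union>C)" unfolding is_subfield_def
    proof (intro conjI ballI)
      show "0 \<in> \<Union>C" "1 \<in> \<Union>C" using C(1) CA(1) by (auto simp: is_subfield_def)
      show "- x \<in> \<Union>C" "inverse x \<in> \<Union>C" if "x \<in> \<Union>C" for x
        using that CA(1) unfolding is_subfield_def by blast+
      fix x y assume xy: "x \<in> \<Union>C" "y \<in> \<Union>C"
      then have "{x, y} \<subseteq> \<Union>C" by auto
      then obtain X where "X \<in> C" "{x, y} \<subseteq> X"
        by (rule finite_subset_Union_chain[OF _ _ C, rotated]) auto
      then show "x + y \<in> \<Union>C" "x * y \<in> \<Union>C" using CA(1) by (auto simp: is_subfield_def)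
    qed
    moreover have "alg_closure_in (\<Union>C) \<subseteq> \<Union>C"
    proof
      fix x assume "x \<in> alg_closure_in (\<Union>C)"
      then obtain p where p: "p \<noteq> 0" "\<And>i. coeff p i \<in> \<Union>C" "poly p x = 0" by (auto simp: alg_closure_in_def)
      have "coeff p ` {..Suc (degree p)} \<subseteq> \<Union>C" using p by auto
      then obtain X where X: "X \<in> C" "coeff p ` {..Suc (degree p)} \<subseteq> X"
        by (rule finite_subset_Union_chain[OF _ _ C, rotated]) auto
      have "coeff p i \<in> X" for i
      proof (cases "i \<le> degree p")
        case False
        then have "coeff p i = coeff p (Suc (degree p))" by (simp add: coeff_eq_0)
        then show ?thesis using X by auto
      qed (use X in auto)
      then have "x \<in> alg_closure_in X" using p unfolding alg_closure_in_def by blast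
      then show "x \<in> \<Union>C" using CA(2) X(1) by blast
    qed
    moreover have "\<not> D \<subseteq> \<Union>C"
    proof
      assume "D \<subseteq> \<Union>C"
      then obtain X where "X \<in> C" "D \<subseteq> X"
        by (rule finite_subset_Union_chain[OF assms(1) _ C])
      then show False using CA(3) by blast
    qed
    ultimately show ?thesis by (simp add: \<A>_def)
  qed
  ultimately obtain k where k: "k \<in> \<A>" and max: "\<And>X. X \<in> \<A> \<Longrightarrow> k \<subseteq> X \<Longrightarrow> X = k"
    using subset_Zorn_nonempty[of \<A>] by blast
  show ?thesis
  proof (rule that[of k])
    show sk: "is_subfield k" and "alg_closure_in k \<subseteq> k" "\<not> D \<subseteq> k" using k by (auto simp: \<A>_def)
    fix t assume t: "t \<notin> k"
    let ?K = "alg_closure_in (field_adjoin k t)"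
    have F: "is_subfield (field_adjoin k t)" using sk by (rule is_subfield_field_adjoin)
    have "k \<subseteq> ?K" "t \<in> ?K"
      using subset_alg_closure_in[OF F] subset_field_adjoin[OF sk] in_field_adjoin[OF sk] by blast+
    \<comment> \<open>\<open>?K\<close> is an algebraically closed field properly containing
      \<open>k\<close>, so by maximality it can only fail to belong to the family by containing
      \<open>D\<close>.\<close>
    then have "?K \<notin> \<A>" using max t by blast
    then show "D \<subseteq> ?K"
      using is_subfield_alg_closure_in[OF F] alg_closure_in_idem[OF F] by (simp add: \<A>_def)
  qed
qed

text \<open>For a maximal field of constants \<open>k\<close> as above this contains the data, and each of its elements is
  algebraic over \<open>k(t)\<close> for every \<open>t\<close> outside \<open>k\<close>.\<close>
definition dim_one_field :: "'a::field set \<Rightarrow> 'a set" where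
  "dim_one_field k = {x. \<forall>t. t \<notin> k \<longrightarrow> x \<in> alg_closure_in (field_adjoin k t)}"

lemma is_subfield_dim_one_field:
  assumes "is_subfield k" shows "is_subfield (dim_one_field k)"
proof -
  have "is_subfield (alg_closure_in (field_adjoin k t))" for t
    by (intro is_subfield_alg_closure_in is_subfield_field_adjoin assms)
  then show ?thesis unfolding dim_one_field_def is_subfield_def by blast
qed

lemma alg_closure_in_dim_one_field:
  assumes "is_subfield k" shows "alg_closure_in (dim_one_field k) \<subseteq> dim_one_field k"
proof
  fix x assume x: "x \<in> alg_closure_in (dim_one_field k)"
  have "x \<in> alg_closure_in (field_adjoin k t)" if "t \<notin> k" for t
  proof -
    have "dim_one_field k \<subseteq> alg_closure_in (field_adjoin k t)" using that by (auto simp: dim_one_field_def)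
    then have "x \<in> alg_closure_in (alg_closure_in (field_adjoin k t))" using x alg_closure_in_mono by blast
    then show ?thesis using alg_closure_in_idem[OF is_subfield_field_adjoin[OF assms]] by blast
  qed
  then show "x \<in> dim_one_field k" by (simp add: dim_one_field_def)
qed

lemma (in valued) dim_one_field_archimedean:
  assumes "C \<in> dim_one_field k" "a \<notin> V"
  shows "\<exists>N. C / a ^ N \<in> V"
  using archimedean[OF _ assms(2)] assms k_subset by (auto simp: dim_one_field_def)

section \<open>Finite-dimensional spans\<close>

inductive_set fspan :: "'a::field set \<Rightarrow> 'a set \<Rightarrow> 'a set" for F B where
  fspan_0: "0 \<in> fspan F B"
| fspan_step: "x \<in> fspan F B \<Longrightarrow> c \<in> F \<Longrightarrow> b \<in> B \<Longrightarrow> x + c * b \<in> fspan F B"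

lemma fspan_add:
  assumes "y \<in> fspan F B" "x \<in> fspan F B" shows "x + y \<in> fspan F B"
  using assms(1)
proof induction
  case (fspan_step y c b)
  have "(x + y) + c * b \<in> fspan F B" by (rule fspan.fspan_step[OF fspan_step(4,2,3)])
  then show ?case by (simp add: add.assoc)
qed (use assms in simp)

lemma fspan_scale:
  assumes F: "is_subring F" and "x \<in> fspan F B" "c \<in> F" shows "c * x \<in> fspan F B"
  using assms(2)
proof induction
  case (fspan_step x c' b)
  have "c * x + (c * c') * b \<in> fspan F B"
    using fspan_step assms by (intro fspan.fspan_step subring_mult[OF F])
  then show ?case by (simp add: algebra_simps)
qed (simp add: fspan_0)

lemma fspan_diff:
  assumes F: "is_subring F" and "x \<in> fspan F B" "y \<in> fspan F B" shows "x - y \<in> fspan F B"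
  using fspan_add[OF fspan_scale[OF F assms(3) subring_uminus[OF F subring_1[OF F]]] assms(2)] by simp

lemma fspan_base: "is_subring F \<Longrightarrow> b \<in> B \<Longrightarrow> b \<in> fspan F B"
  using fspan_step[OF fspan_0, of 1 F b B] subring_1 by auto

lemma fspan_sum:
  "(\<And>i. i \<in> I \<Longrightarrow> f i \<in> fspan F B) \<Longrightarrow> sum f I \<in> fspan F B"
  by (induction I rule: infinite_finite_induct) (auto intro: fspan_0 fspan_add)

lemma fspan_mult:
  assumes F: "is_subring F" and "x \<in> fspan F B" "y \<in> fspan F C"
  shows "x * y \<in> fspan F ((\<lambda>(b, c). b * c) ` (B \<times> C))"
  using assms(2)
proof induction
  case (fspan_step x c b)
  have "b * y \<in> fspan F ((\<lambda>(b, c). b * c) ` (B \<times> C))"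
    using assms(3)
  proof induction
    case (fspan_step y c' d)
    have "b * y + c' * (b * d) \<in> fspan F ((\<lambda>(b, c). b * c) ` (B \<times> C))"
      using fspan_step \<open>b \<in> B\<close> by (intro fspan.fspan_step) force+
    then show ?case by (simp add: algebra_simps)
  qed (simp add: fspan_0)
  then have "c * (b * y) \<in> fspan F ((\<lambda>(b, c). b * c) ` (B \<times> C))"
    using fspan_step(2) by (rule fspan_scale[OF F])
  then have "x * y + c * (b * y) \<in> fspan F ((\<lambda>(b, c). b * c) ` (B \<times> C))"
    using fspan_step(4) by (rule fspan_add)
  then show ?case by (simp add: algebra_simps)
qed (simp add: fspan_0)

lemma fspan_insertE:
  assumes F: "is_subring F" and "x \<in> fspan F (insert b B)"
  shows "\<exists>c\<in>F. \<exists>y\<in>fspan F B. x = y + c * b"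
  using assms(2)
proof induction
  case fspan_0
  then show ?case using subring_0[OF F] fspan.fspan_0 by (intro bexI[of _ 0]) auto
next
  case (fspan_step x c d)
  then obtain c' y where y: "c' \<in> F" "y \<in> fspan F B" "x = y + c' * b" by auto
  show ?case
  proof (cases "d = b")
    case True
    then show ?thesis using y fspan_step
      by (intro bexI[of _ "c' + c"] bexI[of _ y] subring_add[OF F]) (auto simp: algebra_simps)
  next
    case False
    then have "y + c * d \<in> fspan F B" using y fspan_step by (intro fspan.fspan_step) auto
    then show ?thesis using y
      by (intro bexI[of _ c'] bexI[of _ "y + c * d"]) (auto simp: algebra_simps)
  qed
qed

text \<open>Gaussian elimination: a pivot \<open>s j\<close> involving the generator
  \<open>b\<close> removes \<open>b\<close> from all other vectors, leaving one vector and one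
  generator fewer.\<close>

lemma fspan_dependent:
  assumes F: "is_subfield F" and "finite B" "finite I" "card I > card B"
    "\<And>i. i \<in> I \<Longrightarrow> s i \<in> fspan F B"
  shows "\<exists>c. (\<forall>i\<in>I. c i \<in> F) \<and> (\<exists>i\<in>I. c i \<noteq> 0) \<and> (\<Sum>i\<in>I. c i * s i) = 0"
  using assms(2-)
proof (induction B arbitrary: I s rule: finite_induct)
  case empty
  have "x = 0" if "x \<in> fspan F {}" for x using that by induction auto
  moreover have "I \<noteq> {}" using empty by auto
  ultimately show ?case
    using empty subring_1[OF is_subring_subfield[OF F]]
    by (intro exI[of _ "\<lambda>_. 1"]) (auto intro!: sum.neutral)
next
  case (insert b B)
  note R = is_subring_subfield[OF F]
  have "\<forall>i\<in>I. \<exists>c y. c \<in> F \<and> y \<in> fspan F B \<and> s i = y + c * b"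
    using fspan_insertE[OF R] insert.prems(3) by blast
  then obtain g t where gt: "\<And>i. i \<in> I \<Longrightarrow> g i \<in> F \<and> t i \<in> fspan F B \<and> s i = t i + g i * b"
    by metis
  show ?case
  proof (cases "\<forall>i\<in>I. g i = 0")
    case True
    then show ?thesis using gt insert by (intro insert.IH) auto
  next
    case False
    then obtain j where j: "j \<in> I" "g j \<noteq> 0" by auto
    define u where "u i = s i - g i / g j * s j" for i
    have q: "g i / g j \<in> F" if "i \<in> I" for i
    proof -
      have "inverse (g j) \<in> F" using gt[OF j(1)] F by (auto simp: is_subfield_def)
      then show ?thesis using gt[OF that] subring_mult[OF R] by (simp add: divide_inverse)
    qed
    have "u i \<in> fspan F B" if "i \<in> I - {j}" for i
    proof -
      have "u i = t i - g i / g j * t j"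
        using gt[of i] gt[of j] j that unfolding u_def by (simp add: field_simps)
      also have "\<dots> \<in> fspan F B"
        using gt j that q by (intro fspan_diff[OF R] fspan_scale[OF R]) auto
      finally show ?thesis .
    qed
    moreover have "card B < card (I - {j})" using insert j by simp
    ultimately obtain c where c: "\<And>i. i \<in> I - {j} \<Longrightarrow> c i \<in> F" "\<exists>i\<in>I - {j}. c i \<noteq> 0"
      "(\<Sum>i\<in>I - {j}. c i * u i) = 0"
      using insert.IH[of "I - {j}" u] insert.prems(1) by auto
    define c' where "c' i = (if i = j then - (\<Sum>i\<in>I - {j}. c i * (g i / g j)) else c i)" for i
    have "(\<Sum>i\<in>I. c' i * s i) = c' j * s j + (\<Sum>i\<in>I - {j}. c i * s i)"
      using j insert.prems(1) by (simp add: sum.remove[of I j] c'_def)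
    also have "\<dots> = (\<Sum>i\<in>I - {j}. c i * u i)"
      by (simp add: c'_def u_def right_diff_distrib sum_subtractf sum_distrib_right mult.assoc)
    finally have "(\<Sum>i\<in>I. c' i * s i) = 0" using c by simp
    moreover have "- (\<Sum>i\<in>I - {j}. c i * (g i / g j)) \<in> F" using c(1) q
      by (intro subring_uminus[OF R] subring_sum[OF R] subring_mult[OF R]) auto
    then have "\<forall>i\<in>I. c' i \<in> F" using c(1) by (auto simp: c'_def)
    moreover have "\<exists>i\<in>I. c' i \<noteq> 0" using c(2) by (auto simp: c'_def)
    ultimately show ?thesis by blast
  qed
qed

lemma alg_closure_power_span:
  assumes F: "is_subfield F" and x: "x \<in> alg_closure_in F"
  obtains C where "finite C" "\<And>n. x ^ n \<in> fspan F C"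
proof -
  note R = is_subring_subfield[OF F]
  obtain p where p: "p \<noteq> 0" "\<And>i. coeff p i \<in> F" "poly p x = 0"
    using x by (auto simp: alg_closure_in_def)
  define d where "d = degree p"
  define C where "C = (\<lambda>i. x ^ i) ` {..<d}"
  have a: "inverse (coeff p d) \<in> F" "coeff p d \<noteq> 0" using p F by (auto simp: is_subfield_def d_def)
  have "x ^ n \<in> fspan F C" for n
  proof (induction n rule: less_induct)
    case (less n)
    show ?case
    proof (cases "n < d")
      case True
      then show ?thesis by (intro fspan_base[OF R]) (auto simp: C_def)
    next
      case False
      have "{..d} = insert d {..<d}" by auto
      then have "coeff p d * x ^ d = - (\<Sum>i<d. coeff p i * x ^ i)"
        using p(3) unfolding poly_altdef d_def[symmetric] by (simp add: eq_neg_iff_add_eq_0)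
      then have "x ^ d = inverse (coeff p d) * (- (\<Sum>i<d. coeff p i * x ^ i))"
        using a(2) by (simp add: field_simps)
      moreover have "x ^ n = x ^ d * x ^ (n - d)" using False by (simp add: power_add[symmetric])
      ultimately have "x ^ n = (\<Sum>i<d. (- inverse (coeff p d) * coeff p i) * x ^ (i + (n - d)))"
        by (simp add: sum_distrib_left sum_distrib_right sum_negf power_add mult.assoc)
      also have "\<dots> \<in> fspan F C"
        using less False a p(2)
        by (intro fspan_sum fspan_scale[OF R] subring_mult[OF R] subring_uminus[OF R]) auto
      finally show ?thesis .
    qed
  qed
  then show ?thesis using that[of C] by (simp add: C_def)
qed

text \<open>Because \<open>S\<close> is a ring, it contains the whole orbit as soon as
  \<open>D\<close> contains the coefficients and the starting point; all orbit points then lie in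
  one finite-dimensional space over \<open>F\<close>.\<close>

lemma finite_span_ring:
  assumes F: "is_subfield F" and D: "finite D" "D \<subseteq> alg_closure_in F"
  obtains S B where "is_subring S" "D \<subseteq> S" "finite B" "S \<subseteq> fspan F B"
proof -
  note R = is_subring_subfield[OF F]
  have "\<exists>S B. is_subring S \<and> D \<subseteq> S \<and> finite B \<and> S \<subseteq> fspan F B \<and> F \<subseteq> S"
    using D
  proof (induction D rule: finite_induct)
    case empty
    have "F \<subseteq> fspan F {1}" using fspan_step[OF fspan_0, of _ F 1 "{1}"] by auto
    then show ?case using R by (intro exI[of _ F] exI[of _ "{1}"]) auto
  next
    case (insert x D)
    then obtain S B where S: "is_subring S" "D \<subseteq> S" "finite B" "S \<subseteq> fspan F B" "F \<subseteq> S" by auto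
    obtain C where C: "finite C" "\<And>n. x ^ n \<in> fspan F C"
      using alg_closure_power_span[OF F, of x] insert.prems by auto
    let ?BC = "(\<lambda>(b, c). b * c) ` (B \<times> C)"
    have "adjoin S x \<subseteq> fspan F ?BC"
    proof
      fix z assume "z \<in> adjoin S x"
      then obtain p where p: "p \<in> polys_over S" "z = poly p x" by (auto simp: adjoin_def[OF S(1)])
      show "z \<in> fspan F ?BC" unfolding p(2) poly_altdef
        using p(1) S(4) C by (intro fspan_sum fspan_mult[OF R]) (auto simp: polys_over_def)
    qed
    then show ?case
      using is_subring_adjoin[OF S(1), of x] subset_adjoin[OF S(1), of x] in_adjoin[OF S(1), of x] S C
      by (intro exI[of _ "adjoin S x"] exI[of _ ?BC]) auto
  qed
  then show ?thesis using that by blast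
qed

text \<open>A strictly shrinking chain of places would produce elements \<open>s i\<close> in triangular position,
  hence independent over \<open>k(a)\<close>, contradicting finite dimension.\<close>
lemma triangular_chain_bound:
  assumes k: "is_subfield k" and B: "finite B"
    and s: "\<And>i. i < r \<Longrightarrow> s i \<in> fspan (field_adjoin k a) B"
    and v: "\<And>i. i < r \<Longrightarrow> valued k (P i)" and a: "\<And>i. i < r \<Longrightarrow> a \<notin> P i"
    and below: "\<And>i j. i < r \<Longrightarrow> j < i \<Longrightarrow> s j / a \<in> valued.M (P i)"
    and diag: "\<And>i. i < r \<Longrightarrow> s i \<notin> valued.M (P i)"
    and above: "\<And>i j. i < j \<Longrightarrow> j < r \<Longrightarrow> s j \<in> valued.M (P i)"
  shows "r \<le> card B"
proof (rule ccontr)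
  assume "\<not> r \<le> card B"
  then obtain c where c: "\<And>i. i < r \<Longrightarrow> c i \<in> field_adjoin k a" "\<exists>i<r. c i \<noteq> 0" "(\<Sum>i<r. c i * s i) = 0"
    using fspan_dependent[OF is_subfield_field_adjoin[OF k] B, of "{..<r}" s a] s by auto
  have "\<exists>e::int. \<forall>V. valued k V \<longrightarrow> a \<notin> V \<longrightarrow> c i / a powi e \<in> V \<and> c i / a powi e \<notin> valued.M V"
    if "i < r" "c i \<noteq> 0" for i
    using field_adjoin_degree[OF c(1)[OF that(1)] that(2)] by metis
  then obtain e :: "nat \<Rightarrow> int" where e: "\<And>i V. i < r \<Longrightarrow> c i \<noteq> 0 \<Longrightarrow> valued k V \<Longrightarrow> a \<notin> V \<Longrightarrow>
      c i / a powi e i \<in> V \<and> c i / a powi e i \<notin> valued.M V" by metis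
  define N where "N = {i. i < r \<and> c i \<noteq> 0}"
  have N: "finite N" "N \<noteq> {}" using c(2) by (auto simp: N_def)
  define E where "E = Max (e ` N)"
  have "\<exists>i. i \<in> N \<and> e i = E" using Max_in[of "e ` N"] N unfolding E_def by (metis (mono_tags, lifting) finite_imageI imageE image_is_empty)
  \<comment> \<open>Among the coefficients of largest growth the first is taken. Earlier ones are
    smaller by a factor of \<open>a\<close>, which is compensated by \<open>s j / a\<close> being
    small; later ones meet a small \<open>s j\<close>. The term at \<open>i\<close> therefore
    dominates the vanishing sum.\<close>
  define i where "i = (LEAST i. i \<in> N \<and> e i = E)"
  have i: "i \<in> N" "e i = E" using LeastI_ex[OF \<open>\<exists>i. i \<in> N \<and> e i = E\<close>] by (auto simp: i_def)
  have least: "e j < E" if "j < i" "j \<in> N" for j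
  proof -
    have "e j \<noteq> E" using not_less_Least[of j "\<lambda>i. i \<in> N \<and> e i = E"] that by (auto simp: i_def)
    moreover have "e j \<le> E" unfolding E_def using N that by simp
    ultimately show ?thesis by simp
  qed
  have ir: "i < r" "c i \<noteq> 0" using i by (auto simp: N_def)
  interpret valued k "P i" using v ir by simp
  have aP: "a \<notin> P i" and a0: "a \<noteq> 0" using a[OF ir(1)] V_intros(2) by auto
  have ia: "inverse a \<in> P i" using not_V_imp_inverse_M[OF aP] by (rule M_imp_V)
  have low: "c j / a powi f \<in> P i" if "j \<in> N" "e j \<le> f" for j f
  proof -
    have "a powi f = a powi e j * a powi (f - e j)"
      using a0 power_int_add[of a "e j" "f - e j"] by simp
    moreover have "a powi (f - e j) = a ^ nat (f - e j)" using that(2) by (simp add: power_int_def)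
    ultimately have "c j / a powi f = c j / a powi e j * inverse a ^ nat (f - e j)"
      by (simp add: divide_inverse power_inverse mult.assoc)
    also have "\<dots> \<in> P i" using e[of j "P i"] that ia aP valued_axioms by (intro V_intros) (auto simp: N_def)
    finally show ?thesis .
  qed
  have M: "c j * s j / a powi E \<in> M" if "j < r" "j \<noteq> i" for j
  proof (cases "c j = 0")
    case True then show ?thesis by (simp add: M_0)
  next
    case False
    then have jN: "j \<in> N" using that by (simp add: N_def)
    show ?thesis
    proof (cases "j < i")
      case True
      have "c j / a powi (E - 1) \<in> P i" using low[OF jN, of "E - 1"] least[OF True jN] by simp
      then have "(c j / a powi (E - 1)) * (s j / a) \<in> M" using below[OF ir(1) True] by (rule M_mult)
      moreover have "a powi E = a powi (E - 1) * a" using a0 power_int_add[of a "E - 1" 1] by simp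
      ultimately show ?thesis by simp
    next
      case False
      have "e j \<le> E" unfolding E_def using N jN by simp
      then have "(c j / a powi E) * s j \<in> M"
        using low[OF jN] above[of i j] that False by (intro M_mult) auto
      then show ?thesis by simp
    qed
  qed
  have "(\<Sum>j<r. c j * s j / a powi E) = 0" using c(3) by (simp add: sum_divide_distrib[symmetric])
  then have "c i * s i / a powi E = - (\<Sum>j\<in>{..<r} - {i}. c j * s j / a powi E)"
    using ir by (simp add: sum.remove[of _ i] eq_neg_iff_add_eq_0)
  also have "\<dots> \<in> M" using M by (intro M_uminus M_sum) auto
  finally have "(c i / a powi E) * s i \<in> M" by simp
  moreover have "(c i / a powi E) * s i \<notin> M"
    using e[OF ir valued_axioms aP] i diag[OF ir(1)] by (intro not_M_mult) auto
  ultimately show False by simp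
qed

section \<open>Orbits bounded at every place\<close>

text \<open>As long as some place separates two points of the current infinite set, their difference
  is recorded and the pigeonhole principle on \<open>W\<close> passes to an infinite subset
  congruent at that place. Later differences are then small there, so the record is triangular and
  stops after at most \<open>card B\<close> entries.\<close>

lemma infinite_subset_same_residues:
  fixes E :: "'a::field_char_0 set"
  assumes k: "is_subfield k" and B: "finite B" and inf: "infinite E"
    and span: "\<And>z z'. z \<in> E \<Longrightarrow> z' \<in> E \<Longrightarrow> z - z' \<in> fspan (field_adjoin k a) B"
    and P: "\<And>V. V \<in> \<P> \<Longrightarrow> valued k V \<and> a \<notin> V"
    and small: "\<And>V z z'. V \<in> \<P> \<Longrightarrow> z \<in> E \<Longrightarrow> z' \<in> E \<Longrightarrow> (z - z') / a \<in> valued.M V"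
    and W: "finite W" and near: "\<And>V z. V \<in> \<P> \<Longrightarrow> z \<in> E \<Longrightarrow> \<exists>w\<in>W. z - w \<in> valued.M V"
  shows "\<exists>E'\<subseteq>E. infinite E' \<and> (\<forall>V\<in>\<P>. \<forall>z\<in>E'. \<forall>z'\<in>E'. z - z' \<in> valued.M V)"
proof (rule ccontr)
  assume nex: "\<not> ?thesis"
  have "\<exists>s Q E'. E' \<subseteq> E \<and> infinite E' \<and> (\<forall>i<r. Q i \<in> \<P> \<and> (\<exists>z\<in>E. \<exists>z'\<in>E. s i = z - z') \<and>
      s i \<notin> valued.M (Q i) \<and> (\<forall>j<r. i < j \<longrightarrow> s j \<in> valued.M (Q i)) \<and>
      (\<forall>z\<in>E'. \<forall>z'\<in>E'. z - z' \<in> valued.M (Q i)))" for r :: nat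
  proof (induction r)
    case 0
    then show ?case using inf by auto
  next
    case (Suc r)
    then obtain s Q E' where h0: "E' \<subseteq> E" "infinite E'" and H: "\<forall>i<r. Q i \<in> \<P> \<and> (\<exists>z\<in>E. \<exists>z'\<in>E. s i = z - z') \<and>
      s i \<notin> valued.M (Q i) \<and> (\<forall>j<r. i < j \<longrightarrow> s j \<in> valued.M (Q i)) \<and>
      (\<forall>z\<in>E'. \<forall>z'\<in>E'. z - z' \<in> valued.M (Q i))" by (elim exE conjE)
    have h: "Q i \<in> \<P>" "\<exists>z\<in>E. \<exists>z'\<in>E. s i = z - z'" "s i \<notin> valued.M (Q i)"
      "\<And>j. j < r \<Longrightarrow> i < j \<Longrightarrow> s j \<in> valued.M (Q i)"
      "\<And>z z'. z \<in> E' \<Longrightarrow> z' \<in> E' \<Longrightarrow> z - z' \<in> valued.M (Q i)" if "i < r" for i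
      using H[rule_format, OF that] by simp_all
    obtain V z z' where V: "V \<in> \<P>" "z \<in> E'" "z' \<in> E'" "z - z' \<notin> valued.M V"
      using nex h0 by blast
    interpret valued k V using P[OF V(1)] by simp
    have "\<forall>y\<in>E'. \<exists>w. w \<in> W \<and> y - w \<in> M" using near[OF V(1)] h0(1) by blast
    then obtain g where g: "\<And>y. y \<in> E' \<Longrightarrow> g y \<in> W \<and> y - g y \<in> M" by metis
    have "finite (g ` E')" using g W by (meson finite_subset image_subsetI)
    then obtain y0 where y0: "infinite {y \<in> E'. g y = g y0}" using pigeonhole_infinite[OF h0(2)] by blast
    let ?E = "{y \<in> E'. g y = g y0}"
    have new: "y - y' \<in> M" if "y \<in> ?E" "y' \<in> ?E" for y y'
      using M_diff[of "y - g y0" "y' - g y0"] g[of y] g[of y'] that by auto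
    let ?s = "s(r := z - z')" and ?Q = "Q(r := V)"
    have "\<forall>i<Suc r. ?Q i \<in> \<P> \<and> (\<exists>z\<in>E. \<exists>z'\<in>E. ?s i = z - z') \<and>
      ?s i \<notin> valued.M (?Q i) \<and> (\<forall>j<Suc r. i < j \<longrightarrow> ?s j \<in> valued.M (?Q i)) \<and>
      (\<forall>z\<in>?E. \<forall>z'\<in>?E. z - z' \<in> valued.M (?Q i))"
    proof (intro allI impI)
      fix i assume "i < Suc r"
      then consider "i = r" | "i < r" by linarith
      then show "?Q i \<in> \<P> \<and> (\<exists>z\<in>E. \<exists>z'\<in>E. ?s i = z - z') \<and>
        ?s i \<notin> valued.M (?Q i) \<and> (\<forall>j<Suc r. i < j \<longrightarrow> ?s j \<in> valued.M (?Q i)) \<and>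
        (\<forall>z\<in>?E. \<forall>z'\<in>?E. z - z' \<in> valued.M (?Q i))"
      proof cases
        case 1
        then show ?thesis using V h0(1) new by auto
      next
        case 2
        then show ?thesis using h[OF 2] V by (auto simp: less_Suc_eq)
      qed
    qed
    moreover have "?E \<subseteq> E" using h0(1) by auto
    ultimately show ?case using y0 by (intro exI[of _ ?s] exI[of _ ?Q] exI[of _ ?E]) simp
  qed
  from this[of "Suc (card B)"] obtain s Q where H: "\<forall>i<Suc (card B). Q i \<in> \<P> \<and> (\<exists>z\<in>E. \<exists>z'\<in>E. s i = z - z') \<and>
      s i \<notin> valued.M (Q i) \<and> (\<forall>j<Suc (card B). i < j \<longrightarrow> s j \<in> valued.M (Q i))" by blast
  have h: "Q i \<in> \<P>" "\<exists>z\<in>E. \<exists>z'\<in>E. s i = z - z'" "s i \<notin> valued.M (Q i)"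
      "\<And>j. j < Suc (card B) \<Longrightarrow> i < j \<Longrightarrow> s j \<in> valued.M (Q i)" if "i < Suc (card B)" for i
    using H[rule_format, OF that] by simp_all
  have "Suc (card B) \<le> card B"
  proof (rule triangular_chain_bound[OF k B, of _ s a Q])
    fix i assume i: "i < Suc (card B)"
    show "s i \<in> fspan (field_adjoin k a) B" using h(2)[OF i] span by auto
    show "valued k (Q i)" "a \<notin> Q i" using h(1)[OF i] P by auto
    show "s i \<notin> valued.M (Q i)" using h(3)[OF i] .
    show "s j / a \<in> valued.M (Q i)" if "j < i" for j
      using h(2)[of j] h(1)[OF i] small that i by auto
  next
    fix i j assume "i < j" "j < Suc (card B)"
    then show "s j \<in> valued.M (Q i)" using h(4) by auto
  qed
  then show False by simp
qed

section \<open>Monic products and escape from a disc\<close>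

lemma coeff_prod_linear_top: "coeff (\<Prod>w\<in>#A. [:- w, 1:]) (size A) = (1 :: 'a::idom)"
proof -
  have "degree (\<Prod>w\<in>#A. [:- w, 1::'a:]) \<le> size A \<and> coeff (\<Prod>w\<in>#A. [:- w, 1::'a:]) (size A) = 1"
  proof (induction A)
    case (add x A)
    let ?P = "\<Prod>w\<in>#A. [:- w, 1::'a:]"
    have "degree ([:- x, 1:] * ?P) \<le> 1 + size A"
      using degree_mult_le[of "[:- x, 1:]" ?P] add.IH by simp
    moreover have "coeff ?P (Suc (size A)) = 0" using add.IH by (intro coeff_eq_0) auto
    ultimately show ?case using add.IH by (simp del: mult_pCons_left) simp
  qed simp
  then show ?thesis by blast
qed

lemma coeff_prod_linear_second:
  "A \<noteq> {#} \<Longrightarrow> coeff (\<Prod>w\<in>#A. [:- w, 1:]) (size A - 1) = - (\<Sum>w\<in>#A. w :: 'a::idom)"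
proof (induction A)
  case (add x A)
  show ?case
  proof (cases "A = {#}")
    case False
    then obtain n where n: "size A = Suc n" by (cases "size A") auto
    then show ?thesis using add.IH[OF False] coeff_prod_linear_top[of A] by simp
  qed simp
qed simp

context valued
begin

text \<open>By Vieta the coefficient is, up to sign, an elementary symmetric function of degree
  \<open>size A - j\<close> in roots smaller than \<open>\<rho>\<close>.\<close>

lemma coeff_prod_linear_small:
  assumes "\<And>w. w \<in># A \<Longrightarrow> w / \<rho> \<in> M" "\<rho> \<noteq> 0" "j < size A"
  shows "coeff (\<Prod>w\<in>#A. [:- w, 1:]) j / \<rho> ^ (size A - j) \<in> M"
  using assms(1,3)
proof (induction A arbitrary: j)
  case (add x A)
  let ?P = "\<Prod>w\<in>#A. [:- w, 1:]" and ?n = "size A"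
  have V: "coeff ?P i / \<rho> ^ (?n - i) \<in> V" if "i \<le> ?n" for i
    using add.IH[of i] add.prems(1) that coeff_prod_linear_top[of A] M_imp_V
    by (cases "i = ?n") (auto intro: V_intros)
  have x: "x / \<rho> \<in> M" using add.prems by simp
  have j: "j \<le> ?n" using add.prems by simp
  have 1: "(x / \<rho>) * (coeff ?P j / \<rho> ^ (?n - j)) \<in> M" using x V[OF j] by (rule M_mult')
  have 2: "\<rho> ^ (Suc ?n - j) = \<rho> * \<rho> ^ (?n - j)" using j by (simp add: Suc_diff_le)
  show ?case
  proof (cases j)
    case 0
    then show ?thesis using M_uminus[OF 1] 2 by simp
  next
    case (Suc i)
    have "coeff ?P i / \<rho> ^ (?n - i) \<in> M" using add Suc by auto
    from M_diff[OF this 1] show ?thesis using Suc 2 j by (simp add: diff_divide_distrib Suc_diff_Suc)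
  qed
qed simp

text \<open>Outside the disc of radius |rho| the leading term of \<open>f\<close> dominates.\<close>

lemma escape_ratio:
  assumes lc: "coeff f (degree f) = 1"
    and \<rho>: "\<rho> \<noteq> 0" "\<And>j. j < degree f \<Longrightarrow> coeff f j / \<rho> ^ (degree f - j) \<in> V"
    and z: "z / \<rho> \<notin> V"
  shows "poly f z / z ^ degree f \<notin> M"
proof -
  define d where "d = degree f"
  have z0: "z \<noteq> 0" using z V_intros by auto
  have rz: "\<rho> / z \<in> M" using not_V_imp_inverse_M[OF z] by simp
  have "{..d} = insert d {..<d}" by auto
  then have "poly f z / z ^ d = 1 + (\<Sum>i<d. coeff f i * z ^ i / z ^ d)"
    using z0 lc unfolding poly_altdef d_def[symmetric] by (simp add: add_divide_distrib sum_divide_distrib)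
  also have "(\<Sum>i<d. coeff f i * z ^ i / z ^ d) = (\<Sum>i<d. coeff f i / \<rho> ^ (d - i) * (\<rho> / z) ^ (d - i))"
    using z0 \<rho>(1) by (intro sum.cong) (auto simp: power_diff field_simps)
  also have "1 + \<dots> \<notin> M"
    using \<rho>(2) rz by (intro not_M_add_M M_1 M_sum M_mult M_power) (auto simp: d_def)
  finally show ?thesis by (simp add: d_def)
qed

text \<open>The true growth is exponential in degree; the linear exponent \<open>Suc n\<close> is
  enough to exceed every bound by the archimedean property.\<close>

lemma escape_growth:
  assumes lc: "coeff f (degree f) = 1" and d: "degree f \<ge> 2"
    and \<rho>: "\<rho> \<noteq> 0" "\<And>j. j < degree f \<Longrightarrow> coeff f j / \<rho> ^ (degree f - j) \<in> V" "inverse \<rho> \<in> V"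
    and z: "z / \<rho> \<notin> V"
  shows "(poly f ^^ n) z / z ^ Suc n \<notin> M"
proof (induction n)
  case 0
  have "z \<noteq> 0" using z V_intros by auto
  then show ?case by (simp add: M_1)
next
  case (Suc n)
  define y where "y = (poly f ^^ n) z"
  have z0: "z \<noteq> 0" using z V_intros by auto
  have zV: "z \<notin> V" using z \<rho>(3) V_intros(4)[of z "inverse \<rho>"] by (auto simp: divide_inverse)
  have yz: "y / z \<notin> M"
  proof -
    have "y / z ^ Suc n * z ^ n \<notin> M" unfolding y_def
      by (rule not_M_mult[OF Suc not_M_power[OF not_V_imp_not_M[OF zV]]])
    then show ?thesis using z0 by simp
  qed
  have y: "y / \<rho> \<notin> V"
  proof -
    have "z / \<rho> * (y / z) \<notin> V" using z yz by (rule not_V_mult)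
    then show ?thesis using z0 by simp
  qed
  have y0: "y \<noteq> 0" using y V_intros by auto
  have "y \<notin> M"
  proof -
    have "z * (y / z) \<notin> V" using zV yz by (rule not_V_mult)
    then show ?thesis using z0 M_imp_V by auto
  qed
  have "poly f y / y ^ degree f * (y / z ^ Suc n) * (y / z) * y ^ (degree f - 2) \<notin> M"
    using escape_ratio[OF lc \<rho>(1,2) y] Suc yz \<open>y \<notin> M\<close> unfolding y_def by (intro not_M_mult not_M_power)
  moreover have "y ^ degree f = y * y * y ^ (degree f - 2)"
    using d by (metis power_add power2_eq_square le_add_diff_inverse)
  ultimately show ?case using y0 by (simp add: y_def[symmetric] mult_ac)
qed

end

text \<open>The bound is taken from \<open>dim_one_field k\<close> because only such elements are
  known to lie below a power of any pole.\<close>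

definition bounded_at :: "'a::field_char_0 set \<Rightarrow> 'a set \<Rightarrow> 'a poly \<Rightarrow> 'a \<Rightarrow> bool" where
  "bounded_at k V f x \<longleftrightarrow> (\<exists>C\<in>dim_one_field k. C \<noteq> 0 \<and> (\<forall>n. (poly f ^^ n) x / C \<in> V))"

text \<open>A point \<open>z\<close> outside the disc would reach |z|^(N+1) after N steps, while the
  bound is at most |z|^N for some N.\<close>

lemma (in valued) bounded_imp_in_disc:
  assumes b: "bounded_at k V f x" and lc: "coeff f (degree f) = 1" and d: "degree f \<ge> 2"
    and \<rho>: "\<rho> \<noteq> 0" "\<And>j. j < degree f \<Longrightarrow> coeff f j / \<rho> ^ (degree f - j) \<in> V" "inverse \<rho> \<in> V"
  shows "(poly f ^^ n) x / \<rho> \<in> V"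
proof (rule ccontr)
  define z where "z = (poly f ^^ n) x"
  assume "(poly f ^^ n) x / \<rho> \<notin> V"
  then have z: "z / \<rho> \<notin> V" by (simp add: z_def)
  have zV: "z \<notin> V" using z \<rho>(3) V_intros(4)[of z "inverse \<rho>"] by (auto simp: divide_inverse)
  have z0: "z \<noteq> 0" using z V_intros by auto
  obtain C where C: "C \<in> dim_one_field k" "C \<noteq> 0" "\<And>n. (poly f ^^ n) x / C \<in> V"
    using b by (auto simp: bounded_at_def)
  obtain N where N: "C / z ^ N \<in> V" using dim_one_field_archimedean[OF C(1) zV] by blast
  have "(poly f ^^ N) z / C \<in> V" using C(3)[of "N + n"] by (simp add: z_def funpow_add)
  from V_intros(4)[OF this N] have "(poly f ^^ N) z / z ^ N \<in> V" using C(2) by simp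
  moreover have "z * ((poly f ^^ N) z / z ^ Suc N) \<notin> V"
    using zV escape_growth[OF lc d \<rho> z] by (rule not_V_mult)
  ultimately show False using z0 by simp
qed

text \<open>Sizes are totally ordered by divisibility in \<open>V\<close>. The second conjunct
  guards against \<open>x / 0 = 0\<close>, which always lies in \<open>V\<close>.\<close>

lemma (in valued) finite_has_max:
  assumes "finite S" "S \<noteq> {}"
  shows "\<exists>m\<in>S. \<forall>x\<in>S. x / m \<in> V \<and> (m = 0 \<longrightarrow> x = 0)"
  using assms
proof (induction S rule: finite_ne_induct)
  case (singleton x)
  then show ?case by (cases "x = 0") (auto intro: V_intros)
next
  case (insert x S)
  then obtain m where m: "m \<in> S" "\<And>y. y \<in> S \<Longrightarrow> y / m \<in> V \<and> (m = 0 \<longrightarrow> y = 0)" by blast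
  show ?case
  proof (cases "x / m \<in> V \<and> (m = 0 \<longrightarrow> x = 0)")
    case True
    then show ?thesis using m by blast
  next
    case False
    have x0: "x \<noteq> 0" using False V_intros by auto
    have mx: "m / x \<in> V"
    proof (cases "m = 0")
      case False
      then have "inverse (x / m) \<in> V" using \<open>\<not> (x / m \<in> V \<and> _)\<close> not_V_imp_inverse_M M_imp_V by blast
      then show ?thesis by simp
    qed (simp add: V_intros)
    have "y / x \<in> V" if "y \<in> S" for y
    proof (cases "m = 0")
      case True
      then have "y = 0" using m(2)[OF that] by blast
      then show ?thesis by (simp add: V_intros)
    next
      case False
      then show ?thesis using V_intros(4)[of "y / m" "m / x"] conjunct1[OF m(2)[OF that]] mx by simp
    qed
    then show ?thesis using x0 V_intros(1) by (intro bexI[of _ x]) auto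
  qed
qed

text \<open>\<open>\<rho>\<close> is the radius of the disc outside which orbits escape.
  \<open>attained\<close> says that the radius cannot be lowered: after rescaling by
  \<open>\<rho>\<close>, the reduction of \<open>f\<close> is not a pure power of the
  variable.\<close>

locale bad_place = valued k V for k V :: "'a::{alg_closed_field, field_char_0} set" +
  fixes f :: "'a poly" and \<rho> :: 'a
  assumes lc: "coeff f (degree f) = 1" and deg: "degree f \<ge> 2"
    and centred: "coeff f (degree f - 1) = 0"
    and bad: "\<rho> \<notin> V"
    and coeffs: "\<And>j. j < degree f \<Longrightarrow> coeff f j / \<rho> ^ (degree f - j) \<in> V"
    and attained: "\<exists>j<degree f. coeff f j / \<rho> ^ (degree f - j) \<notin> M"
begin

lemma rho_nonzero: "\<rho> \<noteq> 0" using bad V_intros by auto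
lemma inverse_rho: "inverse \<rho> \<in> M" using bad by (rule not_V_imp_inverse_M)

lemma factor_shift:
  obtains A where "size A = degree f" "f - [:c:] = (\<Prod>w\<in>#A. [:- w, 1:])"
proof -
  have dd: "degree (f - [:c:]) = degree f"
    unfolding diff_conv_add_uminus by (rule degree_add_eq_left) (use deg in simp)
  have "lead_coeff (f - [:c:]) = 1"
    unfolding dd using deg lc by (simp add: coeff_pCons split: nat.split)
  moreover from this have "f - [:c:] \<noteq> 0" by auto
  ultimately show ?thesis
    using alg_closed_imp_factorization[of "f - [:c:]"] that dd by auto
qed

text \<open>Since \<open>f\<close> is centred, its reduction after scaling by \<open>\<rho>\<close> has at least two distinct roots.\<close>
lemma far_root:
  assumes c: "c / \<rho> \<in> V" and A: "size A = degree f" "f - [:c:] = (\<Prod>w\<in>#A. [:- w, 1:])"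
  shows "\<exists>w\<in>#A. (z - w) / \<rho> \<notin> M"
proof (rule ccontr)
  assume "\<not> ?thesis"
  then have small: "\<And>w. w \<in># A \<Longrightarrow> (z - w) / \<rho> \<in> M" by auto
  have "A \<noteq> {#}" using A deg by auto
  \<comment> \<open>Centredness makes the roots sum to 0, so if all are close to \<open>z\<close>,
    then \<open>degree f\<close> times \<open>z / \<rho>\<close> is in \<open>M\<close>. The degree
    is a unit, hence \<open>z\<close> and all roots are small, and so are all lower coefficients,
    against \<open>attained\<close>.\<close>
  from coeff_prod_linear_second[OF this]
  have "(\<Sum>w\<in>#A. w) = 0"
    unfolding A(2)[symmetric] A(1) using centred deg by (auto simp: coeff_pCons split: nat.splits)
  moreover have "(\<Sum>w\<in>#A. (z - w) / \<rho>) = (of_nat (size A) * z - (\<Sum>w\<in>#A. w)) / \<rho>"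
    by (induction A) (simp_all add: diff_divide_distrib add_divide_distrib algebra_simps)
  moreover have "(\<Sum>w\<in>#A. (z - w) / \<rho>) \<in> M"
    using small by (induction A) (auto intro: M_0 M_add)
  ultimately have "of_nat (degree f) * (z / \<rho>) \<in> M" using A(1) by simp
  then have z: "z / \<rho> \<in> M"
    using not_M_mult[OF of_nat_not_M[of "degree f"], of "z / \<rho>"] deg by linarith
  have small': "w / \<rho> \<in> M" if "w \<in># A" for w
    using M_diff[OF z small[OF that]] by (simp add: diff_divide_distrib)
  obtain j where j: "j < degree f" "coeff f j / \<rho> ^ (degree f - j) \<notin> M" using attained by blast
  have m: "coeff (f - [:c:]) j / \<rho> ^ (degree f - j) \<in> M"
    using coeff_prod_linear_small[OF small' rho_nonzero, where j = j and A = A] j(1) unfolding A(2)[symmetric] A(1) by simp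
  show False
  proof (cases j)
    case 0
    have "(c / \<rho>) * inverse \<rho> ^ (degree f - 1) \<in> M"
      using c inverse_rho deg by (intro M_mult M_power) auto
    moreover have "\<rho> ^ degree f = \<rho> * \<rho> ^ (degree f - 1)" using deg by (simp add: power_eq_if)
    ultimately have "c / \<rho> ^ degree f \<in> M" by (simp add: divide_inverse power_inverse mult.assoc)
    from M_add[OF m[unfolded 0] this[folded diff_zero]] show ?thesis
      using j(2) 0 by (simp add: diff_divide_distrib)
  next
    case (Suc i)
    then show ?thesis using m j(2) by simp
  qed
qed

text \<open>Suppose \<open>z\<close> is far from every root of the second iterate. For each root c
  of \<open>f\<close>, the polynomial f - c has a root at distance at least |rho| from
  \<open>z\<close> and the others at distance at least 1, so |f(z) - c| >= |rho|. Multiplying over c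
  gives |f(f(z))| >= |rho|^d, too large for a point of the disc. A single iterate would not force
  this.\<close>

lemma near_root:
  assumes z: "poly f z / \<rho> \<in> V" "poly f (poly f z) / \<rho> \<in> V"
  shows "\<exists>w. poly f (poly f w) = 0 \<and> z - w \<in> M"
proof (rule ccontr)
  assume "\<not> ?thesis"
  then have far: "\<And>w. poly f (poly f w) = 0 \<Longrightarrow> z - w \<notin> M" by blast
  obtain C where C: "size C = degree f" "f - [:0:] = (\<Prod>w\<in>#C. [:- w, 1:])" by (rule factor_shift)
  have ev: "poly (\<Prod>w\<in>#A. [:- w, 1:]) y = (\<Prod>w\<in>#A. y - w)" for A and y :: 'a
    by (induction A) (auto simp: algebra_simps)
  have root0: "y \<in># A \<Longrightarrow> (\<Prod>w\<in>#A. y - w) = 0" for A and y :: 'a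
    by (auto simp: multiset_add_sub_el_shuffle dest!: multi_member_split)
  have pC: "poly f y = (\<Prod>c\<in>#C. y - c)" for y using C(2) ev[of C y] by simp
  have "(poly f z - c) / \<rho> \<notin> M" if c: "c \<in># C" for c
  proof -
    have fc: "poly f c = 0" using pC[of c] root0[OF c] by simp
    have cV: "c / \<rho> \<in> V"
    proof (rule ccontr)
      assume "c / \<rho> \<notin> V"
      from escape_ratio[OF lc rho_nonzero coeffs this] show False using fc M_0 by simp
    qed
    obtain A where A: "size A = degree f" "f - [:c:] = (\<Prod>w\<in>#A. [:- w, 1:])" by (rule factor_shift)
    have pA: "poly f y - c = (\<Prod>w\<in>#A. y - w)" for y
      using arg_cong[OF A(2), of "\<lambda>p. poly p y"] ev[of A y] by simp
    have wA: "z - w \<notin> M" if "w \<in># A" for w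
    proof -
      have "poly f w = c" using pA[of w] root0[OF that] by simp
      then show ?thesis using far fc by auto
    qed
    obtain w where w: "w \<in># A" "(z - w) / \<rho> \<notin> M" using far_root[OF cV A] by blast
    then obtain A' where A': "A = add_mset w A'" by (meson multi_member_split)
    have "(z - w) / \<rho> * (\<Prod>w\<in>#A'. z - w) \<notin> M"
      using w wA A' by (intro not_M_mult not_M_prod_mset) auto
    then show ?thesis using pA[of z] A' by simp
  qed
  then have "(\<Prod>c\<in>#C. (poly f z - c) / \<rho>) \<notin> M" by (intro not_M_prod_mset) auto
  moreover have "(\<Prod>c\<in>#C. (y - c) / \<rho>) = (\<Prod>c\<in>#C. y - c) / \<rho> ^ size C" for y
    by (induction C) auto
  ultimately have "poly f (poly f z) / \<rho> ^ degree f \<notin> M" using pC[of "poly f z"] C(1) by simp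
  moreover have "(poly f (poly f z) / \<rho>) * inverse \<rho> ^ (degree f - 1) \<in> M"
    using z(2) inverse_rho deg by (intro M_mult M_power) auto
  moreover have "\<rho> ^ degree f = \<rho> * \<rho> ^ (degree f - 1)" using deg by (simp add: power_eq_if)
  ultimately show False by (simp add: divide_inverse power_inverse mult.assoc)
qed

end

theorem bounded_orbit_imp_constant:
  fixes f :: "'a::{alg_closed_field, field_char_0} poly"
  assumes k: "is_subfield k" "alg_closure_in k \<subseteq> k"
    and lc: "coeff f (degree f) = 1" and deg: "degree f \<ge> 2" and cen: "coeff f (degree f - 1) = 0"
    and fL: "\<And>i. coeff f i \<in> dim_one_field k" and xL: "x \<in> dim_one_field k"
    and inf: "infinite (orbit f x)"
    and bd: "\<And>V. valued k V \<Longrightarrow> bounded_at k V f x"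
  shows "(\<forall>i. coeff f i \<in> k) \<and> x \<in> k"
proof -
  define d where "d = degree f"
  have detect: "\<exists>V. valued k V \<and> y \<notin> V" if "y \<notin> k" for y
    using exists_valuation_ring[OF k(1), of y] k that by (auto simp: valued_def)
  have good: "(poly f ^^ n) x \<in> V" if V: "valued k V" and c: "\<And>i. coeff f i \<in> V" for V n
  proof -
    interpret valued k V by (rule V)
    show ?thesis using bounded_imp_in_disc[OF bd[OF V] lc deg, of 1 n] c by (simp add: V_intros)
  qed
  have fk: "\<forall>i. coeff f i \<in> k"
  proof (rule ccontr)
    assume "\<not> ?thesis"
    then obtain i0 where i0: "coeff f i0 \<notin> k" by blast
    \<comment> \<open>\<open>\<rho> j\<close> is the escape radius contributed by the coefficient of
      degree \<open>j\<close>; the largest of them is the radius at a given place.\<close>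
    have "\<exists>y. y ^ (d - j) = coeff f j" if "j < d" for j
      using nth_root_exists[of "d - j"] that by auto
    then obtain \<rho> where \<rho>: "\<And>j. j < d \<Longrightarrow> \<rho> j ^ (d - j) = coeff f j" by metis
    \<comment> \<open>The bad places are sorted by the index of a largest radius, so that a single
      element \<open>coeff f j\<close> has a pole at all places of one class.\<close>
    define \<P> where "\<P> j = {V. valued k V \<and> \<rho> j \<notin> V \<and> (\<forall>i<d. \<rho> i / \<rho> j \<in> V)}" for j
    have place: "bad_place k V f (\<rho> j)" and jlt: "j + 2 \<le> d" and aV: "coeff f j \<notin> V"
      and disc: "\<And>n. (poly f ^^ n) x / \<rho> j \<in> V"
      if "V \<in> \<P> j" "j < d" for V j
    proof -
      interpret valued k V using that by (simp add: \<P>_def)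
      have r: "\<rho> j \<notin> V" "\<And>i. i < d \<Longrightarrow> \<rho> i / \<rho> j \<in> V" using that by (auto simp: \<P>_def)
      have r0: "\<rho> j \<noteq> 0" using r V_intros by auto
      have q: "coeff f i / \<rho> j ^ (d - i) = (\<rho> i / \<rho> j) ^ (d - i)" if "i < d" for i
        using \<rho>[OF that] by (simp add: power_divide)
      have qV: "coeff f i / \<rho> j ^ (d - i) \<in> V" if "i < d" for i
        unfolding q[OF that] using r(2)[OF that] by (intro V_intros)
      show aV: "coeff f j \<notin> V" unfolding \<rho>[OF that(2), symmetric] using r(1) that(2) by (intro not_V_power) auto
      \<comment> \<open>Centredness leaves d - j >= 2, so \<open>coeff f j\<close>, of size |rho
        j|^(d-j), strictly dominates differences of orbit points, which have size at most |rho
        j|.\<close>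
      have "j \<noteq> d - 1"
      proof
        assume "j = d - 1"
        then have "coeff f j = 0" using cen by (simp add: d_def)
        then show False using aV V_intros by simp
      qed
      then show "j + 2 \<le> d" using that(2) by linarith
      show "bad_place k V f (\<rho> j)"
      proof unfold_locales
        show "coeff f (degree f) = 1" "2 \<le> degree f" "coeff f (degree f - 1) = 0" "\<rho> j \<notin> V"
          using lc deg cen r by auto
        show "coeff f i / \<rho> j ^ (degree f - i) \<in> V" if "i < degree f" for i
          using qV that by (simp add: d_def)
        show "\<exists>i<degree f. coeff f i / \<rho> j ^ (degree f - i) \<notin> M"
          using q[OF that(2)] r0 that(2) M_1 by (intro exI[of _ j]) (auto simp: d_def)
      qed
      show "(poly f ^^ n) x / \<rho> j \<in> V" for n
        using bounded_imp_in_disc[OF bd lc deg r0 _ M_imp_V[OF not_V_imp_inverse_M[OF r(1)]], of n]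
          qV valued_axioms by (simp add: d_def)
    qed
    have cover: "\<exists>j<d. V \<in> \<P> j" if V: "valued k V" and c: "coeff f i \<notin> V" for V i
    proof -
      interpret valued k V by (rule V)
      have "i < d"
      proof (rule ccontr)
        assume "\<not> i < d"
        then have "coeff f i = 1 \<or> coeff f i = 0" using lc by (cases "i = d") (auto simp: d_def coeff_eq_0)
        then show False using c V_intros by auto
      qed
      then have iV: "\<rho> i \<notin> V" using c \<rho>[of i] V_intros(7)[of "\<rho> i" "d - i"] by auto
      obtain j where j: "j < d" "\<And>l. l < d \<Longrightarrow> \<rho> l / \<rho> j \<in> V \<and> (\<rho> j = 0 \<longrightarrow> \<rho> l = 0)"
        using finite_has_max[of "\<rho> ` {..<d}"] \<open>i < d\<close> by auto
      have "\<rho> j \<notin> V"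
      proof
        assume "\<rho> j \<in> V"
        then have "(\<rho> i / \<rho> j) * \<rho> j \<in> V" using j(2)[OF \<open>i < d\<close>] by (intro V_intros) auto
        then show False using iV j(2)[OF \<open>i < d\<close>] V_intros(2) by (cases "\<rho> j = 0") auto
      qed
      then show ?thesis using j V by (auto simp: \<P>_def)
    qed
    define W where "W = {w. poly f (poly f w) = 0}"
    have W: "finite W"
    proof -
      have "pcompose f f \<noteq> 0" using pcompose_eq_0[of f f] lc deg by auto
      then show ?thesis using poly_roots_finite[of "pcompose f f"] by (simp add: W_def poly_pcompose)
    qed
    \<comment> \<open>The classes are treated one after the other, each time passing to an infinite
      subset.\<close>
    have "\<exists>E\<subseteq>orbit f x. infinite E \<and> (\<forall>i<j. \<forall>V\<in>\<P> i. \<forall>z\<in>E. \<forall>z'\<in>E. z - z' \<in> valued.M V)"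
      if "j \<le> d" for j
      using that
    proof (induction j)
      case 0
      then show ?case using inf by auto
    next
      case (Suc j)
      then have jd: "j < d" by simp
      then have "j \<le> d" by simp
      from Suc.IH[OF this] obtain E where E: "E \<subseteq> orbit f x" "infinite E"
        "\<forall>i<j. \<forall>V\<in>\<P> i. \<forall>z\<in>E. \<forall>z'\<in>E. z - z' \<in> valued.M V"
        by (elim exE conjE)
      show ?case
      proof (cases "\<P> j = {}")
        case True
        then show ?thesis using E by (intro exI[of _ E]) (auto simp: less_Suc_eq)
      next
        case False
        define a where "a = coeff f j"
        obtain V0 where V0: "V0 \<in> \<P> j" using False by blast
        have "a \<notin> k" using aV[OF V0 jd] V0 by (auto simp: a_def \<P>_def valued_def)
        define D where "D = insert x (coeff f ` {..d})"
        have F: "is_subfield (field_adjoin k a)" using k(1) by (rule is_subfield_field_adjoin)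
        have "D \<subseteq> alg_closure_in (field_adjoin k a)"
          using fL xL \<open>a \<notin> k\<close> by (auto simp: D_def dim_one_field_def)
        \<comment> \<open>The ring \<open>S\<close> will contain the orbit, which puts all
          differences into one finite-dimensional space over k(a).\<close>
        then obtain S B where S: "is_subring S" "D \<subseteq> S" "finite B" "S \<subseteq> fspan (field_adjoin k a) B"
          using finite_span_ring[OF F, of D] by (auto simp: D_def)
        have fS: "f \<in> polys_over S"
        proof -
          have "coeff f i \<in> S" for i
            using S(2) subring_0[OF S(1)] by (cases "i \<le> d") (auto simp: D_def d_def coeff_eq_0)
          then show ?thesis by (simp add: polys_over_def)
        qed
        have "(poly f ^^ n) x \<in> S" for n
          by (induction n) (use S fS poly_in_subring[OF S(1)] in \<open>auto simp: D_def\<close>)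
        then have ES: "E \<subseteq> S" using E(1) by (auto simp: orbit_def)
        have "\<exists>E'\<subseteq>E. infinite E' \<and> (\<forall>V\<in>\<P> j. \<forall>z\<in>E'. \<forall>z'\<in>E'. z - z' \<in> valued.M V)"
        proof (rule infinite_subset_same_residues[OF k(1) S(3) E(2), of a "\<P> j" W])
          show "z - z' \<in> fspan (field_adjoin k a) B" if "z \<in> E" "z' \<in> E" for z z'
            using subring_diff[OF S(1), of z z'] ES S(4) that by blast
          show "valued k V \<and> a \<notin> V" if "V \<in> \<P> j" for V
            using aV[OF that jd] that by (auto simp: \<P>_def a_def)
          show "(z - z') / a \<in> valued.M V" if V: "V \<in> \<P> j" and z: "z \<in> E" "z' \<in> E" for V z z'
          proof -
            interpret bad_place k V f "\<rho> j" using place[OF V jd] .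
            have "z / \<rho> j \<in> V" "z' / \<rho> j \<in> V" using z E(1) disc[OF V jd] by (auto simp: orbit_def)
            then have "(z - z') / \<rho> j \<in> V" unfolding diff_divide_distrib by (intro V_intros)
            then have "(z - z') / \<rho> j * inverse (\<rho> j) ^ (d - j - 1) \<in> M"
              using inverse_rho jlt[OF V jd] by (intro M_mult M_power) auto
            moreover have "a = \<rho> j * \<rho> j ^ (d - j - 1)"
              using \<rho>[OF jd] jd by (simp add: a_def power_eq_if)
            ultimately show ?thesis by (simp add: divide_inverse power_inverse mult.assoc)
          qed
          show "\<exists>w\<in>W. z - w \<in> valued.M V" if V: "V \<in> \<P> j" and z: "z \<in> E" for V z
          proof -
            interpret bad_place k V f "\<rho> j" using place[OF V jd] .
            obtain n where n: "z = (poly f ^^ n) x" using z E(1) by (auto simp: orbit_def)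
            show ?thesis using near_root[of z] disc[OF V jd, of "Suc n"] disc[OF V jd, of "Suc (Suc n)"]
              by (auto simp: n W_def)
          qed
        qed (rule W)
        then obtain E' where "E' \<subseteq> E" "infinite E'" "\<forall>V\<in>\<P> j. \<forall>z\<in>E'. \<forall>z'\<in>E'. z - z' \<in> valued.M V" by blast
        then show ?thesis using E by (intro exI[of _ E']) (auto simp: less_Suc_eq subset_iff)
      qed
    qed
    from this[OF le_refl] obtain E where E0: "E \<subseteq> orbit f x" "infinite E"
      and H: "\<forall>i<d. \<forall>V\<in>\<P> i. \<forall>z\<in>E. \<forall>z'\<in>E. z - z' \<in> valued.M V"
      by (elim exE conjE)
    have E: "E \<subseteq> orbit f x" "infinite E"
      "i < d \<Longrightarrow> V \<in> \<P> i \<Longrightarrow> z \<in> E \<Longrightarrow> z' \<in> E \<Longrightarrow> z - z' \<in> valued.M V" for i V z z'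
      using E0 H by simp_all
    obtain V0 where V0: "valued k V0" "coeff f i0 \<notin> V0" using detect[OF i0] by blast
    have "z = z'" if z: "z \<in> E" "z' \<in> E" for z z'
    proof -
      have "z - z' \<in> k"
      proof (rule ccontr)
        assume "z - z' \<notin> k"
        then obtain V where V: "valued k V" "z - z' \<notin> V" using detect by blast
        interpret valued k V by (rule V(1))
        show False
        proof (cases "\<forall>i. coeff f i \<in> V")
          case True
          then have "z \<in> V" "z' \<in> V" using good[OF V(1)] z E(1) by (auto simp: orbit_def)
          then show False using V(2) V_intros(3) by blast
        next
          case False
          then show False using cover[OF V(1)] E(3) z V(2) M_imp_V by blast
        qed
      qed
      moreover have "z - z' \<in> valued.M V0" using cover[OF V0] E(3) z by blast
      ultimately show ?thesis using valued.k_M[OF V0(1), of "z - z'"] by simp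
    qed
    moreover obtain z0 where "z0 \<in> E" using E(2) by fastforce
    ultimately have "E \<subseteq> {z0}" by blast
    then show False using E(2) finite_subset by blast
  qed
  moreover have "x \<in> k"
  proof (rule ccontr)
    assume "x \<notin> k"
    then obtain V where V: "valued k V" "x \<notin> V" using detect by blast
    then show False using good[OF V(1), of 0] fk by (auto simp: valued_def)
  qed
  ultimately show ?thesis by blast
qed

section \<open>Orbits escaping at a place\<close>

text \<open>The sum 1 + d + ... + d^(n-1), the exponent of the leading coefficient of a polynomial
  of degree \<open>d\<close> in that of its n-th iterate.\<close>

primrec geo :: "nat \<Rightarrow> nat \<Rightarrow> nat" where
  "geo d 0 = 0"
| "geo d (Suc n) = Suc (d * geo d n)"

lemma geo_eq: "int d ^ n - 1 = (int d - 1) * int (geo d n)"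
proof (induction n)
  case (Suc n)
  have "int d ^ Suc n - 1 = int d * (int d ^ n - 1) + (int d - 1)" by (simp add: algebra_simps)
  also have "\<dots> = (int d - 1) * int (geo d (Suc n))" unfolding Suc by (simp add: algebra_simps)
  finally show ?case .
qed simp

lemma geo_pos: "n > 0 \<Longrightarrow> geo d n > 0" by (cases n) auto

section \<open>Degrees and leading coefficients of iterates\<close>

lemma poly_poly_iter: "poly (poly_iter f n) = poly f ^^ n"
  unfolding poly_iter_def by (induction n) (auto simp: fun_eq_iff poly_pcompose)

lemma poly_iter_Suc: "poly_iter f (Suc n) = pcompose f (poly_iter f n)"
  by (simp add: poly_iter_def)

lemma poly_iter_0: "poly_iter f 0 = [:0, 1:]" by (simp add: poly_iter_def)

lemma poly_iter_over:
  assumes "is_subring A" "f \<in> polys_over A" shows "poly_iter f n \<in> polys_over A"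
proof (induction n)
  case 0
  show ?case unfolding poly_iter_0
    using assms(1) by (intro polys_over_pCons polys_over_const subring_0 subring_1)
next
  case (Suc n)
  then show ?case unfolding poly_iter_Suc using assms by (intro polys_over_pcompose)
qed

lemma degree_poly_iter: "degree (poly_iter (f :: 'a::idom poly) n) = degree f ^ n"
  by (induction n) (auto simp: poly_iter_0 poly_iter_Suc degree_pcompose)

lemma lead_coeff_poly_iter:
  fixes f :: "'a::idom poly"
  assumes "degree f > 0"
  shows "lead_coeff (poly_iter f n) = lead_coeff f ^ geo (degree f) n"
proof (induction n)
  case (Suc n)
  have "degree (poly_iter f n) > 0" using assms by (simp add: degree_poly_iter)
  then have "lead_coeff (poly_iter f (Suc n)) = lead_coeff f * lead_coeff (poly_iter f n) ^ degree f"
    unfolding poly_iter_Suc by (rule lead_coeff_comp)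
  then show ?case unfolding Suc by (simp add: power_mult[symmetric] mult.commute)
qed (simp add: poly_iter_0)

lemma iterate_iterate: "poly (poly_iter f a) ^^ l = poly f ^^ (a * l)"
  unfolding poly_poly_iter by (simp add: funpow_mult)

section \<open>Asymptotics of iterates at large points\<close>

context valued
begin

abbreviation L where "L \<equiv> dim_one_field k"

lemma subfield_L: "is_subfield L" using subfield_k by (rule is_subfield_dim_one_field)
lemma subring_L: "is_subring L" using subfield_L by (rule is_subring_subfield)
lemma L_inverse: "x \<in> L \<Longrightarrow> inverse x \<in> L" using subfield_L by (simp add: is_subfield_def)
lemma L_divide: "x \<in> L \<Longrightarrow> y \<in> L \<Longrightarrow> x / y \<in> L"
  using L_inverse subring_mult[OF subring_L] by (simp add: divide_inverse)

text \<open>In absolute values, |z| > max(1, |C|).\<close>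

definition large :: "'a \<Rightarrow> 'a \<Rightarrow> bool" where
  "large C z \<longleftrightarrow> z \<notin> V \<and> C / z \<in> M"

lemma large_nonzero: "large C z \<Longrightarrow> z \<noteq> 0" using V_intros(2) by (auto simp: large_def)

lemma large_mono: "large C z \<Longrightarrow> D / C \<in> V \<Longrightarrow> C \<noteq> 0 \<Longrightarrow> large D z"
  using M_mult[of "D / C" "C / z"] by (auto simp: large_def)

lemma exists_bound:
  assumes "finite D" "D \<subseteq> L"
  obtains C where "C \<in> L" "C \<noteq> 0" "inverse C \<in> V" "\<And>x. x \<in> D \<Longrightarrow> x / C \<in> V"
proof -
  have "\<exists>C\<in>insert 1 D. \<forall>x\<in>insert 1 D. x / C \<in> V \<and> (C = 0 \<longrightarrow> x = 0)"
    using assms(1) by (intro finite_has_max) auto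
  then obtain C where C: "C \<in> insert 1 D" "\<forall>x\<in>insert 1 D. x / C \<in> V \<and> (C = 0 \<longrightarrow> x = 0)"
    by (elim bexE)
  have "C \<in> L" using C(1) assms(2) subring_1[OF subring_L] by blast
  moreover have "C \<noteq> 0" using C(2) by (metis insertI1 zero_neq_one)
  moreover have "inverse C \<in> V" using bspec[OF C(2), of 1] by (simp add: divide_inverse)
  moreover have "\<And>x. x \<in> D \<Longrightarrow> x / C \<in> V" using C(2) by blast
  ultimately show ?thesis by (rule that)
qed

text \<open>The condition |u - 1| <= |delta|. For nonzero \<open>\<delta>\<close> in
  \<open>M\<close> this is a group of units, the principal units of level
  \<open>\<delta>\<close>.\<close>

definition near1 :: "'a \<Rightarrow> 'a set" where
  "near1 \<delta> = {u. (u - 1) / \<delta> \<in> V}"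

lemma near1_diff:
  assumes "u \<in> near1 \<delta>" "\<delta> \<in> M" "\<delta> \<noteq> 0" shows "u - 1 \<in> M"
  using M_mult[of "(u - 1) / \<delta>" \<delta>] assms by (auto simp: near1_def)

lemma near1_unit:
  assumes "u \<in> near1 \<delta>" "\<delta> \<in> M" "\<delta> \<noteq> 0" shows "u \<in> V" "u \<notin> M"
proof -
  note d = near1_diff[OF assms]
  have "1 + (u - 1) \<in> V" by (rule V_intros(6)[OF V_intros(1) M_imp_V[OF d]])
  then show "u \<in> V" by simp
  have "1 + (u - 1) \<notin> M" using d by (intro not_M_add_M M_1)
  then show "u \<notin> M" by simp
qed

lemma near1_1: "1 \<in> near1 \<delta>" by (simp add: near1_def V_intros)

lemma near1_mult:
  assumes "u \<in> near1 \<delta>" "v \<in> near1 \<delta>" "\<delta> \<in> M" "\<delta> \<noteq> 0" shows "u * v \<in> near1 \<delta>"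
proof -
  have "u \<in> V" using near1_unit[OF assms(1,3,4)] by simp
  then have "u * ((v - 1) / \<delta>) + (u - 1) / \<delta> \<in> V"
    using assms by (intro V_intros) (auto simp: near1_def)
  moreover have "u * ((v - 1) / \<delta>) + (u - 1) / \<delta> = (u * v - 1) / \<delta>"
    using assms(4) by (simp add: field_simps)
  ultimately show ?thesis by (simp add: near1_def)
qed

lemma near1_power:
  assumes "u \<in> near1 \<delta>" "\<delta> \<in> M" "\<delta> \<noteq> 0" shows "u ^ n \<in> near1 \<delta>"
  by (induction n) (use near1_1 near1_mult[OF assms(1) _ assms(2,3)] in auto)

lemma near1_inverse:
  assumes "u \<in> near1 \<delta>" "\<delta> \<in> M" "\<delta> \<noteq> 0" shows "inverse u \<in> near1 \<delta>"
proof -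
  note u = near1_unit[OF assms]
  have u0: "u \<noteq> 0" using u M_0 by auto
  have "- ((u - 1) / \<delta>) * inverse u \<in> V"
    using assms(1) not_M_imp_inverse_V[OF u(2)] by (intro V_intros) (auto simp: near1_def)
  moreover have "- ((u - 1) / \<delta>) * inverse u = (inverse u - 1) / \<delta>"
    using u0 assms(3) by (simp add: field_simps)
  ultimately show ?thesis by (simp add: near1_def)
qed

lemma near1_mono:
  assumes "u \<in> near1 \<delta>" "\<delta> / \<epsilon> \<in> V" "\<delta> \<noteq> 0" shows "u \<in> near1 \<epsilon>"
  using V_intros(4)[of "(u - 1) / \<delta>" "\<delta> / \<epsilon>"] assms by (simp add: near1_def)

lemma monic_ratio:
  assumes p: "p \<in> polys_over L" "lead_coeff p = b" "b \<noteq> 0" "degree p = d"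
  obtains C where "C \<in> L" "C \<noteq> 0" "inverse C \<in> V" "\<And>z. z \<notin> V \<Longrightarrow> poly p z / (b * z ^ d) \<in> near1 (C / z)"
proof -
  have b: "b \<in> L" using p by (auto simp: polys_over_def)
  define D where "D = (\<lambda>i. coeff p i / b) ` {..d}"
  have "D \<subseteq> L" using p(1) b by (auto simp: D_def polys_over_def intro: L_divide)
  then obtain C where C: "C \<in> L" "C \<noteq> 0" "inverse C \<in> V" "\<And>x. x \<in> D \<Longrightarrow> x / C \<in> V"
    using exists_bound[of D] by (auto simp: D_def)
  have "poly p z / (b * z ^ d) \<in> near1 (C / z)" if z: "z \<notin> V" for z
  proof -
    have z0: "z \<noteq> 0" using z V_intros(2) by auto
    have iz: "inverse z \<in> V" using not_V_imp_inverse_M[OF z] by (rule M_imp_V)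
    have "{..d} = insert d {..<d}" by auto
    then have eq: "poly p z / (b * z ^ d) = 1 + (\<Sum>i<d. coeff p i * z ^ i / (b * z ^ d))"
      using z0 p unfolding poly_altdef by (auto simp: add_divide_distrib sum_divide_distrib)
    have "(poly p z / (b * z ^ d) - 1) / (C / z) = (\<Sum>i<d. coeff p i * z ^ i / (b * z ^ d) / (C / z))"
      unfolding eq by (simp only: add_diff_cancel_left' sum_divide_distrib)
    also have "\<dots> = (\<Sum>i<d. (coeff p i / b) / C * inverse z ^ (d - 1 - i))"
    proof (rule sum.cong)
      fix i assume "i \<in> {..<d}"
      then have "z ^ d = z ^ i * (z * z ^ (d - 1 - i))"
        by (simp add: power_add[symmetric] power_Suc[symmetric] del: power_Suc)
      then show "coeff p i * z ^ i / (b * z ^ d) / (C / z) = (coeff p i / b) / C * inverse z ^ (d - 1 - i)"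
        using z0 by (simp add: divide_inverse power_inverse mult_ac)
    qed simp
    also have "\<dots> \<in> V"
    proof -
      have "coeff p i / b / C \<in> V" if "i \<le> d" for i using that by (intro C(4)) (auto simp: D_def)
      then show ?thesis by (intro V_intros iz) auto
    qed
    finally show ?thesis by (simp add: near1_def)
  qed
  then show ?thesis using that C by blast
qed

text \<open>The relative error stays within C / z uniformly in \<open>n\<close>: later steps happen
  at larger points and so make smaller errors, and neither powers nor products leave
  \<open>near1\<close>.\<close>

lemma iterate_asymptotics:
  assumes f: "f \<in> polys_over L" "lead_coeff f = b" "b \<noteq> 0" "degree f = d" "d \<ge> 2"
  obtains C where "C \<in> L" "C \<noteq> 0" "inverse C \<in> V"
    "\<And>z n. large C z \<Longrightarrow> (poly f ^^ n) z / (b ^ geo d n * z ^ (d ^ n)) \<in> near1 (C / z)"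
    "\<And>z n. large C z \<Longrightarrow> z / (poly f ^^ n) z \<in> V \<and> (n > 0 \<longrightarrow> z / (poly f ^^ n) z \<in> M)"
    "\<And>z n D. large C z \<Longrightarrow> large D z \<Longrightarrow> large D ((poly f ^^ n) z)"
proof -
  have b: "b \<in> L" using f by (auto simp: polys_over_def)
  obtain C0 where C0: "C0 \<in> L" "C0 \<noteq> 0" "\<And>z. z \<notin> V \<Longrightarrow> poly f z / (b * z ^ d) \<in> near1 (C0 / z)"
    using monic_ratio[OF f(1-4)] by metis
  \<comment> \<open>Including \<open>inverse b\<close> ensures |b z| > 1 at large \<open>z\<close>,
    so the points grow even if the leading coefficient is small.\<close>
  obtain C where C: "C \<in> L" "C \<noteq> 0" "inverse C \<in> V" "\<And>x. x \<in> {C0, inverse b} \<Longrightarrow> x / C \<in> V"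
    using exists_bound[of "{C0, inverse b}"] C0(1) b L_inverse by auto
  have step: "poly f z / (b * z ^ d) \<in> near1 (C / z) \<and> z / poly f z \<in> M \<and> poly f z \<notin> V"
    if z: "large C z" for z
  proof -
    have zV: "z \<notin> V" and CzM: "C / z \<in> M" and z0: "z \<noteq> 0" using z large_nonzero by (auto simp: large_def)
    have Cz0: "C / z \<noteq> 0" using C(2) z0 by simp
    define u where "u = poly f z / (b * z ^ d)"
    have u: "u \<in> near1 (C / z)" unfolding u_def
      by (rule near1_mono[OF C0(3)[OF zV]]) (use C(4)[of C0] C0(2) z0 in auto)
    note uu = near1_unit[OF u CzM Cz0]
    have u0: "u \<noteq> 0" using uu M_0 by auto
    have fz: "poly f z = u * (b * z ^ d)" using f(3) z0 by (simp add: u_def)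
    have "z ^ d = z * z * z ^ (d - 2)" using f(5) by (metis power_add power2_eq_square le_add_diff_inverse)
    then have e: "z / poly f z = inverse u * (inverse b / z) * inverse z ^ (d - 2)"
      unfolding fz using z0 u0 f(3) by (simp add: divide_inverse power_inverse mult_ac)
    have "inverse b / C * (C / z) \<in> M" using C(4)[of "inverse b"] CzM by (intro M_mult) auto
    then have "inverse b / z \<in> M" using C(2) by simp
    then have zf: "z / poly f z \<in> M"
      unfolding e using not_M_imp_inverse_V[OF uu(2)] M_imp_V[OF not_V_imp_inverse_M[OF zV]]
      by (intro M_mult' M_mult V_intros) auto
    have fz0: "poly f z \<noteq> 0" unfolding fz using u0 f(3) z0 by simp
    have "poly f z \<notin> V"
    proof
      assume "poly f z \<in> V"
      then have "z / poly f z * poly f z \<in> V" using M_imp_V[OF zf] by (intro V_intros)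
      then show False using fz0 zV by simp
    qed
    then show ?thesis using u zf by (simp add: u_def)
  qed
  have large_step: "large D (poly f z)" if "large C z" "large D z" for D z
  proof -
    have "D / z * (z / poly f z) \<in> M" using step[OF that(1)] that(2) M_imp_V
      by (intro M_mult) (auto simp: large_def)
    then show ?thesis using step[OF that(1)] large_nonzero[OF that(1)] by (simp add: large_def)
  qed
  have large_iter: "large D ((poly f ^^ n) z)" if "large C z" "large D z" for D z n
  proof -
    have "large C ((poly f ^^ n) z) \<and> large D ((poly f ^^ n) z)"
      by (induction n) (use that large_step in auto)
    then show ?thesis by simp
  qed
  have quot: "z / (poly f ^^ n) z \<in> V \<and> (n > 0 \<longrightarrow> z / (poly f ^^ n) z \<in> M)" if z: "large C z" for z n
  proof (induction n)
    case 0
    show ?case using large_nonzero[OF z] V_intros(1) by simp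
  next
    case (Suc n)
    let ?y = "(poly f ^^ n) z"
    have y: "large C ?y" using large_iter z by blast
    have "z / ?y * (?y / poly f ?y) \<in> M" using Suc step[OF y] by (intro M_mult) auto
    then have "z / poly f ?y \<in> M" using large_nonzero[OF y] by simp
    then show ?case using M_imp_V by simp
  qed
  have asym: "(poly f ^^ n) z / (b ^ geo d n * z ^ (d ^ n)) \<in> near1 (C / z)" if z: "large C z" for z n
  proof (induction n)
    case 0
    show ?case using large_nonzero[OF z] near1_1 by simp
  next
    case (Suc n)
    let ?y = "(poly f ^^ n) z"
    have y: "large C ?y" using large_iter z by blast
    have z0: "z \<noteq> 0" "?y \<noteq> 0" using z y large_nonzero by auto
    have CzM: "C / z \<in> M" "C / z \<noteq> 0" using z z0 C(2) by (auto simp: large_def)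
    have 1: "poly f ?y / (b * ?y ^ d) \<in> near1 (C / z)"
      by (rule near1_mono[of _ "C / ?y"]) (use step[OF y] quot[OF z, of n] z0 C(2) in auto)
    have 2: "(?y / (b ^ geo d n * z ^ (d ^ n))) ^ d \<in> near1 (C / z)"
      using Suc CzM by (rule near1_power)
    have "poly f ?y / (b * ?y ^ d) * (?y / (b ^ geo d n * z ^ (d ^ n))) ^ d
        = poly f ?y / (b * (b ^ geo d n * z ^ (d ^ n)) ^ d)"
      using z0 by (simp add: power_divide)
    also have "b * (b ^ geo d n * z ^ (d ^ n)) ^ d = b ^ geo d (Suc n) * z ^ (d ^ Suc n)"
      by (simp add: power_mult_distrib power_mult[symmetric] mult.commute)
    finally show ?case using near1_mult[OF 1 2 CzM] by simp
  qed
  show ?thesis by (rule that[OF C(1-3) asym quot large_iter])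
qed

text \<open>Once one point exceeds both \<open>D\<close> and the threshold of
  \<open>iterate_asymptotics\<close>, all later points stay beyond them.\<close>

lemma unbounded_imp_eventually_large:
  assumes f: "f \<in> polys_over L" "degree f \<ge> 2" and u: "\<not> bounded_at k V f x" and D: "D \<in> L"
  shows "\<exists>n0. \<forall>n\<ge>n0. large D ((poly f ^^ n) x)"
proof -
  have b0: "lead_coeff f \<noteq> 0" using f(2) by auto
  obtain C where C: "C \<in> L" "C \<noteq> 0" "\<And>z n D. large C z \<Longrightarrow> large D z \<Longrightarrow> large D ((poly f ^^ n) z)"
    using iterate_asymptotics[OF f(1) refl b0 refl f(2)] by metis
  obtain B where B: "B \<in> L" "B \<noteq> 0" "inverse B \<in> V" "\<And>x. x \<in> {C, D} \<Longrightarrow> x / B \<in> V"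
    using exists_bound[of "{C, D}"] C(1) D by auto
  obtain n0 where n0: "(poly f ^^ n0) x / B \<notin> V" using u B(1,2) by (auto simp: bounded_at_def)
  define z where "z = (poly f ^^ n0) x"
  have "z \<notin> V" using n0 B(3) V_intros(4)[of z "inverse B"] by (auto simp: z_def divide_inverse)
  moreover have "B / z \<in> M" using not_V_imp_inverse_M[OF n0] by (simp add: z_def)
  ultimately have lB: "large B z" by (simp add: large_def)
  have lC: "large C z" "large D z" using large_mono[OF lB _ B(2)] B(4) by auto
  have "large D ((poly f ^^ n) x)" if "n \<ge> n0" for n
  proof -
    have "(poly f ^^ n) x = (poly f ^^ (n - n0)) z" using that by (simp add: z_def funpow_add[symmetric, THEN fun_cong, unfolded o_def])
    then show ?thesis using C(3)[OF lC] by simp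
  qed
  then show ?thesis by blast
qed

text \<open>The sum is congruent to \<open>n\<close>, a unit. Consequently u^n - 1 has exactly the
  same size as u - 1.\<close>

lemma power_diff_unit:
  assumes "u - 1 \<in> M" "n > 0"
  shows "(\<Sum>i<n. u ^ i) \<notin> M"
proof -
  have "u ^ i - 1 \<in> M" for i
  proof -
    have "1 + (u - 1) \<in> V" by (rule V_intros(6)[OF V_intros(1) M_imp_V[OF assms(1)]])
    then have uV: "u \<in> V" by simp
    then show ?thesis unfolding power_diff_1_eq using assms(1) by (intro M_mult' V_intros) auto
  qed
  then have "of_nat n + (\<Sum>i<n. u ^ i - 1) \<notin> M"
    using of_nat_not_M[OF assms(2)] by (intro not_M_add_M M_sum)
  moreover have "of_nat n + (\<Sum>i<n. u ^ i - 1) = (\<Sum>i<n. u ^ i)" by (simp add: sum_subtractf)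
  ultimately show ?thesis by simp
qed

text \<open>If \<open>F \<noteq> G\<close>, the relative error \<open>(F(w) - G(w)) / G(w)\<close> keeps its exact size under further
  iteration: raising to the power \<open>s\<close> multiplies it by the unit \<open>s\<close>, and all other errors are smaller.\<close>
lemma monic_eq_of_large_coincidence:
  assumes F: "F \<in> polys_over L" "coeff F s = 1" "degree F = s"
    and G: "G \<in> polys_over L" "coeff G s = 1" "degree G = s" and s: "s \<ge> 2"
  shows "\<exists>C\<in>L. C \<noteq> 0 \<and> (\<forall>w h. large C w \<longrightarrow> h > 0 \<longrightarrow> (poly F ^^ h) w = (poly G ^^ h) w \<longrightarrow> F = G)"
proof (cases "F = G")
  case True
  then show ?thesis using subring_1[OF subring_L] by (intro bexI[of _ 1]) auto
next
  case False
  define E where "E = G - F"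
  define q where "q = degree E"
  define e where "e = coeff E q"
  have E0: "E \<noteq> 0" using False by (simp add: E_def)
  have e0: "e \<noteq> 0" using E0 by (simp add: e_def q_def)
  have EL: "E \<in> polys_over L" unfolding E_def using F G by (intro polys_over_diff[OF subring_L])
  have qs: "q < s"
  proof -
    have "q \<le> s" unfolding q_def E_def using F(3) G(3) by (intro degree_diff_le) auto
    moreover have "q \<noteq> s" using e0 F(2) G(2) by (auto simp: e_def E_def)
    ultimately show ?thesis by simp
  qed
  have lG: "lead_coeff G = 1" using G by simp
  obtain C1 where C1: "C1 \<in> L" "C1 \<noteq> 0"
    "\<And>z n. large C1 z \<Longrightarrow> (poly G ^^ n) z / (1 ^ geo s n * z ^ (s ^ n)) \<in> near1 (C1 / z)"
    "\<And>z n. large C1 z \<Longrightarrow> z / (poly G ^^ n) z \<in> V \<and> (n > 0 \<longrightarrow> z / (poly G ^^ n) z \<in> M)"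
    "\<And>z n D. large C1 z \<Longrightarrow> large D z \<Longrightarrow> large D ((poly G ^^ n) z)"
    using iterate_asymptotics[OF G(1) lG one_neq_zero G(3) s] by metis
  obtain C2 where C2: "C2 \<in> L" "C2 \<noteq> 0" "\<And>z. z \<notin> V \<Longrightarrow> poly E z / (e * z ^ q) \<in> near1 (C2 / z)"
    using monic_ratio[OF EL _ e0, of q] by (metis e_def q_def)
  define D where "D = {C1, C2, e} \<union> coeff F ` {..s}"
  have "D \<subseteq> L" using C1 C2 EL F by (auto simp: D_def e_def polys_over_def)
  then obtain C where C: "C \<in> L" "C \<noteq> 0" "inverse C \<in> V" "\<And>x. x \<in> D \<Longrightarrow> x / C \<in> V"
    using exists_bound[of D] by (auto simp: D_def)
  have "F = G" if w: "large C w" and h: "h > 0" and eq: "(poly F ^^ h) w = (poly G ^^ h) w" for w h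
  proof -
    have lD: "large x z" if "x \<in> D" "large C z" for x z
      using large_mono[OF that(2) C(4)[OF that(1)] C(2)] .
    have lC1: "large C1 z" if "large C z" for z using lD[of C1] that by (simp add: D_def)
    have Eunit: "poly E z / (e * z ^ q) \<in> V" "poly E z / (e * z ^ q) \<notin> M" if z: "large C z" for z
    proof -
      have "large C2 z" using lD[of C2] z by (simp add: D_def)
      then have "z \<notin> V" "C2 / z \<in> M" "C2 / z \<noteq> 0" using C2(2) large_nonzero by (auto simp: large_def)
      then show "poly E z / (e * z ^ q) \<in> V" "poly E z / (e * z ^ q) \<notin> M"
        using near1_unit[OF C2(3)] by blast+
    qed
    have Gunit: "poly G z / z ^ s \<in> V" "poly G z / z ^ s \<notin> M" if z: "large C z" for z
    proof -
      have l: "large C1 z" using lC1 z .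
      then have "C1 / z \<in> M" "C1 / z \<noteq> 0" using C1(2) large_nonzero by (auto simp: large_def)
      then show "poly G z / z ^ s \<in> V" "poly G z / z ^ s \<notin> M"
        using near1_unit[OF C1(3)[OF l, of 1]] by auto
    qed
    define u v where "u j = (poly F ^^ j) w" and "v j = (poly G ^^ j) w" for j
    have vl: "large C (v j)" for j unfolding v_def using C1(5)[OF lC1[OF w] w] .
    have v0: "v j \<noteq> 0" for j using large_nonzero[OF vl] .
    have w0: "w \<noteq> 0" using large_nonzero[OF w] .
    define \<delta> where "\<delta> = poly E w / w ^ s"
    have Ew0: "poly E w \<noteq> 0" using Eunit[OF w] M_0 by auto
    have \<delta>0: "\<delta> \<noteq> 0" using Ew0 w0 by (simp add: \<delta>_def)
    have \<delta>M: "\<delta> \<in> M"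
    proof -
      have "e / w \<in> M" using lD[of e w] w by (simp add: D_def large_def)
      moreover have "inverse w \<in> V" using w not_V_imp_inverse_M M_imp_V by (auto simp: large_def)
      ultimately have "poly E w / (e * w ^ q) * (e / w * inverse w ^ (s - 1 - q)) \<in> M"
        using Eunit[OF w] by (intro M_mult M_mult' V_intros)
      moreover have "w ^ s = w ^ q * (w * w ^ (s - 1 - q))" using qs
        by (simp add: power_add[symmetric] power_Suc[symmetric] del: power_Suc)
      ultimately show ?thesis using e0 w0 by (simp add: \<delta>_def power_inverse field_simps)
    qed
    have claim: "(u (Suc j) - v (Suc j)) / v (Suc j) / \<delta> \<in> V \<and> (u (Suc j) - v (Suc j)) / v (Suc j) / \<delta> \<notin> M" for j
    proof (induction j)
      case 0
      have "(u (Suc 0) - v (Suc 0)) / v (Suc 0) / \<delta> = - inverse (poly G w / w ^ s)"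
        using Ew0 w0 v0[of 1] by (simp add: u_def v_def \<delta>_def E_def field_simps)
      moreover have "inverse (poly G w / w ^ s) \<in> V" using Gunit[OF w] not_M_imp_inverse_V by blast
      moreover have "inverse (poly G w / w ^ s) \<notin> M"
        using Gunit[OF w] inverse_not_M not_M_imp_nonzero by blast
      ultimately show ?case using V_intros(5) M_uminus[of "- inverse (poly G w / w ^ s)"] by auto
    next
      case (Suc j)
      define x y where "x = u (Suc j)" and "y = v (Suc j)"
      define \<theta> where "\<theta> = (x - y) / y"
      have yl: "large C y" and y0: "y \<noteq> 0" unfolding y_def by (rule vl, rule v0)
      have \<theta>: "\<theta> / \<delta> \<in> V" "\<theta> / \<delta> \<notin> M" using Suc by (auto simp: \<theta>_def x_def y_def)
      have \<theta>M: "\<theta> \<in> M" using M_mult[OF \<theta>(1) \<delta>M] \<delta>0 by simp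
      have \<theta>0: "\<theta> \<noteq> 0" using \<theta>(2) M_0 by auto
      have xy: "x = y * (1 + \<theta>)" using y0 by (simp add: \<theta>_def field_simps)
      define S where "S i = (\<Sum>l<i. (1 + \<theta>) ^ l)" for i
      have SV: "S i \<in> V" for i unfolding S_def using \<theta>M M_imp_V by (intro V_intros) auto
      have SM: "S s \<notin> M" unfolding S_def using \<theta>M s by (intro power_diff_unit) auto
      have "poly F x - poly F y = (\<Sum>i\<le>s. coeff F i * (y ^ i * ((1 + \<theta>) ^ i - 1)))"
        unfolding poly_altdef F(3) xy sum_subtractf[symmetric]
        by (simp only: power_mult_distrib right_diff_distrib mult_1_right)
      also have "\<dots> = \<theta> * (\<Sum>i\<le>s. coeff F i * y ^ i * S i)"
        unfolding power_diff_1_eq by (simp add: S_def sum_distrib_left mult_ac)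
      finally have "(poly F x - poly F y) / y ^ s / \<theta> = (\<Sum>i\<le>s. coeff F i * y ^ i * S i) / y ^ s"
        using \<theta>0 by simp
      also have "{..s} = insert s {..<s}" by auto
      also have "(\<Sum>i\<in>insert s {..<s}. coeff F i * y ^ i * S i) / y ^ s
          = S s + (\<Sum>i<s. coeff F i * y ^ i * S i / y ^ s)"
        using y0 F(2) by (simp add: add_divide_distrib sum_divide_distrib)
      finally have A: "(poly F x - poly F y) / y ^ s / \<theta> = S s + (\<Sum>i<s. coeff F i * y ^ i * S i / y ^ s)" .
      have "coeff F i * y ^ i * S i / y ^ s \<in> M" if "i < s" for i
      proof -
        have "coeff F i / y \<in> M" using lD[of "coeff F i" y] yl that by (simp add: D_def large_def)
        moreover have "inverse y \<in> V" using yl not_V_imp_inverse_M M_imp_V by (auto simp: large_def)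
        ultimately have "coeff F i / y * (inverse y ^ (s - 1 - i) * S i) \<in> M"
          using SV by (intro M_mult' V_intros)
        moreover have "y ^ s = y ^ i * (y * y ^ (s - 1 - i))" using that
          by (simp add: power_add[symmetric] power_Suc[symmetric] del: power_Suc)
        ultimately show ?thesis using y0 by (simp add: power_inverse field_simps)
      qed
      then have sumM: "(\<Sum>i<s. coeff F i * y ^ i * S i / y ^ s) \<in> M" by (intro M_sum) auto
      have A1: "(poly F x - poly F y) / y ^ s / \<theta> \<notin> M" unfolding A using SM sumM by (rule not_M_add_M)
      have A2: "(poly F x - poly F y) / y ^ s / \<theta> \<in> V" unfolding A by (rule V_intros(6)[OF SV M_imp_V[OF sumM]])
      have wy: "w / y \<in> M" using C1(4)[OF lC1[OF w], of "Suc j"] by (simp add: y_def v_def)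
      \<comment> \<open>The fresh error committed at \<open>y\<close> has size |e| |y|^(q-s),
        smaller than the first one |e| |w|^(q-s) because \<open>y\<close> is larger than
        \<open>w\<close>. It cannot cancel the inherited error.\<close>
      have Ey: "poly E y / y ^ s / \<delta> \<in> M"
      proof -
        have "poly E y / (e * y ^ q) * inverse (poly E w / (e * w ^ q)) * (w / y) ^ (s - q) \<in> M"
          using Eunit[OF yl] not_M_imp_inverse_V[OF Eunit(2)[OF w]] wy qs
          by (intro M_mult M_power V_intros) auto
        moreover have "w ^ s = w ^ q * w ^ (s - q)" "y ^ s = y ^ q * y ^ (s - q)"
          using qs by (simp_all add: power_add[symmetric])
        ultimately show ?thesis using e0 w0 y0 Ew0
          by (simp add: \<delta>_def power_divide field_simps)
      qed
      define R where "R = (poly F x - poly F y) / y ^ s / \<theta> * (\<theta> / \<delta>) - poly E y / y ^ s / \<delta>"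
      have "(poly F x - poly F y) / y ^ s / \<theta> * (\<theta> / \<delta>) \<notin> M" using A1 \<theta>(2) by (rule not_M_mult)
      from not_M_add_M[OF this M_uminus[OF Ey]] have RM: "R \<notin> M" by (simp add: R_def)
      have RV: "R \<in> V" unfolding R_def using A2 \<theta>(1) M_imp_V[OF Ey] by (intro V_intros)
      have "poly G y \<noteq> 0" using v0[of "Suc (Suc j)"] by (simp add: y_def v_def)
      then have "(u (Suc (Suc j)) - v (Suc (Suc j))) / v (Suc (Suc j)) / \<delta> = inverse (poly G y / y ^ s) * R"
        using y0 \<theta>0 by (simp add: R_def u_def v_def x_def y_def E_def diff_divide_distrib[symmetric])
      moreover have "inverse (poly G y / y ^ s) * R \<in> V"
        using not_M_imp_inverse_V[OF Gunit(2)[OF yl]] RV by (rule V_intros)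
      moreover have "inverse (poly G y / y ^ s) * R \<notin> M"
        using inverse_not_M[OF Gunit(1)[OF yl] not_M_imp_nonzero[OF Gunit(2)[OF yl]]] RM by (rule not_M_mult)
      ultimately show ?case by simp
    qed
    obtain j where j: "h = Suc j" using h by (cases h) auto
    have "u h = v h" using eq by (simp add: u_def v_def)
    then show ?thesis using claim[of j] M_0 by (simp add: j)
  qed
  then show ?thesis using C(1,2) by blast
qed

end

section \<open>Coincidences at a place\<close>

context valued
begin

lemma power_quotient_unit:
  assumes "x / y \<in> V" "x / y \<notin> M" shows "x ^ n / y ^ n \<in> V" "x ^ n / y ^ n \<notin> M"
  using V_intros(7)[OF assms(1), of n] not_M_power[OF assms(2), of n] by (simp_all add: power_divide)

lemma power_quotient_unit_imp_eq:
  assumes z: "z \<notin> V" and u: "z ^ A / z ^ B \<in> V" "z ^ A / z ^ B \<notin> M"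
  shows "A = B"
proof (rule ccontr)
  assume ne: "A \<noteq> B"
  have z0: "z \<noteq> 0" using z V_intros(2) by auto
  show False
  proof (cases "A < B")
    case True
    then have "z ^ A / z ^ B = inverse z ^ (B - A)"
      using z0 by (simp add: power_diff power_inverse field_simps)
    then show False using u(2) True M_power[OF not_V_imp_inverse_M[OF z], of "B - A"] by simp
  next
    case False
    then have "z ^ A / z ^ B = z ^ (A - B)" using z0 by (simp add: power_diff)
    then show False using u(1) False ne not_V_power[OF z, of "A - B"] by simp
  qed
qed

text \<open>Each hypothesis says |beta|^Q |z|^E = |z|^D. Raising the two relations to the powers
  \<open>Q2\<close> and \<open>Q1\<close> eliminates the unknown size of \<open>\<beta>\<close>, and
  distinct powers of \<open>z\<close> have distinct sizes.\<close>

lemma leading_power_relation: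
  assumes z: "z \<notin> V" and \<beta>: "\<beta> \<noteq> 0"
    and 1: "\<beta> ^ Q1 * z ^ E1 / z ^ D1 \<in> V" "\<beta> ^ Q1 * z ^ E1 / z ^ D1 \<notin> M"
    and 2: "\<beta> ^ Q2 * z ^ E2 / z ^ D2 \<in> V" "\<beta> ^ Q2 * z ^ E2 / z ^ D2 \<notin> M"
  shows "D2 * Q1 + E1 * Q2 = D1 * Q2 + E2 * Q1"
proof (rule power_quotient_unit_imp_eq[OF z])
  have z0: "z \<noteq> 0" using z V_intros(2) by auto
  define a b where "a = (\<beta> ^ Q1 * z ^ E1) ^ Q2 / (z ^ D1) ^ Q2" and "b = (\<beta> ^ Q2 * z ^ E2) ^ Q1 / (z ^ D2) ^ Q1"
  have a: "a \<in> V" "a \<notin> M" and b: "b \<in> V" "b \<notin> M"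
    unfolding a_def b_def using power_quotient_unit 1 2 by blast+
  have "z ^ (D2 * Q1 + E1 * Q2) / z ^ (D1 * Q2 + E2 * Q1) = a * inverse b"
    using z0 \<beta> unfolding a_def b_def
    by (simp add: power_mult_distrib power_mult[symmetric] power_add field_simps)
  moreover have "a * inverse b \<in> V" using a not_M_imp_inverse_V[OF b(2)] by (intro V_intros)
  moreover have "a * inverse b \<notin> M"
    using a inverse_not_M[OF b(1) not_M_imp_nonzero[OF b(2)]] by (intro not_M_mult)
  ultimately show "z ^ (D2 * Q1 + E1 * Q2) / z ^ (D1 * Q2 + E2 * Q1) \<in> V"
    "z ^ (D2 * Q1 + E1 * Q2) / z ^ (D1 * Q2 + E2 * Q1) \<notin> M" by simp_all
qed

end

text \<open>Apart from finitely many, every common point comes after \<open>z\<close> in both orbits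
  and is therefore reached from \<open>z\<close> by both maps.\<close>

lemma infinite_coincidences:
  assumes inf: "infinite (orbit f x \<inter> orbit g y)" and z: "z \<in> orbit f x \<inter> orbit g y"
  shows "infinite {(m, n). m > 0 \<and> n > 0 \<and> (poly f ^^ m) z = (poly g ^^ n) z}" (is "infinite ?I")
proof
  assume fin: "finite ?I"
  obtain m0 n0 where z0: "z = (poly f ^^ m0) x" "z = (poly g ^^ n0) y" using z unfolding orbit_def by blast
  have "orbit f x \<inter> orbit g y \<subseteq> (\<lambda>i. (poly f ^^ i) x) ` {..m0} \<union> (\<lambda>i. (poly g ^^ i) y) ` {..n0}
      \<union> (\<lambda>(m, n). (poly f ^^ m) z) ` ?I"
  proof
    fix w assume "w \<in> orbit f x \<inter> orbit g y"
    then obtain m n where w: "w = (poly f ^^ m) x" "w = (poly g ^^ n) y" unfolding orbit_def by blast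
    show "w \<in> (\<lambda>i. (poly f ^^ i) x) ` {..m0} \<union> (\<lambda>i. (poly g ^^ i) y) ` {..n0}
      \<union> (\<lambda>(m, n). (poly f ^^ m) z) ` ?I"
    proof (cases "m \<le> m0 \<or> n \<le> n0")
      case True
      then consider "m \<in> {..m0}" | "n \<in> {..n0}" by auto
      then show ?thesis
      proof cases
        case 1
        then show ?thesis unfolding w(1) by (intro UnI1 imageI)
      next
        case 2
        then show ?thesis unfolding w(2) by (intro UnI1 UnI2 imageI)
      qed
    next
      case False
      then obtain i j where ij: "m = i + m0" "n = j + n0" "i > 0" "j > 0"
        by (metis add.commute less_imp_add_positive not_le)
      have "w = (poly f ^^ i) z" "w = (poly g ^^ j) z"
        using w z0 ij by (auto simp: funpow_add)
      then have "(i, j) \<in> ?I" "w = (\<lambda>(m, n). (poly f ^^ m) z) (i, j)" using ij by auto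
      then show ?thesis by blast
    qed
  qed
  then show False using inf fin finite_subset by blast
qed

text \<open>Division with remainder by the least exponent: the remainder \<open>r\<close> would
  again make \<open>d ^ r\<close> a power of \<open>e\<close>.\<close>

lemma common_power_multiples:
  fixes d e :: nat
  assumes de: "d > 1" "e > 1" and mn: "d ^ m = e ^ n" and a: "a > 0" "d ^ a = e ^ b"
    and least: "\<And>a' b'. a' > 0 \<Longrightarrow> d ^ a' = e ^ b' \<Longrightarrow> a \<le> a'"
  shows "\<exists>l. m = a * l \<and> n = b * l"
proof -
  define l r where "l = m div a" and "r = m mod a"
  have m: "m = a * l + r" and ra: "r < a" using a by (simp_all add: l_def r_def)
  have eq: "e ^ n = e ^ (b * l) * d ^ r"
    unfolding mn[symmetric] m power_add power_mult a(2) ..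
  have "b * l \<le> n"
  proof (rule ccontr)
    assume "\<not> b * l \<le> n"
    then have "e ^ n < e ^ (b * l)" using de by (intro power_strict_increasing) auto
    also have "\<dots> \<le> e ^ (b * l) * d ^ r" using de by simp
    finally show False using eq by simp
  qed
  then have "e ^ n = e ^ (b * l) * e ^ (n - b * l)" by (simp add: power_add[symmetric])
  then have "d ^ r = e ^ (n - b * l)" using eq de by simp
  then have "r = 0" using least[of r] ra by (metis gr0I not_le)
  then have "e ^ n = e ^ (b * l)" using eq by simp
  then show ?thesis using \<open>r = 0\<close> m de by (metis add.right_neutral power_inject_exp)
qed

theorem (in valued) common_iterate_of_large_coincidences:
  assumes f: "f \<in> polys_over L" "lead_coeff f = 1" "degree f \<ge> 2"
    and g: "g \<in> polys_over L" "degree g \<ge> 2"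
    and inf: "infinite (orbit f x \<inter> orbit g y)"
    and far: "\<And>C. C \<in> L \<Longrightarrow> \<exists>z\<in>orbit f x \<inter> orbit g y. large C z"
  shows "\<exists>a b. a > 0 \<and> b > 0 \<and> poly_iter f a = poly_iter g b"
proof -
  define d e where "d = degree f" and "e = degree g"
  define \<beta> where "\<beta> = lead_coeff g"
  have \<beta>0: "\<beta> \<noteq> 0" using g by (auto simp: \<beta>_def)
  have de: "d > 1" "e > 1" using f g by (auto simp: d_def e_def)
  obtain Cf where Cf: "Cf \<in> L" "Cf \<noteq> 0" 
    "\<And>z n. large Cf z \<Longrightarrow> (poly f ^^ n) z / (1 ^ geo d n * z ^ (d ^ n)) \<in> near1 (Cf / z)"
    using iterate_asymptotics[OF f(1,2) one_neq_zero d_def[symmetric]] f(3) by (metis d_def)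
  obtain Cg where Cg: "Cg \<in> L" "Cg \<noteq> 0"
    "\<And>z n. large Cg z \<Longrightarrow> (poly g ^^ n) z / (\<beta> ^ geo e n * z ^ (e ^ n)) \<in> near1 (Cg / z)"
    using iterate_asymptotics[OF g(1) \<beta>_def[symmetric] \<beta>0 e_def[symmetric]] g(2) by (metis e_def)
  obtain C0 where C0: "C0 \<in> L" "C0 \<noteq> 0" "\<And>x. x \<in> {Cf, Cg} \<Longrightarrow> x / C0 \<in> V"
    using exists_bound[of "{Cf, Cg}"] Cf(1) Cg(1) by (metis empty_subsetI finite.emptyI finite.insertI insert_subset)
  define I where "I z = {(m, n). m > 0 \<and> n > 0 \<and> (poly f ^^ m) z = (poly g ^^ n) z}" for z
  have I_inf: "infinite (I z)" if "z \<in> orbit f x \<inter> orbit g y" for z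
    unfolding I_def using infinite_coincidences[OF inf that] .
  have powers: "d ^ m1 = e ^ n1"
    if z: "z \<in> orbit f x \<inter> orbit g y" "large C0 z" and mn: "(m1, n1) \<in> I z" for z m1 n1
  proof -
    have lf: "large Cf z" and lg: "large Cg z" using large_mono[OF z(2) _ C0(2)] C0(3) by auto
    have zV: "z \<notin> V" and z0: "z \<noteq> 0" using lf large_nonzero by (auto simp: large_def)
    have unit: "\<beta> ^ geo e n * z ^ (e ^ n) / z ^ (d ^ m) \<in> V" "\<beta> ^ geo e n * z ^ (e ^ n) / z ^ (d ^ m) \<notin> M"
      if "(m, n) \<in> I z" for m n
    proof -
      define a b where "a = (poly f ^^ m) z / z ^ (d ^ m)" and "b = (poly g ^^ n) z / (\<beta> ^ geo e n * z ^ (e ^ n))"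
      have "Cf / z \<in> M" "Cf / z \<noteq> 0" "Cg / z \<in> M" "Cg / z \<noteq> 0"
        using lf lg z0 Cf(2) Cg(2) by (auto simp: large_def)
      then have a: "a \<in> V" "a \<notin> M" and b: "b \<in> V" "b \<notin> M"
        using near1_unit[OF Cf(3)[OF lf, of m]] near1_unit[OF Cg(3)[OF lg, of n]] by (auto simp: a_def b_def)
      have "(poly f ^^ m) z = (poly g ^^ n) z" using that by (simp add: I_def)
      moreover have "(poly f ^^ m) z \<noteq> 0" using a(2) M_0 by (auto simp: a_def)
      ultimately have "\<beta> ^ geo e n * z ^ (e ^ n) / z ^ (d ^ m) = a * inverse b"
        using z0 \<beta>0 by (simp add: a_def b_def field_simps)
      moreover have "a * inverse b \<in> V" using a not_M_imp_inverse_V[OF b(2)] by (intro V_intros)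
      moreover have "a * inverse b \<notin> M"
        using a inverse_not_M[OF b(1) not_M_imp_nonzero[OF b(2)]] by (intro not_M_mult)
      ultimately show "\<beta> ^ geo e n * z ^ (e ^ n) / z ^ (d ^ m) \<in> V"
        "\<beta> ^ geo e n * z ^ (e ^ n) / z ^ (d ^ m) \<notin> M" by simp_all
    qed
    have pos: "m1 > 0" "n1 > 0" using mn by (auto simp: I_def)
    \<comment> \<open>With the coincidence \<open>(m1, n1)\<close> fixed and \<open>(m, n)\<close>
      varying, eliminating the size of the leading coefficient gives this Pillai equation. Its
      constant term vanishes exactly when \<open>d ^ m1 = e ^ n1\<close>.\<close>
    let ?P = "{(m, n). int (e ^ n1 - 1) * int d ^ m = int (d ^ m1 - 1) * int e ^ n + (int e ^ n1 - int d ^ m1)}"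
    have "I z \<subseteq> ?P"
    proof
      fix p assume "p \<in> I z"
      then obtain m n where p: "p = (m, n)" "(m, n) \<in> I z" by (cases p) auto
      have "d ^ m * geo e n1 + e ^ n1 * geo e n = d ^ m1 * geo e n + e ^ n * geo e n1"
        using leading_power_relation[OF zV \<beta>0 unit[OF mn] unit[OF p(2)]] .
      then have "(int e - 1) * int (d ^ m * geo e n1 + e ^ n1 * geo e n)
          = (int e - 1) * int (d ^ m1 * geo e n + e ^ n * geo e n1)" by simp
      then have "int d ^ m * ((int e - 1) * int (geo e n1)) + int e ^ n1 * ((int e - 1) * int (geo e n))
          = int d ^ m1 * ((int e - 1) * int (geo e n)) + int e ^ n * ((int e - 1) * int (geo e n1))"
        by (simp add: algebra_simps)
      then have main: "int d ^ m * (int e ^ n1 - 1) + int e ^ n1 * (int e ^ n - 1)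
          = int d ^ m1 * (int e ^ n - 1) + int e ^ n * (int e ^ n1 - 1)"
        unfolding geo_eq .
      have sub: "int (e ^ n1 - 1) = int e ^ n1 - 1" "int (d ^ m1 - 1) = int d ^ m1 - 1"
        using de by (simp_all add: of_nat_diff)
      show "p \<in> ?P" unfolding p mem_Collect_eq prod.case sub using main by (simp add: algebra_simps)
    qed
    then have "infinite ?P" using I_inf[OF z(1)] finite_subset by blast
    moreover have "e ^ n1 - 1 > 0" "d ^ m1 - 1 > 0"
      using one_less_power[OF de(2) pos(2)] one_less_power[OF de(1) pos(1)] by simp_all
    ultimately have "int e ^ n1 - int d ^ m1 = 0"
      using finite_pillai[of "e ^ n1 - 1" "d ^ m1 - 1" "int e ^ n1 - int d ^ m1" d e] de by blast
    then have "int (d ^ m1) = int (e ^ n1)" by simp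
    then show ?thesis by (simp only: of_nat_eq_iff)
  qed
  \<comment> \<open>The least exponent with a common power gives iterates of equal degree, and every
    coincidence from a large point uses the same multiple of both exponents.\<close>
  define A where "A a \<longleftrightarrow> a > 0 \<and> (\<exists>b. d ^ a = e ^ b)" for a
  obtain z1 where z1: "z1 \<in> orbit f x \<inter> orbit g y" "large C0 z1" using far[OF C0(1)] by blast
  obtain m1 n1 where mn1: "(m1, n1) \<in> I z1" using infinite_imp_nonempty[OF I_inf[OF z1(1)]] by (metis ex_in_conv surj_pair)
  have "A m1" using powers[OF z1 mn1] mn1 by (auto simp: A_def I_def)
  then have "A (LEAST a. A a)" by (rule LeastI)
  moreover define a where "a = (LEAST a. A a)"
  ultimately obtain b where ab: "a > 0" "d ^ a = e ^ b" by (auto simp: A_def)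
  have least: "a \<le> a'" if "a' > 0" "d ^ a' = e ^ b'" for a' b'
    unfolding a_def using that by (intro Least_le) (auto simp: A_def)
  have b: "b > 0"
  proof (rule ccontr)
    assume "\<not> b > 0"
    then have "d ^ a = 1" using ab by simp
    then show False using ab(1) de(1) by simp
  qed
  define F G where "F = poly_iter f a" and "G = poly_iter g b"
  define s where "s = d ^ a"
  have s: "s \<ge> 2" unfolding s_def using de(1) ab(1) by (metis One_nat_def Suc_1 Suc_leI one_less_power)
  have "lead_coeff F = 1" unfolding F_def using f(2,3) by (subst lead_coeff_poly_iter) auto
  then have FG: "F \<in> polys_over L" "G \<in> polys_over L" "degree F = s" "degree G = s" "lead_coeff F = 1"
    using f(1) g(1) ab by (simp_all add: F_def G_def s_def poly_iter_over subring_L degree_poly_iter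
        d_def[symmetric] e_def[symmetric])
  define \<gamma> where "\<gamma> = lead_coeff G"
  have "G \<noteq> 0" using FG(4) s by auto
  then have \<gamma>: "\<gamma> \<noteq> 0" "\<gamma> \<in> L" using FG(2) by (simp_all add: \<gamma>_def polys_over_def)
  define Lam where "Lam z = {l. l > 0 \<and> (poly F ^^ l) z = (poly G ^^ l) z}" for z
  have Lam: "infinite (Lam z)" if z: "z \<in> orbit f x \<inter> orbit g y" "large C0 z" for z
  proof
    assume fin: "finite (Lam z)"
    have "I z \<subseteq> (\<lambda>l. (a * l, b * l)) ` Lam z"
    proof
      fix p assume "p \<in> I z"
      then obtain m n where p: "p = (m, n)" "(m, n) \<in> I z" by (cases p) auto
      obtain l where l: "m = a * l" "n = b * l"
        using common_power_multiples[OF de powers[OF z p(2)] ab] least by blast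
      have "l \<in> Lam z" using p(2) l by (auto simp: Lam_def I_def F_def G_def iterate_iterate)
      then show "p \<in> (\<lambda>l. (a * l, b * l)) ` Lam z" using p l by blast
    qed
    then show False using I_inf[OF z(1)] fin finite_subset by blast
  qed
  obtain CF where CF: "CF \<in> L" "CF \<noteq> 0"
    "\<And>z n. large CF z \<Longrightarrow> (poly F ^^ n) z / (1 ^ geo s n * z ^ (s ^ n)) \<in> near1 (CF / z)"
    "\<And>z n D. large CF z \<Longrightarrow> large D z \<Longrightarrow> large D ((poly F ^^ n) z)"
    using iterate_asymptotics[OF FG(1,5) one_neq_zero FG(3) s] by metis
  obtain CG where CG: "CG \<in> L" "CG \<noteq> 0"
    "\<And>z n. large CG z \<Longrightarrow> (poly G ^^ n) z / (\<gamma> ^ geo s n * z ^ (s ^ n)) \<in> near1 (CG / z)"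
    using iterate_asymptotics[OF FG(2) \<gamma>_def[symmetric] \<gamma>(1) FG(4) s] by metis
  obtain C1 where C1: "C1 \<in> L" "C1 \<noteq> 0" "\<And>x. x \<in> {C0, CF, CG} \<Longrightarrow> x / C1 \<in> V"
    using exists_bound[of "{C0, CF, CG}"] C0(1) CF(1) CG(1)
    by (metis empty_subsetI finite.emptyI finite.insertI insert_subset)
  have C1l: "large C0 z" "large CF z" "large CG z" if "large C1 z" for z
    using large_mono[OF that _ C1(2)] C1(3) by auto
  \<comment> \<open>At a coincidence both asymptotic expansions describe the same point with the
    same power of \<open>z\<close>, so the leading coefficients agree up to the error C1 /
    z.\<close>
  have root: "\<gamma> ^ geo s l \<in> near1 (C1 / z)" if z: "large C1 z" and l: "l \<in> Lam z" for z l
  proof -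
    have z0: "z \<noteq> 0" using large_nonzero z .
    have M: "C1 / z \<in> M" "C1 / z \<noteq> 0" using z z0 C1(2) by (auto simp: large_def)
    define p q where "p = (poly F ^^ l) z / z ^ (s ^ l)" and "q = (poly G ^^ l) z / (\<gamma> ^ geo s l * z ^ (s ^ l))"
    have p: "p \<in> near1 (C1 / z)"
      by (rule near1_mono[of _ "CF / z"]) (use CF(3)[OF C1l(2)[OF z], of l] C1(3)[of CF] CF(2) z0 in \<open>auto simp: p_def\<close>)
    have q: "q \<in> near1 (C1 / z)"
      by (rule near1_mono[of _ "CG / z"]) (use CG(3)[OF C1l(3)[OF z], of l] C1(3)[of CG] CG(2) z0 in \<open>auto simp: q_def\<close>)
    have "p \<noteq> 0" using near1_unit[OF p M] M_0 by auto
    then have "(poly F ^^ l) z \<noteq> 0" by (auto simp: p_def)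
    then have "\<gamma> ^ geo s l = p * inverse q"
      using l z0 \<gamma>(1) by (simp add: Lam_def p_def q_def field_simps)
    then show ?thesis using near1_mult[OF p near1_inverse[OF q M] M] by simp
  qed
  obtain z2 where z2: "z2 \<in> orbit f x \<inter> orbit g y" "large C1 z2" using far[OF C1(1)] by blast
  obtain h where h: "h \<in> Lam z2" using infinite_imp_nonempty[OF Lam[OF z2(1) C1l(1)[OF z2(2)]]] by blast
  have h0: "h > 0" using h by (simp add: Lam_def)
  have \<gamma>h: "\<gamma> ^ geo s h = 1"
  proof (rule ccontr)
    assume ne: "\<gamma> ^ geo s h \<noteq> 1"
    \<comment> \<open>A base point \<open>z3\<close> is chosen so far out that C1 / z3 is smaller
      than \<open>\<epsilon>\<close>. The power \<open>(\<gamma> ^ geo s h) ^ geo s h'\<close> would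
      differ from 1 by exactly the size of \<open>\<epsilon>\<close>, yet by at most C1 /
      z3.\<close>
    define \<epsilon> where "\<epsilon> = \<gamma> ^ geo s h - 1"
    have \<epsilon>0: "\<epsilon> \<noteq> 0" using ne by (simp add: \<epsilon>_def)
    have "\<epsilon> \<in> L" unfolding \<epsilon>_def using \<gamma>(2)
      by (intro subring_diff[OF subring_L] subring_power[OF subring_L] subring_1[OF subring_L])
    then have "C1 / \<epsilon> \<in> L" using C1(1) by (rule L_divide[rotated])
    then obtain B where B: "B \<in> L" "B \<noteq> 0" "\<And>x. x \<in> {C1, C1 / \<epsilon>} \<Longrightarrow> x / B \<in> V"
      using exists_bound[of "{C1, C1 / \<epsilon>}"] C1(1)
      by (metis empty_subsetI finite.emptyI finite.insertI insert_subset)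
    obtain z3 where z3: "z3 \<in> orbit f x \<inter> orbit g y" "large B z3" using far[OF B(1)] by blast
    have l3: "large C1 z3" "large (C1 / \<epsilon>) z3" using large_mono[OF z3(2) _ B(2)] B(3) by auto
    have z30: "z3 \<noteq> 0" "z2 \<noteq> 0" using large_nonzero l3 z2 by auto
    obtain h' where h': "h' \<in> Lam z3" using infinite_imp_nonempty[OF Lam[OF z3(1) C1l(1)[OF l3(1)]]] by blast
    let ?k = "geo s h" and ?k' = "geo s h'"
    have M2: "C1 / z2 \<in> M" "C1 / z2 \<noteq> 0" and M3: "C1 / z3 \<in> M" "C1 / z3 \<noteq> 0"
      using z2 l3 z30 C1(2) by (auto simp: large_def)
    have "\<gamma> ^ ?k - 1 \<in> M" using near1_diff[OF root[OF z2(2) h] M2] .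
    moreover have "?k' > 0" using h' by (intro geo_pos) (simp add: Lam_def)
    ultimately have S: "(\<Sum>i<?k'. (\<gamma> ^ ?k) ^ i) \<notin> M" by (intro power_diff_unit)
    have "(\<gamma> ^ ?k') ^ ?k \<in> near1 (C1 / z3)" using near1_power[OF root[OF l3(1) h'] M3] .
    moreover have "(\<gamma> ^ ?k') ^ ?k = (\<gamma> ^ ?k) ^ ?k'" by (simp add: power_mult[symmetric] mult.commute)
    ultimately have "((\<gamma> ^ ?k) ^ ?k' - 1) / (C1 / z3) \<in> V" by (simp add: near1_def)
    then have "\<epsilon> * (\<Sum>i<?k'. (\<gamma> ^ ?k) ^ i) / (C1 / z3) \<in> V" unfolding power_diff_1_eq \<epsilon>_def .
    moreover have "C1 / \<epsilon> / z3 \<in> M" using l3(2) by (simp add: large_def)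
    ultimately have "\<epsilon> * (\<Sum>i<?k'. (\<gamma> ^ ?k) ^ i) / (C1 / z3) * (C1 / \<epsilon> / z3) \<in> M" by (rule M_mult)
    then show False using S \<epsilon>0 z30 C1(2) by simp
  qed
  define F' G' where "F' = poly_iter F h" and "G' = poly_iter G h"
  have FG': "F' \<in> polys_over L" "G' \<in> polys_over L" "degree F' = s ^ h" "degree G' = s ^ h"
    "coeff F' (s ^ h) = 1" "coeff G' (s ^ h) = 1"
  proof -
    show "F' \<in> polys_over L" "G' \<in> polys_over L" using FG by (auto simp: F'_def G'_def poly_iter_over subring_L)
    show dF: "degree F' = s ^ h" and dG: "degree G' = s ^ h" using FG by (auto simp: F'_def G'_def degree_poly_iter)
    have "lead_coeff F' = 1" unfolding F'_def using FG s by (subst lead_coeff_poly_iter) auto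
    then show "coeff F' (s ^ h) = 1" by (simp add: dF)
    have "lead_coeff G' = \<gamma> ^ geo s h" unfolding G'_def using FG s by (subst lead_coeff_poly_iter) (auto simp: \<gamma>_def)
    then show "coeff G' (s ^ h) = 1" using \<gamma>h by (simp add: dG)
  qed
  have "s ^ h \<ge> 2" using s h0 by (metis order_trans self_le_power One_nat_def Suc_1 Suc_leD)
  then obtain C2 where C2: "C2 \<in> L" "C2 \<noteq> 0"
    "\<And>w j. large C2 w \<Longrightarrow> j > 0 \<Longrightarrow> (poly F' ^^ j) w = (poly G' ^^ j) w \<Longrightarrow> F' = G'"
    using monic_eq_of_large_coincidence[OF FG'(1,5,3) FG'(2,6,4)] by blast
  obtain C3 where C3: "C3 \<in> L" "C3 \<noteq> 0" "\<And>x. x \<in> {C1, C2} \<Longrightarrow> x / C3 \<in> V"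
    using exists_bound[of "{C1, C2}"] C1(1) C2(1)
    by (metis empty_subsetI finite.emptyI finite.insertI insert_subset)
  obtain z4 where z4: "z4 \<in> orbit f x \<inter> orbit g y" "large C3 z4" using far[OF C3(1)] by blast
  have l4: "large C1 z4" "large C2 z4" using large_mono[OF z4(2) _ C3(2)] C3(3) by auto
  \<comment> \<open>\<open>F'\<close> and \<open>G'\<close> are h-th iterates, so their coincidences
    need multiples of \<open>h\<close>. Two coincidences of \<open>F\<close> and \<open>G\<close>
    with indices congruent mod \<open>h\<close> give them: the earlier one supplies the common
    starting point \<open>w\<close>.\<close>
  have "finite ((\<lambda>l. l mod h) ` Lam z4)"
    by (rule finite_subset[of _ "{..<h}"]) (use h0 in auto)
  then obtain l0 where "infinite {l \<in> Lam z4. l mod h = l0 mod h}"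
    using pigeonhole_infinite[OF Lam[OF z4(1) C1l(1)[OF l4(1)]]] by blast
  then obtain l where l: "l \<in> Lam z4" "l mod h = l0 mod h" and inf': "infinite {l \<in> Lam z4. l mod h = l0 mod h}"
    using infinite_imp_nonempty by blast
  obtain l' where l': "l' > l" "l' \<in> Lam z4" "l' mod h = l0 mod h"
    using inf' unfolding infinite_nat_iff_unbounded by blast
  have "h dvd l' - l" using l l' by (metis less_imp_le_nat mod_eq_dvd_iff_nat)
  then obtain j where j: "l' = h * j + l" using l'(1) by (metis dvdE le_add_diff_inverse2 less_imp_le_nat)
  have j0: "j > 0" using j l'(1) by (cases j) auto
  define w where "w = (poly F ^^ l) z4"
  have w: "large C2 w" unfolding w_def using CF(4) C1l(2)[OF l4(1)] l4(2) by blast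
  have "(poly F' ^^ j) w = (poly F ^^ l') z4" by (simp add: w_def F'_def iterate_iterate j funpow_add)
  also have "\<dots> = (poly G ^^ l') z4" using l'(2) by (simp add: Lam_def)
  also have "\<dots> = (poly G' ^^ j) w" using l(1) by (simp add: w_def G'_def iterate_iterate j funpow_add Lam_def)
  finally have "F' = G'" using C2(3)[OF w j0] by blast
  have "poly (poly_iter f (a * h)) = poly (poly_iter g (b * h))"
    using arg_cong[OF \<open>F' = G'\<close>, of poly] unfolding F'_def G'_def
    by (simp only: poly_poly_iter) (simp only: F_def G_def iterate_iterate)
  then have "poly_iter f (a * h) = poly_iter g (b * h)" by (simp only: poly_eq_poly_eq_iff)
  then show ?thesis using ab b h0 by (intro exI[of _ "a * h"] exI[of _ "b * h"]) auto
qed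

section \<open>Non-isotrivial pairs\<close>

text \<open>For nonzero \<open>\<alpha>\<close> this is conjugation by
  \<open>[:\<tau>, \<alpha>:]\<close>; the outer factor is literally
  \<open>lin_inv [:\<tau>, \<alpha>:]\<close>.\<close>

definition affine_conj :: "'a::field \<Rightarrow> 'a \<Rightarrow> 'a poly \<Rightarrow> 'a poly" where
  "affine_conj \<alpha> \<tau> p = pcompose [: - \<tau> / \<alpha>, 1 / \<alpha> :] (pcompose p [:\<tau>, \<alpha>:])"

lemma poly_affine_conj: "poly (affine_conj \<alpha> \<tau> p) ((x - \<tau>) / \<alpha>) = (poly p x - \<tau>) / \<alpha>" if "\<alpha> \<noteq> 0"
proof -
  have e: "poly [:\<tau>, \<alpha>:] ((x - \<tau>) / \<alpha>) = x" using that by simp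
  show ?thesis unfolding affine_conj_def poly_pcompose e by (simp add: diff_divide_distrib)
qed

lemma funpow_affine_conj:
  assumes "\<alpha> \<noteq> 0"
  shows "(poly (affine_conj \<alpha> \<tau> p) ^^ n) ((x - \<tau>) / \<alpha>) = ((poly p ^^ n) x - \<tau>) / \<alpha>"
  by (induction n) (auto simp: poly_affine_conj[OF assms])

lemma orbit_affine_conj:
  assumes "\<alpha> \<noteq> 0"
  shows "orbit (affine_conj \<alpha> \<tau> p) ((x - \<tau>) / \<alpha>) = (\<lambda>z. (z - \<tau>) / \<alpha>) ` orbit p x"
  unfolding orbit_def funpow_affine_conj[OF assms] by auto

lemma poly_iter_affine_conj_eq:
  fixes p q :: "'a::field_char_0 poly"
  assumes \<alpha>: "\<alpha> \<noteq> 0" and eq: "poly_iter (affine_conj \<alpha> \<tau> p) a = poly_iter (affine_conj \<alpha> \<tau> q) b"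
  shows "poly_iter p a = poly_iter q b"
proof -
  have "(poly p ^^ a) x = (poly q ^^ b) x" for x
  proof -
    have "(poly (affine_conj \<alpha> \<tau> p) ^^ a) ((x - \<tau>) / \<alpha>) = (poly (affine_conj \<alpha> \<tau> q) ^^ b) ((x - \<tau>) / \<alpha>)"
      using eq by (metis poly_poly_iter)
    then show ?thesis using \<alpha> by (simp add: funpow_affine_conj)
  qed
  then have "poly (poly_iter p a) = poly (poly_iter q b)" by (simp add: poly_poly_iter fun_eq_iff)
  then show ?thesis by (simp only: poly_eq_poly_eq_iff)
qed

lemma affine_conj_over:
  assumes K: "is_subfield K" and "p \<in> polys_over K" "\<alpha> \<in> K" "\<tau> \<in> K"
  shows "affine_conj \<alpha> \<tau> p \<in> polys_over K"
proof -
  note R = is_subring_subfield[OF K]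
  have i: "inverse \<alpha> \<in> K" using K assms(3) by (simp add: is_subfield_def)
  show ?thesis unfolding affine_conj_def divide_inverse
    using assms i by (intro polys_over_pcompose[OF R] polys_over_pCons[OF R] polys_over_const[OF R]
        subring_mult[OF R] subring_uminus[OF R] subring_1[OF R])
qed

lemma coeff_pcompose_linear:
  "coeff (pcompose p [:\<tau>, \<alpha>:]) i = (\<Sum>j\<le>degree p. coeff p j * (of_nat (j choose i) * \<alpha> ^ i * \<tau> ^ (j - i)))"
  for p :: "'a::comm_ring_1 poly"
proof -
  have "pcompose p [:\<tau>, \<alpha>:] = (\<Sum>j\<le>degree p. smult (coeff p j) ([:\<tau>, \<alpha>:] ^ j))"
  proof -
    have "pcompose ([:0, 1:] ^ n) [:\<tau>, \<alpha>:] = [:\<tau>, \<alpha>:] ^ n" for n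
      by (induction n) (simp_all only: power_0 power_Suc pcompose_1 pcompose_mult, simp add: pcompose_pCons)
    then have "pcompose (\<Sum>j\<le>degree p. monom (coeff p j) j) [:\<tau>, \<alpha>:] = (\<Sum>j\<le>degree p. smult (coeff p j) ([:\<tau>, \<alpha>:] ^ j))"
      by (simp only: pcompose_sum monom_altdef pcompose_smult)
    then show ?thesis by (simp only: poly_as_sum_of_monoms)
  qed
  moreover have "coeff ([:\<tau>, \<alpha>:] ^ j) i = of_nat (j choose i) * \<alpha> ^ i * \<tau> ^ (j - i)" for j
  proof (cases "i \<le> j")
    case False
    have "degree ([:\<tau>, \<alpha>:] ^ j) \<le> 1 * j"
      by (rule order_trans[OF degree_power_le]) (intro mult_right_mono, auto)
    then show ?thesis using False by (simp add: coeff_eq_0 binomial_eq_0)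
  qed (simp add: coeff_linear_poly_power)
  ultimately show ?thesis by (simp add: coeff_sum)
qed

text \<open>Conjugation multiplies the leading coefficient by
  \<open>\<alpha> ^ (degree f - 1)\<close>, and \<open>\<tau>\<close> is the mean of the roots of
  \<open>f\<close>. Both are algebraic over \<open>K\<close>. The final subtraction of
  \<open>\<tau>\<close> only touches the constant term, which degree at least 2 keeps apart from the
  coefficient to be killed.\<close>

lemma exists_centred_conj:
  fixes f :: "'a::{alg_closed_field, field_char_0} poly"
  assumes K: "is_subfield K" and f: "f \<in> polys_over K" and d: "degree f \<ge> 2"
  obtains \<alpha> \<tau> where "\<alpha> \<noteq> 0" "\<alpha> \<in> alg_closure_in K" "\<tau> \<in> alg_closure_in K"
    "degree (affine_conj \<alpha> \<tau> f) = degree f" "coeff (affine_conj \<alpha> \<tau> f) (degree f) = 1"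
    "coeff (affine_conj \<alpha> \<tau> f) (degree f - 1) = 0"
proof -
  note R = is_subring_subfield[OF K]
  define n where "n = degree f"
  define c where "c = lead_coeff f"
  have n: "n \<ge> 2" using d by (simp add: n_def)
  have c0: "c \<noteq> 0" using d by (auto simp: c_def)
  have cK: "inverse c \<in> K" using f K by (auto simp: polys_over_def c_def is_subfield_def)
  obtain \<alpha> where \<alpha>: "\<alpha> ^ (n - 1) = inverse c" using nth_root_exists[of "n - 1" "inverse c"] n by auto
  have \<alpha>0: "\<alpha> \<noteq> 0" using \<alpha> c0 n by (auto simp: power_0_left)
  define \<tau> where "\<tau> = - coeff f (n - 1) * inverse (of_nat n) * inverse c"
  have "inverse (of_nat n) \<in> K" using subring_of_nat[OF R] K by (auto simp: is_subfield_def)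
  then have "\<tau> \<in> K" unfolding \<tau>_def using f cK
    by (intro subring_mult[OF R] subring_uminus[OF R]) (auto simp: polys_over_def)
  then have \<tau>K: "\<tau> \<in> alg_closure_in K" using subset_alg_closure_in[OF K] by blast
  have \<alpha>K: "\<alpha> \<in> alg_closure_in K"
  proof -
    let ?p = "monom 1 (n - 1) - [:inverse c:]"
    have "?p \<in> polys_over K"
      using cK by (intro polys_over_diff[OF R] polys_over_monom[OF R] polys_over_const[OF R] subring_1[OF R])
    moreover have "coeff ?p (n - 1) = 1" using n by (simp add: coeff_eq_0)
    then have "?p \<noteq> 0" by (metis coeff_0 zero_neq_one)
    moreover have "poly ?p \<alpha> = 0" using \<alpha> by (simp add: poly_monom)
    ultimately show ?thesis unfolding alg_closure_in_def polys_over_def by blast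
  qed
  have co: "coeff (affine_conj \<alpha> \<tau> f) i = coeff (pcompose f [:\<tau>, \<alpha>:]) i / \<alpha>" if "i > 0" for i
    using that by (auto simp: affine_conj_def pcompose_pCons coeff_pCons split: nat.splits)
  have deg: "degree (affine_conj \<alpha> \<tau> f) = n"
    using \<alpha>0 by (simp add: affine_conj_def degree_pcompose n_def)
  have "coeff (pcompose f [:\<tau>, \<alpha>:]) n = c * \<alpha> ^ n"
  proof -
    have "coeff (pcompose f [:\<tau>, \<alpha>:]) n = (\<Sum>j\<le>n. if j = n then c * \<alpha> ^ n else 0)"
      unfolding coeff_pcompose_linear n_def[symmetric] by (intro sum.cong) (auto simp: c_def n_def)
    then show ?thesis by simp
  qed
  then have top: "coeff (affine_conj \<alpha> \<tau> f) n = 1"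
    using co[of n] n \<alpha> \<alpha>0 c0 by (simp add: power_eq_if)
  have "coeff (pcompose f [:\<tau>, \<alpha>:]) (n - 1) = 0"
  proof -
    obtain m where m: "n = Suc m" using n by (cases n) auto
    have "coeff (pcompose f [:\<tau>, \<alpha>:]) m = (\<Sum>j\<le>Suc m. coeff f j * (of_nat (j choose m) * \<alpha> ^ m * \<tau> ^ (j - m)))"
      unfolding coeff_pcompose_linear using m by (simp add: n_def)
    also have "\<dots> = (\<Sum>j<m. coeff f j * (of_nat (j choose m) * \<alpha> ^ m * \<tau> ^ (j - m)))
        + (coeff f m * \<alpha> ^ m + c * (of_nat n * \<alpha> ^ m * \<tau>))"
      by (simp add: lessThan_Suc_atMost[symmetric] c_def n_def[symmetric] m)
    also have "(\<Sum>j<m. coeff f j * (of_nat (j choose m) * \<alpha> ^ m * \<tau> ^ (j - m))) = 0"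
      by (intro sum.neutral) auto
    also have "c * (of_nat n * \<alpha> ^ m * \<tau>) = - coeff f m * \<alpha> ^ m"
      using c0 n m by (simp add: \<tau>_def field_simps del: of_nat_Suc)
    finally show ?thesis using m by simp
  qed
  then have "coeff (affine_conj \<alpha> \<tau> f) (n - 1) = 0" using co[of "n - 1"] n by simp
  with that[OF \<alpha>0 \<alpha>K \<tau>K] deg top show ?thesis by (simp add: n_def)
qed

lemma orbit_subset:
  assumes "is_subring A" "f \<in> polys_over A" "x \<in> A" shows "orbit f x \<subseteq> A"
proof -
  have "(poly f ^^ n) x \<in> A" for n by (induction n) (use assms poly_in_subring in auto)
  then show ?thesis by (auto simp: orbit_def)
qed

lemma (in valued) bounded_at_affine_conj:
  assumes b: "bounded_at k V g y" and \<alpha>: "\<alpha> \<noteq> 0" "\<alpha> \<in> L" and \<tau>: "\<tau> \<in> L"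
  shows "bounded_at k V (affine_conj \<alpha> \<tau> g) ((y - \<tau>) / \<alpha>)"
proof -
  obtain C where C: "C \<in> L" "C \<noteq> 0" "\<And>n. (poly g ^^ n) y / C \<in> V" using b by (auto simp: bounded_at_def)
  obtain B where B: "B \<in> L" "B \<noteq> 0" "\<And>x. x \<in> {C, \<tau>} \<Longrightarrow> x / B \<in> V"
    using exists_bound[of "{C, \<tau>}"] C(1) \<tau> by (metis empty_subsetI finite.emptyI finite.insertI insert_subset)
  have "(poly (affine_conj \<alpha> \<tau> g) ^^ n) ((y - \<tau>) / \<alpha>) / (B / \<alpha>) \<in> V" for n
  proof -
    have "((poly g ^^ n) y / C) * (C / B) - \<tau> / B \<in> V" using C(3) B(3) by (intro V_intros) auto
    moreover have "(u - \<tau>) / \<alpha> / (B / \<alpha>) = u / C * (C / B) - \<tau> / B" for u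
        using \<alpha>(1) C(2) by (simp add: diff_divide_distrib[symmetric])
    ultimately show ?thesis unfolding funpow_affine_conj[OF \<alpha>(1)] by (simp only:)
  qed
  moreover have "B / \<alpha> \<in> L" "B / \<alpha> \<noteq> 0" using B \<alpha> L_divide by auto
  ultimately show ?thesis unfolding bounded_at_def by blast
qed

text \<open>Non-isotriviality yields a place at which one of the two orbits is unbounded.\<close>
lemma all_bounded_imp_constant:
  fixes f g :: "'a::{alg_closed_field, field_char_0} poly"
  assumes k: "is_subfield k" "alg_closure_in k \<subseteq> k"
    and f: "f \<in> polys_over (dim_one_field k)" "coeff f (degree f) = 1" "degree f \<ge> 2" "coeff f (degree f - 1) = 0"
    and g: "g \<in> polys_over (dim_one_field k)" "degree g \<ge> 2"
    and xy: "x \<in> dim_one_field k" "y \<in> dim_one_field k"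
    and inf: "infinite (orbit f x \<inter> orbit g y)"
    and bd: "\<And>V. valued k V \<Longrightarrow> bounded_at k V f x \<and> bounded_at k V g y"
  shows "f \<in> polys_over k \<and> g \<in> polys_over k \<and> x \<in> k \<and> y \<in> k"
proof -
  note R = is_subring_subfield[OF k(1)]
  let ?L = "dim_one_field k"
  have Lf: "is_subfield ?L" using k(1) by (rule is_subfield_dim_one_field)
  have fk: "f \<in> polys_over k" "x \<in> k"
    using bounded_orbit_imp_constant[OF k f(2-4) _ xy(1)] f(1) inf bd by (auto simp: polys_over_def)
  obtain \<alpha> \<tau> where c: "\<alpha> \<noteq> 0" "\<alpha> \<in> alg_closure_in ?L" "\<tau> \<in> alg_closure_in ?L"
    "degree (affine_conj \<alpha> \<tau> g) = degree g" "coeff (affine_conj \<alpha> \<tau> g) (degree g) = 1"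
    "coeff (affine_conj \<alpha> \<tau> g) (degree g - 1) = 0"
    using exists_centred_conj[OF Lf g] by metis
  define h where "h = affine_conj \<alpha> \<tau> g"
  have \<alpha>L: "\<alpha> \<in> ?L" and \<tau>L: "\<tau> \<in> ?L" using c alg_closure_in_dim_one_field[OF k(1)] by auto
  have hL: "h \<in> polys_over ?L" unfolding h_def using Lf g(1) \<alpha>L \<tau>L by (rule affine_conj_over)
  have "(y - \<tau>) / \<alpha> \<in> ?L"
  proof -
    have "inverse \<alpha> \<in> ?L" using \<alpha>L Lf by (simp add: is_subfield_def)
    then show ?thesis unfolding divide_inverse
      using xy \<tau>L is_subring_subfield[OF Lf] by (intro subring_mult subring_diff)
  qed
  moreover have "infinite (orbit h ((y - \<tau>) / \<alpha>))"
  proof -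
    have "inj (\<lambda>z. (z - \<tau>) / \<alpha>)" using c(1) by (auto simp: inj_def)
    then show ?thesis unfolding h_def orbit_affine_conj[OF c(1)]
      using inf by (metis finite_Int finite_imageD inj_on_subset subset_UNIV)
  qed
  moreover have "bounded_at k V h ((y - \<tau>) / \<alpha>)" if "valued k V" for V
    unfolding h_def using valued.bounded_at_affine_conj[OF that _ c(1) \<alpha>L \<tau>L] bd[OF that] by blast
  ultimately have hk: "h \<in> polys_over k" "(y - \<tau>) / \<alpha> \<in> k"
    using bounded_orbit_imp_constant[OF k, of h "(y - \<tau>) / \<alpha>"] c(4-6) g(2) hL
    by (auto simp: polys_over_def h_def)
  \<comment> \<open>Now \<open>f\<close> and the conjugate \<open>h\<close> of \<open>g\<close> are
    defined over \<open>k\<close>, but the conjugating map might not be. Common orbit points are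
    constant both before and after it, and two of them determine \<open>\<alpha>\<close> and
    \<open>\<tau>\<close>, which are therefore constants.\<close>
  have Zk: "z \<in> k \<and> (z - \<tau>) / \<alpha> \<in> k" if "z \<in> orbit f x \<inter> orbit g y" for z
    using that orbit_subset[OF R fk] orbit_subset[OF R hk] orbit_affine_conj[OF c(1), of \<tau> g y]
    unfolding h_def by blast
  have "\<exists>z z'. z \<in> orbit f x \<inter> orbit g y \<and> z' \<in> orbit f x \<inter> orbit g y \<and> z \<noteq> z'"
  proof (rule ccontr)
    assume one: "\<not> ?thesis"
    obtain z where "z \<in> orbit f x \<inter> orbit g y" using inf by (metis ex_in_conv finite.emptyI)
    then have "orbit f x \<inter> orbit g y \<subseteq> {z}" using one by blast
    then show False using inf finite_subset by blast
  qed
  then obtain z z' where z: "z \<in> k" "(z - \<tau>) / \<alpha> \<in> k" "z' \<in> k" "(z' - \<tau>) / \<alpha> \<in> k" "z \<noteq> z'"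
    using Zk by metis
  have inv: "inverse u \<in> k" if "u \<in> k" for u using that k(1) by (simp add: is_subfield_def)
  have "(z - z') * inverse ((z - \<tau>) / \<alpha> - (z' - \<tau>) / \<alpha>) \<in> k"
    using z by (intro subring_mult[OF R] subring_diff[OF R] inv)
  moreover have "(z - z') * inverse ((z - \<tau>) / \<alpha> - (z' - \<tau>) / \<alpha>) = \<alpha>"
    using z(5) c(1) by (simp add: diff_divide_distrib[symmetric])
  ultimately have \<alpha>k: "\<alpha> \<in> k" by simp
  have "z - \<alpha> * ((z - \<tau>) / \<alpha>) \<in> k" using z \<alpha>k by (intro subring_mult[OF R] subring_diff[OF R])
  then have \<tau>k: "\<tau> \<in> k" using c(1) by simp
  have "g = pcompose [:\<tau>, \<alpha>:] (pcompose h [: - \<tau> * inverse \<alpha>, inverse \<alpha>:])"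
  proof -
    have "poly g u = poly (pcompose [:\<tau>, \<alpha>:] (pcompose h [: - \<tau> * inverse \<alpha>, inverse \<alpha>:])) u" for u
    proof -
      have "poly h ((u - \<tau>) / \<alpha>) = (poly g u - \<tau>) / \<alpha>" unfolding h_def by (rule poly_affine_conj[OF c(1)])
      moreover have "- \<tau> * inverse \<alpha> + u * inverse \<alpha> = (u - \<tau>) / \<alpha>"
        by (simp add: diff_divide_distrib divide_inverse left_diff_distrib)
      ultimately show ?thesis using c(1) by (simp add: poly_pcompose)
    qed
    then show ?thesis by (simp add: poly_eq_poly_eq_iff[symmetric] fun_eq_iff)
  qed
  also have "\<dots> \<in> polys_over k"
    using \<alpha>k \<tau>k hk(1) inv by (intro polys_over_pcompose[OF R] polys_over_pCons[OF R] polys_over_const[OF R]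
        subring_mult[OF R] subring_uminus[OF R])
  finally have gk: "g \<in> polys_over k" .
  have "\<alpha> * ((y - \<tau>) / \<alpha>) + \<tau> \<in> k" using \<alpha>k \<tau>k hk by (intro subring_mult[OF R] subring_add[OF R])
  then have "y \<in> k" using c(1) by simp
  then show ?thesis using fk gk by blast
qed

lemma finite_coeffs_subset_iff:
  assumes "is_subring A" shows "coeff p ` {..degree p} \<subseteq> A \<longleftrightarrow> p \<in> polys_over A"
proof
  assume h: "coeff p ` {..degree p} \<subseteq> A"
  have "coeff p i \<in> A" for i
    using h subring_0[OF assms] by (cases "i \<le> degree p") (auto simp: coeff_eq_0)
  then show "p \<in> polys_over A" by (simp add: polys_over_def)
qed (auto simp: polys_over_def)

text \<open>Only finitely many orbit points precede the index from which all points are large, so an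
  infinite part of the orbit contains a large one.\<close>

lemma (in valued) unbounded_imp_large_coincidence:
  assumes f: "f \<in> polys_over L" "degree f \<ge> 2" and u: "\<not> bounded_at k V f x"
    and inf: "infinite (orbit f x \<inter> S)" and C: "C \<in> L"
  shows "\<exists>z\<in>orbit f x \<inter> S. large C z"
proof -
  obtain n0 where n0: "\<And>n. n \<ge> n0 \<Longrightarrow> large C ((poly f ^^ n) x)"
    using unbounded_imp_eventually_large[OF f u C] by blast
  have "\<not> orbit f x \<inter> S \<subseteq> (\<lambda>n. (poly f ^^ n) x) ` {..<n0}"
    using inf finite_subset by blast
  then obtain z where z: "z \<in> orbit f x \<inter> S" "z \<notin> (\<lambda>n. (poly f ^^ n) x) ` {..<n0}" by blast
  obtain n where n: "z = (poly f ^^ n) x" using z(1) unfolding orbit_def by blast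
  have "n \<ge> n0" using z(2) n by (meson imageI lessThan_iff not_le)
  then show ?thesis using n0 n z(1) by blast
qed

theorem common_iterate_of_not_isotrivial:
  fixes f g :: "'a::{alg_closed_field, field_char_0} poly"
  assumes f: "coeff f (degree f) = 1" "degree f \<ge> 2" "coeff f (degree f - 1) = 0" and g: "degree g \<ge> 2"
    and inf: "infinite (orbit f x \<inter> orbit g y)"
    and ni: "\<not> (f \<in> polys_over Qbar \<and> g \<in> polys_over Qbar \<and> x \<in> Qbar \<and> y \<in> Qbar)"
  shows "\<exists>a b. a > 0 \<and> b > 0 \<and> poly_iter f a = poly_iter g b"
proof -
  define D where "D = coeff f ` {..degree f} \<union> coeff g ` {..degree g} \<union> {x, y}"
  have D: "D \<subseteq> A \<longleftrightarrow> f \<in> polys_over A \<and> g \<in> polys_over A \<and> x \<in> A \<and> y \<in> A" if "is_subring A" for A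
    using finite_coeffs_subset_iff[OF that] by (auto simp: D_def)
  have "\<not> D \<subseteq> Qbar" using ni D[OF is_subring_subfield[OF is_subfield_Qbar]] by blast
  moreover have "finite D" by (simp add: D_def)
  ultimately obtain k where k: "is_subfield k" "alg_closure_in k \<subseteq> k" "\<not> D \<subseteq> k"
    "\<And>t. t \<notin> k \<Longrightarrow> D \<subseteq> alg_closure_in (field_adjoin k t)"
    using exists_maximal_field_of_constants by metis
  have "D \<subseteq> dim_one_field k" using k(4) by (auto simp: dim_one_field_def)
  then have over: "f \<in> polys_over (dim_one_field k)" "g \<in> polys_over (dim_one_field k)"
    "x \<in> dim_one_field k" "y \<in> dim_one_field k"
    using D[OF is_subring_subfield[OF is_subfield_dim_one_field[OF k(1)]]] by auto
  have "\<exists>V. valued k V \<and> \<not> (bounded_at k V f x \<and> bounded_at k V g y)"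
  proof (rule ccontr)
    assume "\<not> ?thesis"
    then have "f \<in> polys_over k \<and> g \<in> polys_over k \<and> x \<in> k \<and> y \<in> k"
      using all_bounded_imp_constant[OF k(1,2) over(1) f over(2) g over(3,4) inf] by blast
    then show False using k(3) D[OF is_subring_subfield[OF k(1)]] by blast
  qed
  then obtain V where V: "valued k V" "\<not> (bounded_at k V f x \<and> bounded_at k V g y)" by blast
  interpret valued k V by (rule V(1))
  have "\<exists>z\<in>orbit f x \<inter> orbit g y. large C z" if C: "C \<in> L" for C
  proof (cases "bounded_at k V f x")
    case False
    then show ?thesis using unbounded_imp_large_coincidence[OF over(1) f(2) False inf C] by blast
  next
    case True
    then have "\<not> bounded_at k V g y" using V(2) by blast
    moreover have "infinite (orbit g y \<inter> orbit f x)" using inf by (simp add: Int_commute)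
    ultimately show ?thesis using unbounded_imp_large_coincidence[OF over(2) g _ _ C] by blast
  qed
  then show ?thesis using common_iterate_of_large_coincidences[OF over(1) f(1,2) over(2) g inf] by blast
qed

theorem mainTheorem12:
  fixes K :: "'a::{alg_closed_field, field_char_0} set"
    and f g :: "'a poly" and x0 y0 :: 'a
  assumes "is_subfield K"
    and "\<forall>i. coeff f i \<in> K" and "\<forall>i. coeff g i \<in> K"
    and "degree f > 1" and "degree g > 1"
    and "x0 \<in> K" and "y0 \<in> K"
    and "\<not> (\<exists>mu. degree mu = 1 \<and> (\<forall>i. coeff mu i \<in> alg_closure_in K) \<and>
              poly (lin_inv mu) x0 \<in> Qbar \<and> poly (lin_inv mu) y0 \<in> Qbar \<and>
              (\<forall>i. coeff (pcompose (lin_inv mu) (pcompose f mu)) i \<in> Qbar) \<and>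
              (\<forall>i. coeff (pcompose (lin_inv mu) (pcompose g mu)) i \<in> Qbar))"
    and "infinite (orbit f x0 \<inter> orbit g y0)"
  shows "\<exists>a b. a > 0 \<and> b > 0 \<and> poly_iter f a = poly_iter g b"
proof -
  note R = is_subring_subfield[OF assms(1)]
  have fK: "f \<in> polys_over K" and gK: "g \<in> polys_over K" using assms(2,3) by (simp_all add: polys_over_def)
  have df: "degree f \<ge> 2" and dg: "degree g \<ge> 2" using assms(4,5) by simp_all
  obtain \<alpha> \<tau> where c: "\<alpha> \<noteq> 0" "\<alpha> \<in> alg_closure_in K" "\<tau> \<in> alg_closure_in K"
    "degree (affine_conj \<alpha> \<tau> f) = degree f" "coeff (affine_conj \<alpha> \<tau> f) (degree f) = 1"
    "coeff (affine_conj \<alpha> \<tau> f) (degree f - 1) = 0"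
    using exists_centred_conj[OF assms(1) fK df] by metis
  define f1 g1 where "f1 = affine_conj \<alpha> \<tau> f" and "g1 = affine_conj \<alpha> \<tau> g"
  define x1 y1 where "x1 = (x0 - \<tau>) / \<alpha>" and "y1 = (y0 - \<tau>) / \<alpha>"
  have dg1: "degree g1 \<ge> 2" using dg c(1) by (simp add: g1_def affine_conj_def degree_pcompose)
  have "orbit f1 x1 \<inter> orbit g1 y1 = (\<lambda>z. (z - \<tau>) / \<alpha>) ` (orbit f x0 \<inter> orbit g y0)"
    unfolding f1_def g1_def x1_def y1_def orbit_affine_conj[OF c(1)]
    by (rule image_Int[symmetric]) (use c(1) in \<open>auto simp: inj_def\<close>)
  moreover have "inj_on (\<lambda>z. (z - \<tau>) / \<alpha>) (orbit f x0 \<inter> orbit g y0)" using c(1) by (auto simp: inj_on_def)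
  ultimately have inf: "infinite (orbit f1 x1 \<inter> orbit g1 y1)" using assms(9) finite_imageD by metis
  \<comment> \<open>The map \<open>[:\<tau>, \<alpha>:]\<close> that centres \<open>f\<close> is
    itself an admissible \<open>mu\<close>, since its coefficients are algebraic over
    \<open>K\<close>.\<close>
  have ni: "\<not> (f1 \<in> polys_over Qbar \<and> g1 \<in> polys_over Qbar \<and> x1 \<in> Qbar \<and> y1 \<in> Qbar)"
  proof
    assume h: "f1 \<in> polys_over Qbar \<and> g1 \<in> polys_over Qbar \<and> x1 \<in> Qbar \<and> y1 \<in> Qbar"
    have lin: "lin_inv [:\<tau>, \<alpha>:] = [: - \<tau> / \<alpha>, 1 / \<alpha> :]" by (simp add: lin_inv_def)
    have "0 \<in> alg_closure_in K"
      using subset_alg_closure_in[OF assms(1)] subring_0[OF R] by blast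
    then have "\<forall>i. coeff [:\<tau>, \<alpha>:] i \<in> alg_closure_in K"
      using c(2,3) by (auto simp: coeff_pCons split: nat.splits)
    moreover have "degree [:\<tau>, \<alpha>:] = 1" using c(1) by simp
    moreover have "poly (lin_inv [:\<tau>, \<alpha>:]) x0 \<in> Qbar" "poly (lin_inv [:\<tau>, \<alpha>:]) y0 \<in> Qbar"
      using h unfolding lin x1_def y1_def by (simp_all add: diff_divide_distrib)
    moreover have "\<forall>i. coeff (pcompose (lin_inv [:\<tau>, \<alpha>:]) (pcompose f [:\<tau>, \<alpha>:])) i \<in> Qbar"
      "\<forall>i. coeff (pcompose (lin_inv [:\<tau>, \<alpha>:]) (pcompose g [:\<tau>, \<alpha>:])) i \<in> Qbar"
      using h unfolding lin f1_def g1_def affine_conj_def polys_over_def by blast+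
    ultimately show False using assms(8) by blast
  qed
  have "\<exists>a b. a > 0 \<and> b > 0 \<and> poly_iter f1 a = poly_iter g1 b"
    by (rule common_iterate_of_not_isotrivial[OF _ _ _ dg1 inf ni]) (use c(4-6) df in \<open>auto simp: f1_def\<close>)
  then show ?thesis unfolding f1_def g1_def using poly_iter_affine_conj_eq[OF c(1)] by blast
qed

end
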